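(* Let $A=A(\mathcal X)$ be a $\sigma(\mathcal X)$-measurable random field on $\mathbb R^d$, where $\mathcal X$ is a completely independent random field on some measure space $X=\biguplus_{x\in\mathbb Z^d}X_x$ with values in some measurable space $M$. For $x\in\mathbb Z^d$ and $\ell\ge0$ set $X_x^\ell:=\bigcup_{y\in\mathbb Z^d:|x-y|_\infty\le\ell}X_y$. Given an i.i.d. copy $\mathcal X'$ of $\mathcal X$, for $x\in\mathbb Z^d$ and $\ell\in\mathbb N$ let the perturbed field $\mathcal X^{x,\ell}$ be defined by $\mathcal X^{x,\ell}|_{X\setminus X_x^\ell}=\mathcal X|_{X\setminus X_x^\ell}$ and $\mathcal X^{x,\ell}|_{X_x^\ell}=\mathcal X'|_{X_x^\ell}$. Assume that: (a) For all $x,\ell$ there exists an action radius $\rho_x^\ell$ for $A$ with respect to $\mathcal X$ in $X_x^\ell$, that is, a nonnegative random variable $\rho_x^\ell$ such that almost surely $$A(\mathcal X^{x,\ell})|_{\mathbb R^d\setminus(Q_{2\ell+1}(x)+B_{\rho_x^\ell})}=A(\mathcal X)|_{\mathbb R^d\setminus(Q_{2\ell+1}(x)+B_{\rho_x^\ell})}.$$ (b) The transformation $A$ of $\mathcal X$ is stationary, that is, the random fields $A(\mathcal X(\cdot+x,\cdot))$ and $A(\mathcal X)(\cdot+x)$ have the same law for all $x\in\mathbb Z^d$. (c) For all $x,\ell$ the random variable $\rho_x^\ell$ is $\sigma\big(\mathcal X|_{X_x^{\ell+\rho_x^\ell}\setminus X_x^\ell}\big)$-measurable, in the sense that for all $r\ge0$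 the event $\{\rho_x^\ell>r\}$ belongs to $\sigma\big(\mathcal X|_{X_x^{\ell+r}\setminus X_x^\ell}\big)$. Assume that $R\ge1$ can be chosen large enough so that $\sup_{\ell\ge R}\mathbb P[\rho_x^\ell\ge\ell]\le\frac14$ (for all $x$). Let $\pi_0:\mathbb R_+\to\mathbb R_+$ be a non-increasing function such that $\mathbb P[\frac14\ell\le\rho_x^{\ell_0}<\ell]\le\pi_0(\ell)$ holds for all $0\le\ell_0\le\frac14\ell$ (and all $x$), and define $$\pi(\ell):=(\ell+1)^d\begin{cases}1,&\text{if }\ell\le4R;\\ 8\ell^{-1}\pi_0(\tfrac12\ell),&\text{if }\ell>4R.\end{cases}$$ Then for all $\sigma(A)$-measurable random variables $Z(A)$, $$\mathrm{Var}[Z(A)]\le\frac12\,\mathbb E\left[\int_0^\infty\int_{\mathbb R^d}\Big(\partial^{\mathrm{osc}}_{A,B_{\sqrt d(\ell+1)}(x)}Z(A)\Big)^2dx\,(\ell+1)^{-d}\pi(\ell)\,d\ell\right],$$ $$\mathrm{Ent}[Z(A)^2]\le2\,\mathbb E\left[\int_0^\infty\int_{\mathbb R^d}\Big(\partial^{\mathrm{osc}}_{A,B_{\sqrt d(\ell+1)}(x)}Z(A)\Big)^2dx\,(\ell+1)^{-d}\pi(\ell)\,d\ell\right].$$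
   Context: $\mathbb N=\{0,1,2,\dots\}$; $Q:=[-\frac12,\frac12)^d$, $Q_r(x):=x+rQ$; $B_r(x)$ is the Euclidean ball of radius $r$ centered at $x$, $B_r:=B_r(0)$. The field $A:\mathbb R^d\times\Omega\to\mathbb R$ is jointly measurable on a probability space $(\Omega,\mathcal A,\mathbb P)$; $A(\mathcal X^{x,\ell})$ denotes the same measurable function applied to the perturbed field. Complete independence of $\mathcal X$: the restrictions $(\mathcal X|_{X_x})_{x\in\mathbb Z^d}$ are all independent. $\mathcal X(\cdot+x,\cdot)$ denotes the field translated by $x\in\mathbb Z^d$ (pieces $X_y$ being mapped to $X_{y+x}$ by translation). Action radii are $\sigma(\mathcal X,\mathcal X')$-measurable. Entropy: $\mathrm{Ent}[Z^2]:=\mathbb E\big[Z^2\log\frac{Z^2}{\mathbb E[Z^2]}\big]$. Oscillation: for Borel $S\subset\mathbb R^d$, $\partial^{\mathrm{osc}}_{A,S}Z(A):=\mathcal M[Z\,\|\,A|_{\mathbb R^d\setminus S}]+\mathcal M[-Z\,\|\,A|_{\mathbb R^d\setminus S}]$, where $\mathcal M[Y\|A|_{\mathbb R^d\setminus S}]$ is the conditional essential supremum of $Y$ given $\sigma(A|_{\mathbb R^d\setminus S})$, that is, the a.s. smallest $\sigma(A|_{\mathbb R^d\setminus S})$-measurable extended real random variable that is a.s. $\ge Y$. The inequalities are understood for those $Z(A)$ for which the left-hand side makes sense. *)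

theory Defs
  imports "HOL-Probability.Probability"
begin

section \<open>Geometry of the lattice and of Euclidean space\<close>

definition of_lattice :: "int ^ 'd \<Rightarrow> real ^ 'd" where
  "of_lattice z = (\<chi> i. real_of_int (z $ i))"

definition unit_cube :: "(real ^ 'd) set" where
  "unit_cube = {y. \<forall>i. - (1 / 2) \<le> y $ i \<and> y $ i < 1 / 2}"

definition cube :: "real \<Rightarrow> real ^ 'd \<Rightarrow> (real ^ 'd) set" where
  "cube r x = (\<lambda>y. x + r *\<^sub>R y) ` unit_cube"

section \<open>Random fields\<close>

text \<open>A random field on a set \<open>T\<close> with values in \<open>N\<close> is a random element of the product space
  \<open>PiM T (\<lambda>_. N)\<close>.\<close>

definition sigma_restrict ::
    "'w measure \<Rightarrow> ('w \<Rightarrow> 't \<Rightarrow> 's) \<Rightarrow> 's measure \<Rightarrow> 't set \<Rightarrow> 'w measure" where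
  "sigma_restrict M Y N T =
     vimage_algebra (space M) (\<lambda>\<omega>. restrict (Y \<omega>) T) (PiM T (\<lambda>_. N))"

definition lattice_partition :: "'i measure \<Rightarrow> (int ^ 'd \<Rightarrow> 'i set) \<Rightarrow> bool" where
  "lattice_partition E P \<longleftrightarrow>
     (\<forall>z. P z \<in> sets E) \<and> disjoint_family P \<and> (\<Union>z. P z) = space E"

definition lattice_translation ::
    "'i measure \<Rightarrow> (int ^ 'd \<Rightarrow> 'i set) \<Rightarrow> (int ^ 'd \<Rightarrow> 'i \<Rightarrow> 'i) \<Rightarrow> bool" where
  "lattice_translation E P \<tau> \<longleftrightarrow>
     (\<forall>z. \<tau> z \<in> E \<rightarrow>\<^sub>M E) \<and>
     (\<forall>t\<in>space E. \<tau> 0 t = t) \<and>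
     (\<forall>y z. \<forall>t\<in>space E. \<tau> (y + z) t = \<tau> y (\<tau> z t)) \<and>
     (\<forall>y z. \<tau> z ` P y = P (y + z))"

definition nbhd :: "(int ^ 'd \<Rightarrow> 'i set) \<Rightarrow> int ^ 'd \<Rightarrow> real \<Rightarrow> 'i set" where
  "nbhd P x l = (\<Union>y\<in>{y. infnorm (of_lattice x - of_lattice y) \<le> l}. P y)"

definition completely_independent ::
    "'w measure \<Rightarrow> 'm measure \<Rightarrow> (int ^ 'd \<Rightarrow> 'i set) \<Rightarrow> ('w \<Rightarrow> 'i \<Rightarrow> 'm) \<Rightarrow> bool" where
  "completely_independent M N P X \<longleftrightarrow>
     prob_space.indep_vars M (\<lambda>z. PiM (P z) (\<lambda>_. N)) (\<lambda>z \<omega>. restrict (X \<omega>) (P z)) UNIV"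

definition iid_copy ::
    "'w measure \<Rightarrow> 'i measure \<Rightarrow> 'm measure \<Rightarrow> ('w \<Rightarrow> 'i \<Rightarrow> 'm) \<Rightarrow> ('w \<Rightarrow> 'i \<Rightarrow> 'm) \<Rightarrow> bool" where
  "iid_copy M E N X X' \<longleftrightarrow>
     prob_space.indep_var M (PiM (space E) (\<lambda>_. N)) X (PiM (space E) (\<lambda>_. N)) X' \<and>
     distr M (PiM (space E) (\<lambda>_. N)) X' = distr M (PiM (space E) (\<lambda>_. N)) X"

definition perturb ::
    "('w \<Rightarrow> 'i \<Rightarrow> 'm) \<Rightarrow> ('w \<Rightarrow> 'i \<Rightarrow> 'm) \<Rightarrow> 'i set \<Rightarrow> 'w \<Rightarrow> 'i \<Rightarrow> 'm" where
  "perturb X X' S \<omega> = (\<lambda>t. if t \<in> S then X' \<omega> t else X \<omega> t)"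

text \<open>Balls are closed throughout. In particular \<open>Q + B\<^sub>0\<close> is the cube \<open>Q\<close> itself, so that the
  value \<open>0\<close> of an action radius means that the perturbation acts only inside the cube.\<close>

definition action_radius ::
    "'w measure \<Rightarrow> 'i measure \<Rightarrow> 'm measure \<Rightarrow> (int ^ 'd \<Rightarrow> 'i set) \<Rightarrow>
     ('w \<Rightarrow> 'i \<Rightarrow> 'm) \<Rightarrow> ('w \<Rightarrow> 'i \<Rightarrow> 'm) \<Rightarrow> (('i \<Rightarrow> 'm) \<Rightarrow> real ^ 'd \<Rightarrow> real) \<Rightarrow>
     int ^ 'd \<Rightarrow> nat \<Rightarrow> ('w \<Rightarrow> real) \<Rightarrow> bool" where
  "action_radius M E N P X X' A x l \<rho> \<longleftrightarrow>
     \<rho> \<in> borel_measurable (vimage_algebra (space M) (\<lambda>\<omega>. (X \<omega>, X' \<omega>))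
            (PiM (space E) (\<lambda>_. N) \<Otimes>\<^sub>M PiM (space E) (\<lambda>_. N))) \<and>
     (\<forall>\<omega>\<in>space M. 0 \<le> \<rho> \<omega>) \<and>
     (AE \<omega> in M. \<forall>y\<in>UNIV - (cube (2 * real l + 1) (of_lattice x) + cball 0 (\<rho> \<omega>)).
        A (perturb X X' (nbhd P x (real l)) \<omega>) y = A (X \<omega>) y)"

definition stationary_transformation ::
    "'w measure \<Rightarrow> 'i measure \<Rightarrow> (int ^ 'd \<Rightarrow> 'i \<Rightarrow> 'i) \<Rightarrow>
     ('w \<Rightarrow> 'i \<Rightarrow> 'm) \<Rightarrow> (('i \<Rightarrow> 'm) \<Rightarrow> real ^ 'd \<Rightarrow> real) \<Rightarrow> bool" where
  "stationary_transformation M E \<tau> X A \<longleftrightarrow>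
     (\<forall>x. distr M (PiM UNIV (\<lambda>_. borel)) (\<lambda>\<omega>. A (\<lambda>t\<in>space E. X \<omega> (\<tau> x t))) =
          distr M (PiM UNIV (\<lambda>_. borel)) (\<lambda>\<omega> y. A (X \<omega>) (y + of_lattice x)))"

section \<open>Variance and entropy\<close>

text \<open>Both are extended-valued: the variance is \<open>\<infinity>\<close> if \<open>Z\<close> is integrable but not square
  integrable; the entropy of an integrable \<open>Y \<ge> 0\<close> is an expectation in
  \<open>(-\<infinity>, \<infinity>]\<close>, because \<open>Y log (Y / \<bbbE>[Y])\<close> is bounded below.
  Note \<open>0 * ln 0 = 0\<close>.\<close>

definition ext_variance :: "'w measure \<Rightarrow> ('w \<Rightarrow> real) \<Rightarrow> ennreal" where
  "ext_variance M Z = (\<integral>\<^sup>+\<omega>. ennreal ((Z \<omega> - (\<integral>\<omega>'. Z \<omega>' \<partial>M))\<^sup>2) \<partial>M)"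

definition ext_expectation :: "'w measure \<Rightarrow> ('w \<Rightarrow> real) \<Rightarrow> ereal" where
  "ext_expectation M f =
     enn2ereal (\<integral>\<^sup>+\<omega>. ennreal (f \<omega>) \<partial>M) - enn2ereal (\<integral>\<^sup>+\<omega>. ennreal (- f \<omega>) \<partial>M)"

definition ext_entropy :: "'w measure \<Rightarrow> ('w \<Rightarrow> real) \<Rightarrow> ereal" where
  "ext_entropy M Y = ext_expectation M (\<lambda>\<omega>. Y \<omega> * ln (Y \<omega> / (\<integral>\<omega>'. Y \<omega>' \<partial>M)))"

section \<open>Conditional essential supremum and oscillation\<close>

definition is_cond_esssup ::
    "'w measure \<Rightarrow> 'w measure \<Rightarrow> ('w \<Rightarrow> ereal) \<Rightarrow> ('w \<Rightarrow> ereal) \<Rightarrow> bool" where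
  "is_cond_esssup M F Y U \<longleftrightarrow>
     U \<in> borel_measurable F \<and> (AE \<omega> in M. Y \<omega> \<le> U \<omega>) \<and>
     (\<forall>V\<in>borel_measurable F. (AE \<omega> in M. Y \<omega> \<le> V \<omega>) \<longrightarrow> (AE \<omega> in M. U \<omega> \<le> V \<omega>))"

definition cond_esssup :: "'w measure \<Rightarrow> 'w measure \<Rightarrow> ('w \<Rightarrow> ereal) \<Rightarrow> 'w \<Rightarrow> ereal" where
  "cond_esssup M F Y = (SOME U. is_cond_esssup M F Y U)"

definition osc ::
    "'w measure \<Rightarrow> ('w \<Rightarrow> 'v::euclidean_space \<Rightarrow> real) \<Rightarrow> 'v set \<Rightarrow> ('w \<Rightarrow> real) \<Rightarrow> 'w \<Rightarrow> ereal" where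
  "osc M A S Z \<omega> =
     cond_esssup M (sigma_restrict M A borel (UNIV - S)) (\<lambda>\<omega>. ereal (Z \<omega>)) \<omega> +
     cond_esssup M (sigma_restrict M A borel (UNIV - S)) (\<lambda>\<omega>. ereal (- Z \<omega>)) \<omega>"

text \<open>For fixed \<open>x\<close> and \<open>l\<close> the oscillation is only defined up to null events. To integrate it
  over \<open>x\<close> and \<open>l\<close> for fixed \<open>\<omega>\<close> one has to choose these representatives in a jointly measurable
  way. By Tonelli's theorem, the resulting expectation does not depend on the choice; such a
  choice always exists, see \<open>osc_version_exists\<close> below.\<close>

definition osc_version ::
    "'w measure \<Rightarrow> ('w \<Rightarrow> real ^ 'd \<Rightarrow> real) \<Rightarrow> ('w \<Rightarrow> real) \<Rightarrow>
     (real ^ 'd \<Rightarrow> real \<Rightarrow> 'w \<Rightarrow> ereal) \<Rightarrow> bool" where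
  "osc_version M A Z D \<longleftrightarrow>
     (\<lambda>((x, l), \<omega>). D x l \<omega>) \<in> borel_measurable ((borel \<Otimes>\<^sub>M borel) \<Otimes>\<^sub>M M) \<and>
     (AE (x, l) in lborel \<Otimes>\<^sub>M lborel. 0 \<le> l \<longrightarrow>
        (AE \<omega> in M. D x l \<omega> = osc M A (cball x (sqrt (real CARD('d)) * (l + 1))) Z \<omega>))"

definition multiscale_osc ::
    "'w measure \<Rightarrow> (real \<Rightarrow> real) \<Rightarrow> (real ^ 'd \<Rightarrow> real \<Rightarrow> 'w \<Rightarrow> ereal) \<Rightarrow> ennreal" where
  "multiscale_osc M w D =
     (\<integral>\<^sup>+\<omega>. (\<integral>\<^sup>+l\<in>{0..}. ((\<integral>\<^sup>+x. e2ennreal ((D x l \<omega>)\<^sup>2) \<partial>lborel)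
                * ennreal (inverse ((l + 1) ^ CARD('d)) * w l)) \<partial>lborel) \<partial>M)"

definition weight :: "nat \<Rightarrow> real \<Rightarrow> (real \<Rightarrow> real) \<Rightarrow> real \<Rightarrow> real" where
  "weight d R \<pi>\<^sub>0 l = (l + 1) ^ d * (if l \<le> 4 * R then 1 else 8 / l * \<pi>\<^sub>0 (l / 2))"

section \<open>Existence of conditional essential suprema and of jointly measurable oscillations\<close>

definition squash :: "ereal \<Rightarrow> real" where
  "squash u = (if u = \<infinity> then 2 else if u = - \<infinity> then - 2 else arctan (real_of_ereal u))"

lemma arctan_less_2: "- 2 < arctan x" "arctan x < 2"
  using arctan_bounded[of x] pi_less_4 by auto

lemma squash_bound: "\<bar>squash u\<bar> \<le> 2"
  unfolding squash_def using arctan_less_2[of "real_of_ereal u"] by auto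

lemma squash_strict_mono: "u < v \<Longrightarrow> squash u < squash v"
  using arctan_less_2 by (cases u; cases v) (auto simp: squash_def arctan_less_iff)

lemma squash_mono: "u \<le> v \<Longrightarrow> squash u \<le> squash v"
  using squash_strict_mono[of u v] by (auto simp: le_less)

lemma squash_eq_iff: "squash u = squash v \<longleftrightarrow> u = v"
  by (metis less_irrefl linorder_neqE squash_strict_mono)

lemma squash_measurable [measurable]: "squash \<in> borel_measurable borel"
proof -
  have "arctan \<in> borel_measurable borel"
    by (intro borel_measurable_continuous_onI continuous_intros)
  then have [measurable]: "(\<lambda>u. arctan (real_of_ereal u)) \<in> borel_measurable borel"
    by (rule measurable_compose[rotated]) simp
  show ?thesis unfolding squash_def by measurable
qed

lemma (in prob_space) integrable_squash:
  "U \<in> borel_measurable M \<Longrightarrow> integrable M (\<lambda>\<omega>. squash (U \<omega>))"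
  by (rule integrable_const_bound[where B = 2]) (auto intro: squash_bound)

lemma (in prob_space) squash_integral_mono:
  assumes "U \<in> borel_measurable M" "V \<in> borel_measurable M" "AE \<omega> in M. U \<omega> \<le> V \<omega>"
  shows "(\<integral>\<omega>. squash (U \<omega>) \<partial>M) \<le> (\<integral>\<omega>. squash (V \<omega>) \<partial>M)"
  using assms by (intro integral_mono_AE integrable_squash) (auto intro: squash_mono)

lemma (in prob_space) squash_integral_eq:
  assumes U: "U \<in> borel_measurable M" and V: "V \<in> borel_measurable M"
    and le: "AE \<omega> in M. U \<omega> \<le> V \<omega>"
    and eq: "(\<integral>\<omega>. squash (V \<omega>) \<partial>M) \<le> (\<integral>\<omega>. squash (U \<omega>) \<partial>M)"
  shows "AE \<omega> in M. U \<omega> = V \<omega>"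
proof -
  let ?f = "\<lambda>\<omega>. squash (V \<omega>) - squash (U \<omega>)"
  have int: "integrable M ?f"
    using integrable_squash[OF U] integrable_squash[OF V] by auto
  have nn: "AE \<omega> in M. 0 \<le> ?f \<omega>"
    using le by eventually_elim (simp add: squash_mono)
  have "(\<integral>\<omega>. ?f \<omega> \<partial>M) \<le> 0"
    using integrable_squash[OF U] integrable_squash[OF V] eq by simp
  moreover have "0 \<le> (\<integral>\<omega>. ?f \<omega> \<partial>M)" by (rule integral_nonneg_AE[OF nn])
  ultimately have "(\<integral>\<omega>. ?f \<omega> \<partial>M) = 0" by simp
  then have "AE \<omega> in M. ?f \<omega> = 0"
    using integral_nonneg_eq_0_iff_AE[OF int nn] by simp
  then show ?thesis by eventually_elim (simp add: squash_eq_iff)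
qed

lemma (in prob_space) is_cond_esssup_exists:
  assumes F: "subalgebra M F"
  shows "\<exists>U. is_cond_esssup M F Y U"
proof -
  define C where "C = {U \<in> borel_measurable F. AE \<omega> in M. Y \<omega> \<le> U \<omega>}"
  define I where "I U = (\<integral>\<omega>. squash (U \<omega>) \<partial>M)" for U :: "'a \<Rightarrow> ereal"
  have CM: "U \<in> borel_measurable M" if "U \<in> C" for U
    using that measurable_from_subalg[OF F] by (auto simp: C_def)
  have "(\<lambda>_. \<infinity>) \<in> C" by (simp add: C_def)
  then have ne: "I ` C \<noteq> {}" by blast
  have "- 2 \<le> I U" if "U \<in> C" for U
  proof -
    have "(\<integral>\<omega>. - 2 \<partial>M) \<le> I U"
      unfolding I_def using integrable_squash[OF CM[OF that]] squash_bound
      by (intro integral_mono) (auto simp: abs_le_iff minus_le_iff)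
    then show ?thesis by (simp add: prob_space)
  qed
  then have bdd: "bdd_below (I ` C)" by (intro bdd_belowI2[where m = "- 2"])
  have "\<exists>U\<in>C. I U < Inf (I ` C) + 1 / real (Suc n)" for n
    using cInf_lessD[OF ne, of "Inf (I ` C) + 1 / real (Suc n)"] by auto
  then obtain U where U: "\<And>n. U n \<in> C" "\<And>n. I (U n) < Inf (I ` C) + 1 / real (Suc n)"
    by metis
  define W where "W \<omega> = (INF n. U n \<omega>)" for \<omega>
  have "W \<in> borel_measurable F"
    unfolding W_def using U(1) by (intro borel_measurable_INF) (auto simp: C_def)
  moreover have "AE \<omega> in M. \<forall>n. Y \<omega> \<le> U n \<omega>"
    using U(1) by (auto simp: C_def AE_all_countable)
  then have "AE \<omega> in M. Y \<omega> \<le> W \<omega>"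
    by eventually_elim (auto simp: W_def intro: INF_greatest)
  ultimately have WC: "W \<in> C" by (simp add: C_def)
  have *: "I W \<le> Inf (I ` C) + 1 / real (Suc n)" for n
  proof -
    have "I W \<le> I (U n)"
      unfolding I_def
      by (intro squash_integral_mono CM WC U(1)) (auto simp: W_def intro: INF_lower)
    then show ?thesis using U(2)[of n] by simp
  qed
  have Wmin: "I W \<le> Inf (I ` C)"
  proof (rule field_le_epsilon)
    fix e :: real assume "0 < e"
    then obtain n where "1 / real (Suc n) < e" using nat_approx_posE by metis
    then show "I W \<le> Inf (I ` C) + e" using *[of n] by simp
  qed
  have "AE \<omega> in M. W \<omega> \<le> V \<omega>" if V: "V \<in> borel_measurable F" "AE \<omega> in M. Y \<omega> \<le> V \<omega>" for V
  proof -
    let ?m = "\<lambda>\<omega>. min (W \<omega>) (V \<omega>)"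
    have "AE \<omega> in M. Y \<omega> \<le> ?m \<omega>"
      using V(2) \<open>AE \<omega> in M. Y \<omega> \<le> W \<omega>\<close> by eventually_elim simp
    then have mC: "?m \<in> C" using V(1) WC by (auto simp: C_def)
    have "I W \<le> I ?m" using Wmin cINF_lower[OF bdd mC] by simp
    then have "AE \<omega> in M. ?m \<omega> = W \<omega>"
      unfolding I_def by (intro squash_integral_eq CM mC WC) auto
    then show ?thesis by eventually_elim (metis min.cobounded2)
  qed
  then have "is_cond_esssup M F Y W"
    using WC by (auto simp: is_cond_esssup_def C_def)
  then show ?thesis by blast
qed

lemma (in prob_space) cond_esssup:
  "subalgebra M F \<Longrightarrow> is_cond_esssup M F Y (cond_esssup M F Y)"
  unfolding cond_esssup_def by (rule someI_ex[OF is_cond_esssup_exists])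

lemma (in prob_space) cond_esssup_antimono:
  assumes F: "subalgebra M F" "subalgebra M G" "subalgebra F G"
  shows "AE \<omega> in M. cond_esssup M F Y \<omega> \<le> cond_esssup M G Y \<omega>"
  using cond_esssup[OF F(1), of Y] cond_esssup[OF F(2), of Y] measurable_from_subalg[OF F(3)]
  unfolding is_cond_esssup_def by blast

lemma subalgebra_sigma_restrict:
  assumes Y: "Y \<in> M \<rightarrow>\<^sub>M PiM T (\<lambda>_. N)" and "S \<subseteq> T"
  shows "subalgebra M (sigma_restrict M Y N S)"
proof -
  have "(\<lambda>\<omega>. restrict (Y \<omega>) S) \<in> M \<rightarrow>\<^sub>M PiM S (\<lambda>_. N)"
    by (rule measurable_compose[OF Y measurable_restrict_subset[OF \<open>S \<subseteq> T\<close>]])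
  then show ?thesis
    unfolding subalgebra_def sigma_restrict_def by (auto dest: sets_image_in_sets[OF refl])
qed

lemma subalgebra_sigma_restrict_mono:
  assumes Y: "Y \<in> M \<rightarrow>\<^sub>M PiM T (\<lambda>_. N)" and S: "S \<subseteq> S'" "S' \<subseteq> T"
  shows "subalgebra (sigma_restrict M Y N S') (sigma_restrict M Y N S)"
proof -
  have "(\<lambda>\<omega>. restrict (Y \<omega>) S') \<in> M \<rightarrow>\<^sub>M PiM S' (\<lambda>_. N)"
    by (rule measurable_compose[OF Y measurable_restrict_subset[OF S(2)]])
  then have "(\<lambda>\<omega>. restrict (Y \<omega>) S') \<in> sigma_restrict M Y N S' \<rightarrow>\<^sub>M PiM S' (\<lambda>_. N)"
    unfolding sigma_restrict_def by (intro measurable_vimage_algebra1) (auto dest: measurable_space)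
  from measurable_compose[OF this measurable_restrict_subset[OF S(1)]]
  have "(\<lambda>\<omega>. restrict (Y \<omega>) S) \<in> sigma_restrict M Y N S' \<rightarrow>\<^sub>M PiM S (\<lambda>_. N)"
    using S(1) by (simp add: Int_absorb1)
  then show ?thesis
    unfolding subalgebra_def
    by (auto simp: sigma_restrict_def[of M Y N S] sigma_restrict_def[of M Y N S']
        dest!: sets_image_in_sets[rotated, where X = "space M"])
qed

lemma (in prob_space) osc_measurable:
  assumes A: "A \<in> M \<rightarrow>\<^sub>M PiM UNIV (\<lambda>_. borel)"
  shows "osc M A S Z \<in> borel_measurable M"
proof -
  have F: "subalgebra M (sigma_restrict M A borel (UNIV - S))"
    by (rule subalgebra_sigma_restrict[OF A]) simp
  have "cond_esssup M (sigma_restrict M A borel (UNIV - S)) Y \<in> borel_measurable M" for Y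
    using cond_esssup[OF F, of Y] measurable_from_subalg[OF F]
    unfolding is_cond_esssup_def by blast
  then show ?thesis unfolding osc_def[abs_def] by measurable
qed

lemma (in prob_space) osc_mono:
  assumes A: "A \<in> M \<rightarrow>\<^sub>M PiM UNIV (\<lambda>_. borel)" and "S \<subseteq> S'"
  shows "AE \<omega> in M. osc M A S Z \<omega> \<le> osc M A S' Z \<omega>"
proof -
  let ?F = "sigma_restrict M A borel (UNIV - S)" and ?F' = "sigma_restrict M A borel (UNIV - S')"
  have *: "AE \<omega> in M. cond_esssup M ?F Y \<omega> \<le> cond_esssup M ?F' Y \<omega>" for Y
    using \<open>S \<subseteq> S'\<close>
    by (intro cond_esssup_antimono subalgebra_sigma_restrict[OF A]
        subalgebra_sigma_restrict_mono[OF A]) auto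
  show ?thesis
    using *[of "\<lambda>\<omega>. ereal (Z \<omega>)"] *[of "\<lambda>\<omega>. ereal (- Z \<omega>)"]
    by eventually_elim (auto simp: osc_def intro: add_mono)
qed

theorem osc_version_exists:
  fixes A :: "'w \<Rightarrow> real ^ 'd \<Rightarrow> real"
  assumes "prob_space M" and A: "A \<in> M \<rightarrow>\<^sub>M PiM UNIV (\<lambda>_. borel)"
  shows "\<exists>D. osc_version M A Z D"
proof -
  interpret prob_space M by fact
  define r where "r l = sqrt (real CARD('d)) * (l + 1)" for l
  have r_less: "r l < r l'" if "l < l'" for l l'
    using that by (simp add: r_def)
  have r_meas [measurable]: "r \<in> borel_measurable borel"
    unfolding r_def by measurable
  obtain B :: "(real ^ 'd) set" where B: "countable B"
      "\<And>S. open S \<Longrightarrow> S \<noteq> {} \<Longrightarrow> \<exists>b\<in>B. b \<in> S"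
    by (rule countable_dense_setE) blast
  define I where "I = B \<times> (\<rat> :: real set)"
  have I: "countable I" using B(1) by (simp add: I_def countable_rat)
  define D where "D x l \<omega> = (INF (q, s)\<in>I. if dist x q + r l \<le> s
      then osc M A (cball q s) Z \<omega> else \<infinity>)" for x l \<omega>
  note osc_measurable[OF A, measurable]
  have D_meas [measurable]: "(\<lambda>((x, l), \<omega>). D x l \<omega>) \<in> borel_measurable ((borel \<Otimes>\<^sub>M borel) \<Otimes>\<^sub>M M)"
    unfolding D_def case_prod_beta
    using I by (intro borel_measurable_INF) (auto simp: split: prod.splits)
  have D_meas1 [measurable]: "D x l \<in> borel_measurable M" for x l
    unfolding D_def case_prod_beta using I by (intro borel_measurable_INF) auto
  have lower: "AE \<omega> in M. osc M A (cball x (r l)) Z \<omega> \<le> D x l \<omega>" for x l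
  proof -
    have "AE \<omega> in M. \<forall>p\<in>I. osc M A (cball x (r l)) Z \<omega> \<le>
        (if dist x (fst p) + r l \<le> snd p then osc M A (cball (fst p) (snd p)) Z \<omega> else \<infinity>)"
      unfolding AE_ball_countable[OF I]
    proof
      fix p assume "p \<in> I"
      show "AE \<omega> in M. osc M A (cball x (r l)) Z \<omega> \<le>
        (if dist x (fst p) + r l \<le> snd p then osc M A (cball (fst p) (snd p)) Z \<omega> else \<infinity>)"
      proof (cases "dist x (fst p) + r l \<le> snd p")
        case True
        then have "cball x (r l) \<subseteq> cball (fst p) (snd p)"
          by (simp add: cball_subset_cball_iff)
        from osc_mono[OF A this] show ?thesis using True by simp
      qed simp
    qed
    then show ?thesis
      by eventually_elim (fastforce simp: D_def intro!: INF_greatest)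
  qed
  have upper: "AE \<omega> in M. D x l \<omega> \<le> osc M A (cball x (r l')) Z \<omega>" if "l < l'" for x l l'
  proof -
    define e where "e = (r l' - r l) / 4"
    have e: "0 < e" using r_less[OF that] by (simp add: e_def)
    obtain q where q: "q \<in> B" "dist x q < e" using B(2)[of "ball x e"] e by auto
    obtain s where s: "s \<in> \<rat>" "r l + e < s" "s < r l + 2 * e"
      using Rats_dense_in_real[of "r l + e" "r l + 2 * e"] e by auto
    have "cball q s \<subseteq> cball x (r l')"
      using q s e by (simp add: cball_subset_cball_iff dist_commute e_def field_simps)
    from osc_mono[OF A this] have "AE \<omega> in M. osc M A (cball q s) Z \<omega> \<le> osc M A (cball x (r l')) Z \<omega>" .
    moreover have "D x l \<omega> \<le> osc M A (cball q s) Z \<omega>" for \<omega>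
      unfolding D_def using q s by (intro INF_lower2[of "(q, s)"]) (auto simp: I_def)
    ultimately show ?thesis by (auto elim: eventually_mono intro: order_trans)
  qed
  have D_mono: "D x l \<omega> \<le> D x l' \<omega>" if "l \<le> l'" for x l l' \<omega>
  proof -
    have "r l \<le> r l'" using that r_less[of l l'] by (cases "l = l'") auto
    then show ?thesis unfolding D_def by (intro INF_mono') auto
  qed
  define H where "H x l = (\<integral>\<omega>. squash (D x l \<omega>) \<partial>M)" for x l
  have H_mono: "H x l \<le> H x l'" if "l \<le> l'" for x l l'
    unfolding H_def using D_mono[OF that] by (intro squash_integral_mono) auto
  have H_meas: "(\<lambda>p. H (fst p) (snd p)) \<in> borel_measurable (borel \<Otimes>\<^sub>M borel)"
  proof -
    have "(\<lambda>p. squash ((\<lambda>((x, l), \<omega>). D x l \<omega>) p)) \<in> borel_measurable ((borel \<Otimes>\<^sub>M borel) \<Otimes>\<^sub>M M)"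
      by measurable
    then have "(\<lambda>(p, \<omega>). squash (D (fst p) (snd p) \<omega>)) \<in> borel_measurable ((borel \<Otimes>\<^sub>M borel) \<Otimes>\<^sub>M M)"
      by (simp add: case_prod_beta)
    then show ?thesis unfolding H_def by (rule borel_measurable_lebesgue_integral)
  qed
  define G where "G p \<longleftrightarrow> (\<forall>k::nat. \<exists>n::nat.
      H (fst p) (snd p) < H (fst p) (snd p - 1 / real (Suc n)) + 1 / real (Suc k))" for p
  have H_meas': "(\<lambda>p. H (fst p) (snd p - c)) \<in> borel_measurable (borel \<Otimes>\<^sub>M borel)" for c
    using measurable_compose[of "\<lambda>p. (fst p, snd p - c)", OF _ H_meas] by simp
  have G_meas: "{p\<in>space (lborel \<Otimes>\<^sub>M lborel). G p} \<in> sets (lborel \<Otimes>\<^sub>M lborel)"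
  proof -
    note [measurable] = H_meas H_meas'
    have "Measurable.pred (borel \<Otimes>\<^sub>M borel) G" unfolding G_def by measurable
    then have "{p\<in>space (borel \<Otimes>\<^sub>M borel). G p} \<in> sets (borel \<Otimes>\<^sub>M borel)" by measurable
    then show ?thesis
      by (simp add: space_pair_measure sets_pair_measure_cong[OF sets_lborel sets_lborel])
  qed
  have "AE l in lborel. G (x, l)" for x
  proof -
    have "countable {l. \<not> isCont (H x) l}"
      by (rule mono_ctble_discont) (auto intro: monoI H_mono)
    then have "AE l in lborel. l \<notin> {l. \<not> isCont (H x) l}"
      by (intro AE_not_in countable_imp_null_set_lborel)
    then show ?thesis
    proof eventually_elim
      case (elim l)
      have "(\<lambda>n. l - 1 / real (Suc n)) \<longlonglongrightarrow> l - 0"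
        by (intro tendsto_intros LIMSEQ_Suc[OF lim_1_over_n])
      then have lim: "(\<lambda>n. H x (l - 1 / real (Suc n))) \<longlonglongrightarrow> H x l"
        using elim by (auto intro: isCont_tendsto_compose)
      show ?case
        unfolding G_def
      proof
        fix k
        have "\<forall>\<^sub>F n in sequentially. H x l - 1 / real (Suc k) < H x (l - 1 / real (Suc n))"
          by (rule order_tendstoD[OF lim]) simp
        then obtain n where "H x l - 1 / real (Suc k) < H x (l - 1 / real (Suc n))"
          by (auto dest: eventually_happens)
        then show "\<exists>n. H (fst (x, l)) (snd (x, l))
            < H (fst (x, l)) (snd (x, l) - 1 / real (Suc n)) + 1 / real (Suc k)"
          by (auto simp: algebra_simps)
      qed
    qed
  qed
  then have "AE p in lborel \<Otimes>\<^sub>M lborel. G p"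
    by (intro lborel_pair.AE_pair_measure G_meas) auto
  moreover have "AE \<omega> in M. D x l \<omega> = osc M A (cball x (r l)) Z \<omega>" if G: "G (x, l)" for x l
  proof -
    let ?g = "\<integral>\<omega>. squash (osc M A (cball x (r l)) Z \<omega>) \<partial>M"
    have "H x l \<le> ?g"
    proof (rule field_le_epsilon)
      fix e :: real assume "0 < e"
      then obtain k where k: "1 / real (Suc k) < e" using nat_approx_posE by metis
      from G obtain n where "H x l < H x (l - 1 / real (Suc n)) + 1 / real (Suc k)"
        by (auto simp: G_def)
      moreover have "H x (l - 1 / real (Suc n)) \<le> ?g"
        unfolding H_def
        by (intro squash_integral_mono upper osc_measurable[OF A] D_meas1) simp
      ultimately show "H x l \<le> ?g + e" using k by simp
    qed
    then have "AE \<omega> in M. osc M A (cball x (r l)) Z \<omega> = D x l \<omega>"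
      unfolding H_def
      by (intro squash_integral_eq lower osc_measurable[OF A] D_meas1)
    then show ?thesis by eventually_elim simp
  qed
  ultimately have "AE (x, l) in lborel \<Otimes>\<^sub>M lborel.
      AE \<omega> in M. D x l \<omega> = osc M A (cball x (r l)) Z \<omega>"
    by (auto elim!: eventually_mono)
  then have "osc_version M A Z D"
    unfolding osc_version_def using D_meas by (auto simp: r_def elim!: eventually_mono)
  then show ?thesis by blast
qed

end

theory Submission
  imports Defs
begin

text \<open>Both inequalities are obtained by tensorization over the lattice cells, followed by a decoupling
  argument that removes the randomness of the action radius.

  Let \<open>L\<close> be the law of the field \<open>X\<close>, and let \<open>\<xi>\<close>, \<open>\<eta>\<close> be independent configurations with law \<open>L\<close>.
  Complete independence means that exchanging the values of \<open>\<xi>\<close> and \<open>\<eta>\<close> on any union of cells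
  preserves the joint law (\<open>distr_swap\<close>). Replacing the cells of \<open>\<xi>\<close> by those of \<open>\<eta>\<close> one after the
  other and telescoping, one gets \<open>variance_le\<close> and \<open>entropy_le\<close>: if \<open>w k\<close> dominates the squared effect
  on the observable of resampling the cell \<open>k\<close>, then the variance is at most \<open>1 / 2\<close> and the entropy
  of the square at most \<open>2\<close> times the sum of the expectations of the \<open>w k\<close>.

  Resampling a cell leaves the field unchanged outside a ball larger than the action radius, so the
  values of the observable before and after both lie between the same conditional essential bounds,
  and they differ by at most the oscillation over that ball (\<open>obs_perturbed\<close>). Hence \<open>w k\<close> can be
  taken to be a sum over dyadic windows of the indicator that the radius lies in the window times the
  squared oscillation at the scale of the window. It remains to bound the expectation of such a product
  essentially by the product of the expectations.

  The event that the radius lies in the window is determined by the field in a neighbourhood of some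
  scale \<open>l\<close>. If the action radius of this whole neighbourhood is less than \<open>l\<close>, resampling the
  neighbourhood does not change the oscillation at scale \<open>2 * l\<close>, and the two factors decouple
  (\<open>nn_integral_decouple\<close>). Otherwise that second radius lies in a dyadic window above \<open>l\<close>; it is
  independent of the first event, since it only looks at the field outside the neighbourhood, and the
  argument is repeated at the larger scale. Each repetition costs the probability \<open>1 / 4\<close> that the radius
  is at least \<open>l\<close>, so the contributions form a geometric series (\<open>chain_bound\<close>). A window starting at
  \<open>2 ^ j * a\<close> has probability at most \<open>\<pi>\<^sub>0 (4 * 2 ^ j * a)\<close>, which is paid for by the integral of
  \<open>8 / t * \<pi>\<^sub>0 (t / 2)\<close> over \<open>k * 2 ^ j * a < t < 8 * 2 ^ j * a\<close>: these intervals are disjoint for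
  different \<open>j\<close>, and the integral is at least \<open>(8 - k) * \<pi>\<^sub>0 (4 * 2 ^ j * a)\<close>
  (\<open>scale_windows_sum_le\<close>). The first step uses \<open>k = 4\<close>, all others \<open>k = 6\<close>. If \<open>I\<close> denotes the part of
  the right-hand side with \<open>t > 4 * R\<close>, this gives a total of at most
  \<open>1 / 4 + 1 / 2 * (1 + 1 / 4 + 1 / 16 + \<dots>) = 1 / 4 + 2 / 3 \<le> 1\<close> times \<open>I\<close>, while the scales
  \<open>t \<le> 4 * R\<close> absorb the event that the radius is small. So nothing is lost in the constants.

  The tensorization is applied to bounded truncations of the observable (for the entropy, \<open>\<bar>Z\<bar>\<close> cut off
  from below as well). Truncations are \<open>1\<close>-Lipschitz and thus satisfy the same resampling bounds;
  Fatou's lemma removes them.\<close>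

section \<open>Mixing two independent configurations\<close>

definition mix :: "'i set \<Rightarrow> ('i \<Rightarrow> 'm) \<Rightarrow> ('i \<Rightarrow> 'm) \<Rightarrow> 'i \<Rightarrow> 'm" where
  "mix S \<xi> \<eta> = (\<lambda>t. if t \<in> S then \<xi> t else \<eta> t)"

lemma mix_empty [simp]: "mix {} \<xi> \<eta> = \<eta>"
  by (simp add: mix_def)

lemma mix_mix_left [simp]: "mix S (mix S \<xi> \<eta>) \<zeta> = mix S \<xi> \<zeta>"
  by (auto simp: mix_def)

lemma mix_mix_right [simp]: "mix S \<xi> (mix S \<eta> \<zeta>) = mix S \<xi> \<zeta>"
  by (auto simp: mix_def)

lemma mix_same [simp]: "mix S \<xi> \<xi> = \<xi>"
  by (simp add: mix_def)

locale field_law = prob_space L for L :: "('i \<Rightarrow> 'm) measure" +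
  fixes T :: "'i set" and N :: "'m measure"
  assumes sets_L [measurable_cong]: "sets L = sets (PiM T (\<lambda>_. N))"
begin

sublocale pair: pair_prob_space L L ..

abbreviation LL where "LL \<equiv> L \<Otimes>\<^sub>M L"

lemma space_L: "space L = (\<Pi>\<^sub>E t\<in>T. space N)"
  using sets_eq_imp_space_eq[OF sets_L] by (simp add: space_PiM)

lemma measurable_mix [measurable]:
  assumes f: "f \<in> K \<rightarrow>\<^sub>M L" and g: "g \<in> K \<rightarrow>\<^sub>M L"
  shows "(\<lambda>x. mix S (f x) (g x)) \<in> K \<rightarrow>\<^sub>M L"
proof -
  have [measurable]: "f \<in> K \<rightarrow>\<^sub>M PiM T (\<lambda>_. N)" "g \<in> K \<rightarrow>\<^sub>M PiM T (\<lambda>_. N)"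
    using f g by (simp_all cong: measurable_cong_sets add: measurable_cong_sets[OF refl sets_L])
  have "(\<lambda>x. mix S (f x) (g x)) \<in> K \<rightarrow>\<^sub>M PiM T (\<lambda>_. N)"
    unfolding mix_def
  proof (rule measurable_PiM_single')
    fix i assume i: "i \<in> T"
    note [measurable] = measurable_component_singleton[OF i]
    show "(\<lambda>x. if i \<in> S then f x i else g x i) \<in> K \<rightarrow>\<^sub>M N"
      using i by measurable
  next
    show "(\<lambda>x i. if i \<in> S then f x i else g x i) \<in> space K \<rightarrow> (\<Pi>\<^sub>E i\<in>T. space N)"
      using measurable_space[OF f] measurable_space[OF g] by (fastforce simp: space_L PiE_def extensional_def)
  qed
  then show ?thesis by (simp add: measurable_cong_sets[OF refl sets_L])
qed

lemma mix_in_space: "\<xi> \<in> space L \<Longrightarrow> \<eta> \<in> space L \<Longrightarrow> mix S \<xi> \<eta> \<in> space L"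
  by (auto simp: space_L mix_def PiE_def extensional_def)

text \<open>The parts of a random configuration on \<open>S\<close> and off \<open>S\<close> are independent. This formulation avoids
  the laws of the two restrictions: gluing the parts of two independent copies gives the law back.\<close>

definition splits :: "'i set \<Rightarrow> bool" where
  "splits S \<longleftrightarrow> distr LL L (\<lambda>(\<xi>, \<eta>). mix S \<xi> \<eta>) = L"

lemma nn_integral_mix:
  assumes S: "splits S" and f: "f \<in> borel_measurable L"
  shows "(\<integral>\<^sup>+\<xi>. (\<integral>\<^sup>+\<eta>. f (mix S \<xi> \<eta>) \<partial>L) \<partial>L) = (\<integral>\<^sup>+\<xi>. f \<xi> \<partial>L)"
proof -
  note [measurable] = f
  have "(\<integral>\<^sup>+\<xi>. f \<xi> \<partial>L) = (\<integral>\<^sup>+\<xi>. f \<xi> \<partial>distr LL L (\<lambda>(\<xi>, \<eta>). mix S \<xi> \<eta>))"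
    using S by (simp add: splits_def)
  also have "\<dots> = (\<integral>\<^sup>+p. f (mix S (fst p) (snd p)) \<partial>LL)"
    by (subst nn_integral_distr) (auto simp: case_prod_beta)
  also have "\<dots> = (\<integral>\<^sup>+\<xi>. (\<integral>\<^sup>+\<eta>. f (mix S \<xi> \<eta>) \<partial>L) \<partial>L)"
    by (subst nn_integral_fst[symmetric]) auto
  finally show ?thesis by simp
qed

text \<open>Each of the two configurations is itself written as a mixture of two independent ones. The swap then
  merely renames two of the four independent configurations.\<close>

lemma nn_integral_swap:
  assumes S: "splits S" and f [measurable]: "f \<in> borel_measurable LL"
  shows "(\<integral>\<^sup>+p. f (mix S (fst p) (snd p), mix S (snd p) (fst p)) \<partial>LL) = (\<integral>\<^sup>+p. f p \<partial>LL)"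
proof -
  let ?g = "\<lambda>\<xi>. \<integral>\<^sup>+\<eta>. (\<integral>\<^sup>+\<eta>'. f (mix S \<xi> \<eta>', mix S \<eta> \<xi>) \<partial>L) \<partial>L"
  have "(\<integral>\<^sup>+p. f (mix S (fst p) (snd p), mix S (snd p) (fst p)) \<partial>LL)
      = (\<integral>\<^sup>+\<xi>. (\<integral>\<^sup>+\<eta>. f (mix S \<xi> \<eta>, mix S \<eta> \<xi>) \<partial>L) \<partial>L)"
    by (subst nn_integral_fst[symmetric]) auto
  also have "\<dots> = (\<integral>\<^sup>+\<xi>. (\<integral>\<^sup>+\<eta>. (\<integral>\<^sup>+\<eta>'. f (mix S \<xi> \<eta>', mix S \<eta> \<xi>) \<partial>L) \<partial>L) \<partial>L)"
  proof (rule nn_integral_cong)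
    fix \<xi> assume [measurable]: "\<xi> \<in> space L"
    show "(\<integral>\<^sup>+\<eta>. f (mix S \<xi> \<eta>, mix S \<eta> \<xi>) \<partial>L)
        = (\<integral>\<^sup>+\<eta>. (\<integral>\<^sup>+\<eta>'. f (mix S \<xi> \<eta>', mix S \<eta> \<xi>) \<partial>L) \<partial>L)"
      using nn_integral_mix[OF S, of "\<lambda>\<eta>. f (mix S \<xi> \<eta>, mix S \<eta> \<xi>)"] by simp
  qed
  also have "\<dots> = (\<integral>\<^sup>+\<xi>. (\<integral>\<^sup>+\<xi>'. ?g (mix S \<xi> \<xi>') \<partial>L) \<partial>L)"
    by (rule nn_integral_mix[OF S, symmetric]) measurable
  also have "\<dots> = (\<integral>\<^sup>+\<xi>. (\<integral>\<^sup>+\<eta>'. (\<integral>\<^sup>+\<eta>. f (mix S \<xi> \<eta>', \<eta>) \<partial>L) \<partial>L) \<partial>L)"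
  proof (rule nn_integral_cong)
    fix \<xi> assume [measurable]: "\<xi> \<in> space L"
    let ?h = "\<lambda>\<eta>' \<eta> \<xi>'. f (mix S \<xi> \<eta>', mix S \<eta> \<xi>')"
    have "(\<integral>\<^sup>+\<xi>'. ?g (mix S \<xi> \<xi>') \<partial>L) = (\<integral>\<^sup>+\<xi>'. (\<integral>\<^sup>+\<eta>. (\<integral>\<^sup>+\<eta>'. ?h \<eta>' \<eta> \<xi>' \<partial>L) \<partial>L) \<partial>L)"
      by simp
    also have "\<dots> = (\<integral>\<^sup>+\<eta>. (\<integral>\<^sup>+\<xi>'. (\<integral>\<^sup>+\<eta>'. ?h \<eta>' \<eta> \<xi>' \<partial>L) \<partial>L) \<partial>L)"
      by (rule pair.Fubini') measurable
    also have "\<dots> = (\<integral>\<^sup>+\<eta>. (\<integral>\<^sup>+\<eta>'. (\<integral>\<^sup>+\<xi>'. ?h \<eta>' \<eta> \<xi>' \<partial>L) \<partial>L) \<partial>L)"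
      by (intro nn_integral_cong pair.Fubini') measurable
    also have "\<dots> = (\<integral>\<^sup>+\<eta>'. (\<integral>\<^sup>+\<eta>. (\<integral>\<^sup>+\<xi>'. ?h \<eta>' \<eta> \<xi>' \<partial>L) \<partial>L) \<partial>L)"
      by (rule pair.Fubini') measurable
    also have "\<dots> = (\<integral>\<^sup>+\<eta>'. (\<integral>\<^sup>+\<eta>. f (mix S \<xi> \<eta>', \<eta>) \<partial>L) \<partial>L)"
    proof (rule nn_integral_cong)
      fix \<eta>' assume [measurable]: "\<eta>' \<in> space L"
      show "(\<integral>\<^sup>+\<eta>. (\<integral>\<^sup>+\<xi>'. ?h \<eta>' \<eta> \<xi>' \<partial>L) \<partial>L) = (\<integral>\<^sup>+\<eta>. f (mix S \<xi> \<eta>', \<eta>) \<partial>L)"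
        by (rule nn_integral_mix[OF S]) measurable
    qed
    finally show "(\<integral>\<^sup>+\<xi>'. ?g (mix S \<xi> \<xi>') \<partial>L) = (\<integral>\<^sup>+\<eta>'. (\<integral>\<^sup>+\<eta>. f (mix S \<xi> \<eta>', \<eta>) \<partial>L) \<partial>L)" .
  qed
  also have "\<dots> = (\<integral>\<^sup>+\<xi>. (\<integral>\<^sup>+\<eta>. f (\<xi>, \<eta>) \<partial>L) \<partial>L)"
    by (rule nn_integral_mix[OF S]) measurable
  also have "\<dots> = (\<integral>\<^sup>+p. f p \<partial>LL)"
    by (subst nn_integral_fst[symmetric]) auto
  finally show ?thesis .
qed

lemma distr_swap:
  assumes S: "splits S"
  shows "distr LL LL (\<lambda>p. (mix S (fst p) (snd p), mix S (snd p) (fst p))) = LL"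
proof (rule measure_eqI)
  fix A assume "A \<in> sets (distr LL LL (\<lambda>p. (mix S (fst p) (snd p), mix S (snd p) (fst p))))"
  then have [measurable]: "A \<in> sets LL" by simp
  show "emeasure (distr LL LL (\<lambda>p. (mix S (fst p) (snd p), mix S (snd p) (fst p)))) A = emeasure LL A"
    using nn_integral_swap[OF S, of "indicator A"]
    by (simp add: nn_integral_distr nn_integral_indicator[symmetric] del: nn_integral_indicator)
qed simp

lemma distr_flip: "distr LL LL (\<lambda>p. (snd p, fst p)) = LL"
  using pair.distr_pair_swap by (simp add: case_prod_beta')

lemma distr_swap':
  assumes S: "splits S"
  shows "distr LL LL (\<lambda>p. (mix S (snd p) (fst p), mix S (fst p) (snd p))) = LL"
proof -
  have "distr LL LL (\<lambda>p. (mix S (snd p) (fst p), mix S (fst p) (snd p)))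
      = distr (distr LL LL (\<lambda>p. (snd p, fst p))) LL (\<lambda>p. (mix S (fst p) (snd p), mix S (snd p) (fst p)))"
    by (subst distr_distr) (auto simp: comp_def)
  then show ?thesis using distr_flip distr_swap[OF S] by simp
qed

lemma distr_fst: "distr LL L fst = L"
  by (rule distr_pair_fst)

lemma AE_LL_fst: "AE \<xi> in L. Q \<xi> \<Longrightarrow> AE p in LL. Q (fst p)"
  by (rule AE_distrD[of fst LL L]) (simp, simp only: distr_fst)

lemma distr_mix: "splits S \<Longrightarrow> distr LL L (\<lambda>p. mix S (fst p) (snd p)) = L"
  by (simp add: splits_def case_prod_beta')

lemma integrable_pair:
  fixes f :: "('i \<Rightarrow> 'm) \<Rightarrow> real"
  assumes f: "integrable L f"
  shows "integrable LL (\<lambda>p. f (fst p))" "splits S \<Longrightarrow> integrable LL (\<lambda>p. f (mix S (fst p) (snd p)))"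
    "(\<integral>p. f (fst p) \<partial>LL) = (\<integral>\<xi>. f \<xi> \<partial>L)"
    "splits S \<Longrightarrow> (\<integral>p. f (mix S (fst p) (snd p)) \<partial>LL) = (\<integral>\<xi>. f \<xi> \<partial>L)"
proof -
  have [measurable]: "f \<in> borel_measurable L" using f by auto
  show "integrable LL (\<lambda>p. f (fst p))"
    using integrable_distr_eq[of fst LL L f] f distr_fst by simp
  show "(\<integral>p. f (fst p) \<partial>LL) = (\<integral>\<xi>. f \<xi> \<partial>L)"
    using integral_distr[of fst LL L f] distr_fst by simp
  assume S: "splits S"
  show "integrable LL (\<lambda>p. f (mix S (fst p) (snd p)))"
    using integrable_distr_eq[of "\<lambda>p. mix S (fst p) (snd p)" LL L f] f distr_mix[OF S] by simp
  show "(\<integral>p. f (mix S (fst p) (snd p)) \<partial>LL) = (\<integral>\<xi>. f \<xi> \<partial>L)"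
    using integral_distr[of "\<lambda>p. mix S (fst p) (snd p)" LL L f] distr_mix[OF S] by simp
qed

end

text \<open>An increasing sequence of sets across which the law splits and which exhausts the index set. Only
  finitely many coordinates matter for a cylinder set, and this is the source of all convergence below.\<close>

locale exhausted_field = field_law L T N
  for L :: "('i \<Rightarrow> 'm) measure" and T N +
  fixes S :: "nat \<Rightarrow> 'i set"
  assumes splits_S: "splits (S n)"
    and S_mono: "m \<le> n \<Longrightarrow> S m \<subseteq> S n"
    and S_exhausts: "T \<subseteq> (\<Union>n. S n)"
begin

text \<open>The \<open>L\<^sup>1\<close> distance between an observable and the same observable after resampling everything
  off \<open>S n\<close>.\<close>

definition deviation :: "(('i \<Rightarrow> 'm) \<Rightarrow> real) \<Rightarrow> nat \<Rightarrow> real" where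
  "deviation f n = (\<integral>p. \<bar>f (mix (S n) (fst p) (snd p)) - f (fst p)\<bar> \<partial>LL)"

lemma integrable_deviation:
  fixes f :: "('i \<Rightarrow> 'm) \<Rightarrow> real"
  shows "integrable L f \<Longrightarrow> integrable LL (\<lambda>p. \<bar>f (mix (S n) (fst p) (snd p)) - f (fst p)\<bar>)"
  using integrable_pair(1)[of f] integrable_pair(2)[of f "S n"] splits_S by auto

lemma deviation_triangle:
  assumes f: "integrable L f" and g: "integrable L g"
  shows "deviation f n \<le> deviation g n + 2 * (\<integral>\<xi>. \<bar>f \<xi> - g \<xi>\<bar> \<partial>L)"
proof -
  have fg: "integrable L (\<lambda>\<xi>. \<bar>f \<xi> - g \<xi>\<bar>)" using f g by auto
  note s = splits_S[of n] and i = integrable_pair(1,3)[OF fg] integrable_pair(2,4)[OF fg splits_S[of n]]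
  have "deviation f n \<le> (\<integral>p. \<bar>g (mix (S n) (fst p) (snd p)) - g (fst p)\<bar>
      + \<bar>f (mix (S n) (fst p) (snd p)) - g (mix (S n) (fst p) (snd p))\<bar> + \<bar>f (fst p) - g (fst p)\<bar> \<partial>LL)"
    unfolding deviation_def
    using integrable_deviation[OF f] integrable_deviation[OF g, of n] i
    by (intro integral_mono) auto
  also have "\<dots> = deviation g n + 2 * (\<integral>\<xi>. \<bar>f \<xi> - g \<xi>\<bar> \<partial>L)"
    using integrable_deviation[OF g, of n] i by (simp add: deviation_def)
  finally show ?thesis .
qed

lemma deviation_nonneg: "0 \<le> deviation f n"
  unfolding deviation_def by (rule integral_nonneg_AE) simp

text \<open>Resampling preserves the law, so the deviation is continuous with respect to the \<open>L\<^sup>1\<close> norm, uniformly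
  in \<open>n\<close>. This extends the convergence from cylinder sets to all integrable observables.\<close>

lemma deviation_limit_closed:
  assumes f: "integrable L f" and g: "\<And>j::nat. integrable L (g j)" "\<And>j. deviation (g j) \<longlonglongrightarrow> 0"
    and lim: "(\<lambda>j. \<integral>\<xi>. \<bar>f \<xi> - g j \<xi>\<bar> \<partial>L) \<longlonglongrightarrow> 0"
  shows "deviation f \<longlonglongrightarrow> 0"
proof (rule LIMSEQ_I)
  fix e :: real assume e: "0 < e"
  obtain j where "norm ((\<integral>\<xi>. \<bar>f \<xi> - g j \<xi>\<bar> \<partial>L) - 0) < e / 4"
    using LIMSEQ_D[OF lim, of "e / 4"] e by auto
  then have j: "(\<integral>\<xi>. \<bar>f \<xi> - g j \<xi>\<bar> \<partial>L) < e / 4" by auto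
  obtain n0 where n0: "\<And>n. n \<ge> n0 \<Longrightarrow> norm (deviation (g j) n - 0) < e / 2"
    using LIMSEQ_D[OF g(2)[of j], of "e / 2"] e by auto
  have "norm (deviation f n - 0) < e" if "n \<ge> n0" for n
    using deviation_triangle[OF f g(1)[of j], of n] j n0[OF that] deviation_nonneg[of f n] by simp
  then show "\<exists>n0. \<forall>n\<ge>n0. norm (deviation f n - 0) < e" by blast
qed

lemma deviation_add:
  assumes "integrable L f" "integrable L g" "deviation f \<longlonglongrightarrow> 0" "deviation g \<longlonglongrightarrow> 0"
  shows "deviation (\<lambda>\<xi>. f \<xi> + g \<xi>) \<longlonglongrightarrow> 0"
proof (rule tendsto_sandwich[of "\<lambda>_. 0" _ _ "\<lambda>n. deviation f n + deviation g n"])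
  show "(\<lambda>n. deviation f n + deviation g n) \<longlonglongrightarrow> 0"
    using tendsto_add[OF assms(3,4)] by simp
  have "deviation (\<lambda>\<xi>. f \<xi> + g \<xi>) n \<le> deviation f n + deviation g n" for n
  proof -
    note i = integrable_deviation[OF assms(1), of n] integrable_deviation[OF assms(2), of n]
    have "deviation f n + deviation g n = (\<integral>p. \<bar>f (mix (S n) (fst p) (snd p)) - f (fst p)\<bar>
        + \<bar>g (mix (S n) (fst p) (snd p)) - g (fst p)\<bar> \<partial>LL)"
      unfolding deviation_def by (rule Bochner_Integration.integral_add[symmetric, OF i])
    moreover have "deviation (\<lambda>\<xi>. f \<xi> + g \<xi>) n \<le> \<dots>"
      unfolding deviation_def
      by (intro integral_mono Bochner_Integration.integrable_add i
          integrable_deviation[OF Bochner_Integration.integrable_add[OF assms(1,2)]]) linarith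
    ultimately show ?thesis by simp
  qed
  then show "\<forall>\<^sub>F n in sequentially. deviation (\<lambda>\<xi>. f \<xi> + g \<xi>) n \<le> deviation f n + deviation g n"
    by simp
qed (auto simp: deviation_nonneg)

lemma deviation_scale: "deviation (\<lambda>\<xi>. f \<xi> * c) n = \<bar>c\<bar> * deviation f n"
proof -
  have "\<bar>f (mix (S n) \<xi> \<eta>) * c - f \<xi> * c\<bar> = \<bar>c\<bar> * \<bar>f (mix (S n) \<xi> \<eta>) - f \<xi>\<bar>" for \<xi> \<eta>
    by (simp add: left_diff_distrib[symmetric] abs_mult)
  then show ?thesis unfolding deviation_def by simp
qed

lemma deviation_indicator_cylinder:
  assumes "A \<in> prod_algebra T (\<lambda>_. N)"
  shows "deviation (indicator A) \<longlonglongrightarrow> 0"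
proof -
  obtain J F where A: "A = prod_emb T (\<lambda>_. N) J (\<Pi>\<^sub>E j\<in>J. F j)" and J: "finite J" "J \<subseteq> T"
    using assms by (elim prod_algebraE) auto
  have "\<forall>j\<in>J. \<exists>n. j \<in> S n" using J S_exhausts by auto
  then obtain k where k: "\<And>j. j \<in> J \<Longrightarrow> j \<in> S (k j)" by metis
  define n0 where "n0 = Max (k ` J)"
  have JS: "J \<subseteq> S n" if "n \<ge> n0" for n
  proof
    fix j assume j: "j \<in> J"
    then have "k j \<le> n0" using J by (simp add: n0_def)
    then have "k j \<le> n" using that by simp
    then show "j \<in> S n" using k[OF j] S_mono by blast
  qed
  have "deviation (indicator A) n = 0" if "n \<ge> n0" for n
  proof -
    have "mix (S n) \<xi> \<eta> \<in> A \<longleftrightarrow> \<xi> \<in> A" if "\<xi> \<in> space L" "\<eta> \<in> space L" for \<xi> \<eta>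
    proof -
      have "restrict (mix (S n) \<xi> \<eta>) J = restrict \<xi> J"
        using JS[OF \<open>n \<ge> n0\<close>] by (intro restrict_ext) (auto simp: mix_def)
      then show ?thesis
        using that mix_in_space[OF that, of "S n"] by (simp add: A prod_emb_def space_L)
    qed
    then have "deviation (indicator A) n = (\<integral>p. 0 \<partial>LL)"
      unfolding deviation_def
      by (intro Bochner_Integration.integral_cong refl) (auto simp: space_pair_measure indicator_def)
    then show ?thesis by simp
  qed
  then have "\<forall>\<^sub>F n in sequentially. deviation (indicator A) n = 0"
    by (auto simp: eventually_sequentially intro!: exI[of _ n0])
  then show ?thesis by (rule tendsto_eventually)
qed

lemma deviation_indicator:
  assumes "A \<in> sets L"
  shows "deviation (indicator A) \<longlonglongrightarrow> 0"
proof -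
  have eq: "sets L = sigma_sets (\<Pi>\<^sub>E t\<in>T. space N) (prod_algebra T (\<lambda>_. N))"
    by (simp add: sets_L sets_PiM)
  have "A \<in> sigma_sets (\<Pi>\<^sub>E t\<in>T. space N) (prod_algebra T (\<lambda>_. N))"
    using assms eq by simp
  with Int_stable_prod_algebra prod_algebra_sets_into_space show ?thesis
  proof (induction rule: sigma_sets_induct_disjoint)
    case (basic A)
    then show ?case by (rule deviation_indicator_cylinder)
  next
    case empty
    then show ?case by (simp add: deviation_def)
  next
    case (compl A)
    have "deviation (indicator ((\<Pi>\<^sub>E t\<in>T. space N) - A)) n = deviation (indicator A) n" for n
      unfolding deviation_def
      using mix_in_space[of _ _ "S n"]
      by (intro Bochner_Integration.integral_cong refl)
         (auto simp: space_pair_measure space_L[symmetric] indicator_def)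
    then have "deviation (indicator ((\<Pi>\<^sub>E t\<in>T. space N) - A)) = deviation (indicator A)" by blast
    with compl show ?case by simp
  next
    case (union A)
    then have [measurable]: "A j \<in> sets L" for j using eq by auto
    define g :: "nat \<Rightarrow> ('i \<Rightarrow> 'm) \<Rightarrow> real" where "g j \<xi> = (\<Sum>i<j. indicator (A i) \<xi>)" for j \<xi>
    have g_ind: "g j = indicator (\<Union>i<j. A i)" for j
    proof
      fix \<xi> show "g j \<xi> = indicator (\<Union>i<j. A i) \<xi>"
        unfolding g_def using union(1)
        by (subst indicator_UN_disjoint) (auto simp: disjoint_family_on_def)
    qed
    have ind: "integrable L (indicator B :: _ \<Rightarrow> real)" if "B \<in> sets L" for B
      using that by (simp add: emeasure_eq_measure integrable_indicator_iff)
    have dg: "deviation (g j) \<longlonglongrightarrow> 0" for j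
    proof (induction j)
      case 0
      then show ?case by (simp add: g_def deviation_def)
    next
      case (Suc j)
      have "g (Suc j) = (\<lambda>\<xi>. g j \<xi> + indicator (A j) \<xi>)" by (simp add: g_def fun_eq_iff)
      with Suc union ind show ?case by (auto intro!: deviation_add simp: g_ind)
    qed
    show ?case
    proof (rule deviation_limit_closed)
      show "integrable L (indicator (\<Union>i. A i) :: _ \<Rightarrow> real)" by (rule ind) auto
      show "integrable L (g j)" for j unfolding g_ind by (rule ind) auto
      have "(\<lambda>j. \<integral>\<xi>. \<bar>indicator (\<Union>i. A i) \<xi> - g j \<xi>\<bar> \<partial>L) \<longlonglongrightarrow> (\<integral>\<xi>. 0 \<partial>L)"
      proof (rule integral_dominated_convergence[where w = "\<lambda>_. 1"])
        show "AE \<xi> in L. (\<lambda>j. \<bar>indicator (\<Union>i. A i) \<xi> - g j \<xi>\<bar>) \<longlonglongrightarrow> 0"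
        proof (rule AE_I2)
          fix \<xi>
          have "(\<lambda>j. indicator (\<Union>i<j. A i) \<xi> :: real) \<longlonglongrightarrow> indicator (\<Union>i. A i) \<xi>"
            by (rule LIMSEQ_indicator_UN)
          from tendsto_rabs[OF tendsto_diff[OF tendsto_const[of "indicator (\<Union>i. A i) \<xi>"] this]]
          show "(\<lambda>j. \<bar>indicator (\<Union>i. A i) \<xi> - g j \<xi>\<bar>) \<longlonglongrightarrow> 0"
            by (simp add: g_ind)
        qed
      qed (auto simp: g_ind indicator_def)
      then show "(\<lambda>j. \<integral>\<xi>. \<bar>indicator (\<Union>i. A i) \<xi> - g j \<xi>\<bar> \<partial>L) \<longlonglongrightarrow> 0" by simp
    qed (rule dg)
  qed
qed

text \<open>This replaces the martingale convergence theorem in the tensorization.\<close>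

proposition deviation_tendsto_0:
  assumes "integrable L f"
  shows "deviation f \<longlonglongrightarrow> 0"
  using assms
proof (induction rule: integrable_induct)
  case (base A c)
  have "deviation (\<lambda>\<xi>. indicator A \<xi> *\<^sub>R c) = (\<lambda>n. \<bar>c\<bar> * deviation (indicator A) n)"
    by (simp add: deviation_scale fun_eq_iff)
  then show ?case using tendsto_mult_right_zero[OF deviation_indicator[OF base(1)]] by simp
next
  case (add f g)
  then show ?case by (intro deviation_add)
next
  case (lim f s)
  show ?case
  proof (rule deviation_limit_closed)
    have [measurable]: "f \<in> borel_measurable L" "\<And>i. s i \<in> borel_measurable L" using lim by auto
    have "(\<lambda>j. \<integral>\<xi>. \<bar>f \<xi> - s j \<xi>\<bar> \<partial>L) \<longlonglongrightarrow> (\<integral>\<xi>. 0 \<partial>L)"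
    proof (rule integral_dominated_convergence[where w = "\<lambda>\<xi>. 3 * \<bar>f \<xi>\<bar>"])
      show "integrable L (\<lambda>\<xi>. 3 * \<bar>f \<xi>\<bar>)" using lim by auto
      show "AE \<xi> in L. (\<lambda>j. \<bar>f \<xi> - s j \<xi>\<bar>) \<longlonglongrightarrow> 0"
      proof (rule AE_I2)
        fix \<xi> assume "\<xi> \<in> space L"
        from tendsto_rabs[OF tendsto_diff[OF tendsto_const[of "f \<xi>"] lim.hyps(2)[OF this]]]
        show "(\<lambda>j. \<bar>f \<xi> - s j \<xi>\<bar>) \<longlonglongrightarrow> 0" by simp
      qed
      show "AE \<xi> in L. norm \<bar>f \<xi> - s j \<xi>\<bar> \<le> 3 * \<bar>f \<xi>\<bar>" for j
      proof (rule AE_I2)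
        fix \<xi> assume "\<xi> \<in> space L"
        from lim.hyps(3)[OF this, of j] show "norm \<bar>f \<xi> - s j \<xi>\<bar> \<le> 3 * \<bar>f \<xi>\<bar>" by auto
      qed
    qed auto
    then show "(\<lambda>j. \<integral>\<xi>. \<bar>f \<xi> - s j \<xi>\<bar> \<partial>L) \<longlonglongrightarrow> 0" by simp
  qed (use lim in auto)
qed

end

section \<open>Tensorization of variance and entropy\<close>

lemma ln_le_half_diff_inverse:
  fixes s :: real
  assumes "0 < s"
  shows "1 \<le> s \<Longrightarrow> 2 * ln s \<le> s - 1 / s" "s \<le> 1 \<Longrightarrow> s - 1 / s \<le> 2 * ln s"
proof -
  define h where "h s = s - 1 / s - 2 * ln s" for s :: real
  have mono: "h x \<le> h y" if "0 < x" "x \<le> y" for x y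
  proof (rule DERIV_nonneg_imp_nondecreasing[OF that(2)])
    fix z assume z: "x \<le> z" "z \<le> y"
    then have "0 < z" using that by linarith
    then have "(h has_real_derivative (1 - 1 / z)\<^sup>2) (at z)"
      unfolding h_def
      by (auto intro!: derivative_eq_intros simp: power2_eq_square field_simps)
    then show "\<exists>D. (h has_real_derivative D) (at z) \<and> 0 \<le> D" by (intro exI conjI) auto
  qed
  show "1 \<le> s \<Longrightarrow> 2 * ln s \<le> s - 1 / s" using mono[of 1 s] by (simp add: h_def)
  show "s \<le> 1 \<Longrightarrow> s - 1 / s \<le> 2 * ln s" using mono[of s 1] assms by (simp add: h_def)
qed

text \<open>With \<open>s = sqrt (b / a)\<close> this controls the increment of \<open>u * ln u\<close> from \<open>a\<close> to \<open>b\<close> by the increment of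
  the square root. The factor \<open>(4 + 2 * s) / 3\<close> makes the inequality exact to third order at \<open>s = 1\<close>:
  the difference of the two sides, called \<open>G\<close> below, has derivative
  \<open>2 * s * (s - 1 / s - 2 * ln s)\<close>, whose sign is that of \<open>s - 1\<close>.\<close>

lemma square_ln_square_le:
  fixes s :: real
  assumes s: "0 < s"
  shows "s\<^sup>2 * ln (s\<^sup>2) \<le> s\<^sup>2 - 1 + (s - 1)\<^sup>2 * (4 + 2 * s) / 3"
proof -
  define G where "G s = 1 / 3 - 2 * s + s\<^sup>2 + 2 / 3 * s ^ 3 - 2 * (s\<^sup>2 * ln s)" for s :: real
  have der: "(G has_real_derivative 2 * z * (z - 1 / z - 2 * ln z)) (at z)" if "0 < z" for z
    unfolding G_def using that
    by (auto intro!: derivative_eq_intros simp: power2_eq_square field_simps)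
  have "0 \<le> G s"
  proof (cases "1 \<le> s")
    case True
    have "G 1 \<le> G s"
    proof (rule DERIV_nonneg_imp_nondecreasing[OF True])
      fix z assume "1 \<le> z" "z \<le> s"
      then show "\<exists>D. (G has_real_derivative D) (at z) \<and> 0 \<le> D"
        using der[of z] ln_le_half_diff_inverse(1)[of z] by (intro exI conjI) auto
    qed
    then show ?thesis by (simp add: G_def)
  next
    case False
    then have "s \<le> 1" by simp
    have "G 1 \<le> G s"
    proof (rule DERIV_nonpos_imp_nonincreasing[OF \<open>s \<le> 1\<close>])
      fix z assume z: "s \<le> z" "z \<le> 1"
      then have "2 * z * (z - 1 / z - 2 * ln z) \<le> 0"
        using s ln_le_half_diff_inverse(2)[of z] by (intro mult_nonneg_nonpos) auto
      moreover have "(G has_real_derivative 2 * z * (z - 1 / z - 2 * ln z)) (at z)"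
        using z s by (intro der) simp
      ultimately show "\<exists>D. (G has_real_derivative D) (at z) \<and> D \<le> 0" by blast
    qed
    then show ?thesis by (simp add: G_def)
  qed
  moreover have "s\<^sup>2 - 1 + (s - 1)\<^sup>2 * (4 + 2 * s) / 3 - s\<^sup>2 * ln (s\<^sup>2) = G s"
    using s by (simp add: G_def ln_mult power2_eq_square power3_eq_cube field_simps)
  ultimately show ?thesis by linarith
qed

text \<open>If \<open>a\<close> and \<open>D\<close> are known at one step of a martingale and \<open>b\<close> is its next value, the first summand
  on the right has expectation \<open>0\<close>. Bounding \<open>2 * s\<close> by \<open>1 + s\<^sup>2\<close> in the previous lemma
  is what makes the right-hand side affine in \<open>b\<close>.\<close>

lemma entropy_increment_le:
  fixes a b D :: real
  assumes a: "0 < a" and b: "0 < b" and D: "(sqrt b - sqrt a)\<^sup>2 \<le> D"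
  shows "b * ln b - a * ln a \<le> (b - a) * (1 + ln a + D / (3 * a)) + 2 * D"
proof -
  define s where "s = sqrt b / sqrt a"
  have s: "0 < s" and s2: "s\<^sup>2 = b / a" using a b by (auto simp: s_def power_divide)
  have sD: "(s - 1)\<^sup>2 \<le> D / a"
  proof -
    have "(s - 1)\<^sup>2 = (sqrt b - sqrt a)\<^sup>2 / a"
    proof -
      have "s - 1 = (sqrt b - sqrt a) / sqrt a" using a by (simp add: s_def diff_divide_distrib)
      then show ?thesis using a by (simp add: power_divide)
    qed
    then show ?thesis using D a by (simp add: divide_right_mono)
  qed
  have "2 * s \<le> 1 + s\<^sup>2" using zero_le_power2[of "s - 1"] by (simp add: power2_diff)
  then have "(s - 1)\<^sup>2 * (4 + 2 * s) \<le> D / a * (5 + s\<^sup>2)"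
    using sD s by (intro mult_mono) (auto intro: order_trans[OF _ sD])
  then have "(s - 1)\<^sup>2 * (4 + 2 * s) / 3 \<le> D / a * (5 + s\<^sup>2) / 3"
    by (rule divide_right_mono) simp
  then have "s\<^sup>2 * ln (s\<^sup>2) \<le> s\<^sup>2 - 1 + D / a * (5 + s\<^sup>2) / 3"
    using square_ln_square_le[OF s] by linarith
  then have "a * (b / a * ln (b / a)) \<le> a * (b / a - 1 + D / a * (5 + b / a) / 3)"
    using a unfolding s2 by (intro mult_left_mono) auto
  moreover have "a * (b / a * ln (b / a)) = b * ln b - b * ln a"
    using a b by (simp add: ln_div field_simps)
  moreover have "a * (b / a - 1 + D / a * (5 + b / a) / 3) = (b - a) * (1 + D / (3 * a)) + 2 * D"
    using a by (simp add: field_simps)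
  ultimately show ?thesis by (simp add: algebra_simps)
qed

lemma entropy_tangent_le:
  fixes u v :: real
  assumes "0 < u" "0 < v"
  shows "v * ln v + (1 + ln v) * (u - v) \<le> u * ln u"
proof -
  have "ln (v / u) \<le> v / u - 1" using assms by (intro ln_le_minus_one) simp
  then have "u * ln (v / u) \<le> u * (v / u - 1)" using assms by (intro mult_left_mono) auto
  then show ?thesis using assms by (simp add: ln_div algebra_simps)
qed

lemma (in prob_space) integrable_bounded:
  fixes f :: "'a \<Rightarrow> real"
  assumes "f \<in> borel_measurable M" "\<And>x. x \<in> space M \<Longrightarrow> \<bar>f x\<bar> \<le> c"
  shows "integrable M f"
  using assms by (intro integrable_const_bound[where B = c] AE_I2) auto

lemma (in prob_space) integral_in_interval:
  fixes f :: "'a \<Rightarrow> real"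
  assumes f: "f \<in> borel_measurable M" "\<And>x. x \<in> space M \<Longrightarrow> m \<le> f x \<and> f x \<le> c"
  shows "m \<le> (\<integral>x. f x \<partial>M)" "(\<integral>x. f x \<partial>M) \<le> c"
proof -
  have i: "integrable M f"
    using f by (intro integrable_bounded[where c = "max \<bar>m\<bar> \<bar>c\<bar>"]) fastforce+
  have "(\<integral>x. m \<partial>M) \<le> (\<integral>x. f x \<partial>M)" using i f by (intro integral_mono) auto
  then show "m \<le> (\<integral>x. f x \<partial>M)" by (simp add: prob_space)
  have "(\<integral>x. f x \<partial>M) \<le> (\<integral>x. c \<partial>M)" using i f by (intro integral_mono) auto
  then show "(\<integral>x. f x \<partial>M) \<le> c" by (simp add: prob_space)
qed

text \<open>The reverse triangle inequality in \<open>L\<^sup>2\<close>. The Cauchy-Schwarz inequality behind it is obtained from the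
  arithmetic-geometric mean inequality with the optimal parameter \<open>t\<close>.\<close>

lemma (in prob_space) sqrt_integral_diff_le:
  fixes f g :: "'a \<Rightarrow> real"
  assumes [measurable]: "f \<in> borel_measurable M" "g \<in> borel_measurable M"
    and f: "\<And>x. x \<in> space M \<Longrightarrow> \<bar>f x\<bar> \<le> c" and g: "\<And>x. x \<in> space M \<Longrightarrow> \<bar>g x\<bar> \<le> c"
    and pos: "0 < (\<integral>x. (f x)\<^sup>2 \<partial>M)" "0 < (\<integral>x. (g x)\<^sup>2 \<partial>M)"
  shows "(sqrt (\<integral>x. (f x)\<^sup>2 \<partial>M) - sqrt (\<integral>x. (g x)\<^sup>2 \<partial>M))\<^sup>2 \<le> (\<integral>x. (f x - g x)\<^sup>2 \<partial>M)"
proof -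
  let ?a = "\<integral>x. (f x)\<^sup>2 \<partial>M" and ?b = "\<integral>x. (g x)\<^sup>2 \<partial>M"
  have c: "0 \<le> c" using f not_empty by (meson abs_ge_zero order_trans ex_in_conv)
  have i: "integrable M (\<lambda>x. (f x)\<^sup>2)" "integrable M (\<lambda>x. (g x)\<^sup>2)" "integrable M (\<lambda>x. f x * g x)"
    unfolding power2_eq_square using f g c
    by (auto intro!: integrable_bounded[where c = "c * c"] mult_mono simp: abs_mult simp del: abs_mult_self_eq)
  \<comment> \<open>The parameter for which the inequality \<open>f * g \<le> (t * f\<^sup>2 + g\<^sup>2 / t) / 2\<close> becomes the
  Cauchy-Schwarz inequality after integration.\<close>
  define t where "t = sqrt ?b / sqrt ?a"
  have t: "0 < t" using pos by (simp add: t_def)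
  have "(\<integral>x. f x * g x \<partial>M) \<le> (\<integral>x. (t / 2) * (f x)\<^sup>2 + (1 / (2 * t)) * (g x)\<^sup>2 \<partial>M)"
  proof (rule integral_mono)
    fix x
    have "0 \<le> (t * f x - g x)\<^sup>2 / (2 * t)" using t by simp
    also have "\<dots> = (t / 2) * (f x)\<^sup>2 + (1 / (2 * t)) * (g x)\<^sup>2 - f x * g x"
      using t by (simp add: power2_eq_square field_simps)
    finally show "f x * g x \<le> (t / 2) * (f x)\<^sup>2 + (1 / (2 * t)) * (g x)\<^sup>2" by simp
  qed (use i in auto)
  also have "\<dots> = (t / 2) * ?a + (1 / (2 * t)) * ?b" using i by simp
  also have "\<dots> = sqrt ?a * sqrt ?b"
  proof -
    have alg: "(v / u / 2) * (u * u) + (1 / (2 * (v / u))) * (v * v) = u * v" if "0 < u" "0 < v" for u v :: real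
      using that by (simp add: field_simps)
    from alg[of "sqrt ?a" "sqrt ?b"] show ?thesis using pos by (simp add: t_def)
  qed
  finally have "(\<integral>x. f x * g x \<partial>M) \<le> sqrt ?a * sqrt ?b" .
  moreover have "(\<integral>x. (f x - g x)\<^sup>2 \<partial>M) = ?a + ?b - 2 * (\<integral>x. f x * g x \<partial>M)"
  proof -
    have "(\<integral>x. (f x - g x)\<^sup>2 \<partial>M) = (\<integral>x. (f x)\<^sup>2 + (g x)\<^sup>2 - 2 * (f x * g x) \<partial>M)"
      by (intro Bochner_Integration.integral_cong) (auto simp: power2_diff)
    then show ?thesis using i by simp
  qed
  ultimately show ?thesis using pos by (simp add: power2_diff)
qed

locale tensor_field = field_law L T N
  for L :: "('i \<Rightarrow> 'm) measure" and T N +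
  fixes P :: "nat \<Rightarrow> 'i set"
  assumes disj: "disjoint_family P"
    and cover: "T \<subseteq> (\<Union>n. P n)"
    and splits_P: "splits (\<Union>j\<in>J. P j)"
begin

definition initial :: "nat \<Rightarrow> 'i set" where
  "initial n = (\<Union>j<n. P j)"

sublocale exhausted_field L T N initial
proof
  show "splits (initial n)" for n unfolding initial_def by (rule splits_P)
  show "m \<le> n \<Longrightarrow> initial m \<subseteq> initial n" for m n
    by (auto simp: initial_def intro: less_le_trans)
  show "T \<subseteq> (\<Union>n. initial n)" using cover by (fastforce simp: initial_def)
qed

lemma splits_piece: "splits (P k)"
  using splits_P[of "{k}"] by simp

lemma initial_0 [simp]: "initial 0 = {}"
  by (simp add: initial_def)

lemma initial_Suc: "initial (Suc k) = initial k \<union> P k"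
  by (auto simp: initial_def lessThan_Suc)

lemma initial_disjoint: "t \<in> initial k \<Longrightarrow> t \<notin> P k"
proof
  assume "t \<in> initial k" "t \<in> P k"
  then obtain j where "j < k" "t \<in> P j \<inter> P k" by (auto simp: initial_def)
  then show False using disjoint_family_onD[OF disj, of j k] by auto
qed

text \<open>Exchanging the cell \<open>k\<close> between the two configurations exchanges the mixtures along \<open>initial k\<close> and
  \<open>initial (Suc k)\<close>. So these two mixtures are distributed like a configuration and its resampling in
  the cell \<open>k\<close>.\<close>

lemma mix_initial_piece:
  "mix (initial k) (mix (P k) \<eta> \<xi>) (mix (P k) \<xi> \<eta>) = mix (initial (Suc k)) \<xi> \<eta>"
  "mix (initial (Suc k)) (mix (P k) \<eta> \<xi>) (mix (P k) \<xi> \<eta>) = mix (initial k) \<xi> \<eta>"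
  "mix (P k) (mix (initial k) \<eta> \<xi>) (mix (initial k) \<xi> \<eta>) = mix (initial (Suc k)) \<xi> \<eta>"
  "mix (initial k) (mix (P k) \<eta> \<xi>) \<zeta> = mix (initial k) \<xi> \<zeta>"
  using initial_disjoint[of _ k] by (fastforce simp: mix_def initial_Suc)+

lemma integral_swap_piece:
  fixes f :: "_ \<Rightarrow> real"
  assumes [measurable]: "f \<in> borel_measurable LL"
  shows "(\<integral>p. f (mix (P k) (snd p) (fst p), mix (P k) (fst p) (snd p)) \<partial>LL) = (\<integral>p. f p \<partial>LL)"
proof -
  have "(\<integral>p. f p \<partial>LL) = (\<integral>p. f p \<partial>distr LL LL (\<lambda>p. (mix (P k) (snd p) (fst p), mix (P k) (fst p) (snd p))))"
    by (simp add: distr_swap'[OF splits_piece])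
  also have "\<dots> = (\<integral>p. f (mix (P k) (snd p) (fst p), mix (P k) (fst p) (snd p)) \<partial>LL)"
    by (rule integral_distr) measurable
  finally show ?thesis by simp
qed

lemma integral_LL_fst:
  fixes f :: "_ \<Rightarrow> real"
  assumes "f \<in> borel_measurable LL" "\<And>p. p \<in> space LL \<Longrightarrow> \<bar>f p\<bar> \<le> c"
  shows "(\<integral>p. f p \<partial>LL) = (\<integral>\<xi>. (\<integral>\<eta>. f (\<xi>, \<eta>) \<partial>L) \<partial>L)"
  using pair.integral_fst'[OF pair.P.integrable_bounded[OF assms]] by simp

text \<open>The variance is the expectation of \<open>Z \<xi> * (Z \<xi> - Z \<eta>)\<close>. Replacing \<open>\<xi>\<close> by \<open>\<eta>\<close> cell by cell
  telescopes the bracket into increments \<open>\<Delta> k\<close>. Exchanging the cell \<open>k\<close> changes the sign of \<open>\<Delta> k\<close>, so \<open>Z \<xi>\<close>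
  may be replaced by half of its own increment in the cell \<open>k\<close>; both increments have the same law.\<close>

theorem variance_le:
  fixes Z :: "('i \<Rightarrow> 'm) \<Rightarrow> real" and w :: "nat \<Rightarrow> ('i \<Rightarrow> 'm) \<Rightarrow> real"
  assumes Z_meas [measurable]: "Z \<in> borel_measurable L" and Z: "\<And>\<xi>. \<bar>Z \<xi>\<bar> \<le> c"
    and w_meas [measurable]: "\<And>k. w k \<in> borel_measurable L"
    and w: "\<And>k \<xi>. 0 \<le> w k \<xi>" "\<And>k \<xi>. w k \<xi> \<le> c'"
    and osc: "\<And>k. AE p in LL. (Z (fst p) - Z (mix (P k) (snd p) (fst p)))\<^sup>2 \<le> w k (fst p)"
  shows "ennreal (\<integral>\<xi>. (Z \<xi> - (\<integral>\<xi>. Z \<xi> \<partial>L))\<^sup>2 \<partial>L) \<le> ennreal (1 / 2) * (\<Sum>k. ennreal (\<integral>\<xi>. w k \<xi> \<partial>L))"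
proof -
  have c: "0 \<le> c" using Z[of undefined] by linarith
  have ZZ: "\<bar>Z \<xi> * Z \<eta>\<bar> \<le> c * c" for \<xi> \<eta> unfolding abs_mult using Z c by (intro mult_mono) auto
  have Zd: "\<bar>Z \<xi> - Z \<eta>\<bar> \<le> 2 * c" for \<xi> \<eta> using Z[of \<xi>] Z[of \<eta>] by linarith
  have Zd2: "\<bar>(Z \<xi> - Z \<eta>)\<^sup>2\<bar> \<le> (2 * c)\<^sup>2" for \<xi> \<eta>
    using Zd[of \<xi> \<eta>] abs_le_square_iff[of "Z \<xi> - Z \<eta>" "2 * c"] c by simp
  have ZZd: "\<bar>Z \<xi> * (Z \<eta> - Z \<zeta>)\<bar> \<le> c * (2 * c)" for \<xi> \<eta> \<zeta>
    unfolding abs_mult using Z Zd c by (intro mult_mono) auto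
  have iZ: "integrable L Z" using Z by (intro integrable_bounded[where c = c]) auto
  have iZ2: "integrable L (\<lambda>\<xi>. (Z \<xi>)\<^sup>2)"
    unfolding power2_eq_square by (intro integrable_bounded[where c = "c * c"] ZZ) measurable
  define \<Delta> where "\<Delta> k p = Z (mix (initial k) (snd p) (fst p)) - Z (mix (initial (Suc k)) (snd p) (fst p))" for k p
  have [measurable]: "\<Delta> k \<in> borel_measurable LL" for k unfolding \<Delta>_def by measurable
  define Q where "Q k p = (Z (fst p) - Z (mix (P k) (snd p) (fst p)))\<^sup>2" for k p
  have [measurable]: "Q k \<in> borel_measurable LL" for k unfolding Q_def by measurable
  have iQ: "integrable LL (Q k)" for k
    unfolding Q_def using Zd2 by (intro pair.P.integrable_bounded[where c = "(2 * c)\<^sup>2"]) auto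
  have i\<Delta>: "integrable LL (\<lambda>p. (\<Delta> k p)\<^sup>2)" for k
    unfolding \<Delta>_def using Zd2 by (intro pair.P.integrable_bounded[where c = "(2 * c)\<^sup>2"]) auto
  have iZ\<Delta>: "integrable LL (\<lambda>p. Z (fst p) * \<Delta> k p)"
      "integrable LL (\<lambda>p. Z (mix (P k) (snd p) (fst p)) * \<Delta> k p)" for k
    unfolding \<Delta>_def using ZZd by (auto intro!: pair.P.integrable_bounded[where c = "c * (2 * c)"])
  have Q_le: "(\<integral>p. Q k p \<partial>LL) \<le> (\<integral>\<xi>. w k \<xi> \<partial>L)" for k
  proof -
    have iw: "integrable L (w k)"
      using w by (intro integrable_bounded[where c = c']) auto
    have "(\<integral>p. Q k p \<partial>LL) \<le> (\<integral>p. w k (fst p) \<partial>LL)"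
      using osc[of k] by (intro integral_mono_AE iQ integrable_pair(1)[OF iw]) (simp add: Q_def)
    then show ?thesis using integrable_pair(3)[OF iw] by simp
  qed
  have \<Delta>_Q: "(\<integral>p. (\<Delta> k p)\<^sup>2 \<partial>LL) = (\<integral>p. Q k p \<partial>LL)" for k
  proof -
    let ?h = "\<lambda>p. (mix (initial k) (snd p) (fst p), mix (initial k) (fst p) (snd p))"
    have "(\<integral>p. Q k p \<partial>LL) = (\<integral>p. Q k p \<partial>distr LL LL ?h)"
      by (simp add: distr_swap'[OF splits_S])
    also have "\<dots> = (\<integral>p. Q k (?h p) \<partial>LL)"
      by (rule integral_distr) measurable
    also have "\<dots> = (\<integral>p. (\<Delta> k p)\<^sup>2 \<partial>LL)"
      by (simp add: Q_def \<Delta>_def mix_initial_piece)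
    finally show ?thesis by simp
  qed
  have term_le: "(\<integral>p. Z (fst p) * \<Delta> k p \<partial>LL) \<le> 1 / 2 * (\<integral>\<xi>. w k \<xi> \<partial>L)" for k
  proof -
    have anti: "\<Delta> k (mix (P k) (snd p) (fst p), mix (P k) (fst p) (snd p)) = - \<Delta> k p" for p
      by (simp add: \<Delta>_def mix_initial_piece(1,2))
    have "(\<integral>p. Z (fst p) * \<Delta> k p \<partial>LL) = - (\<integral>p. Z (mix (P k) (snd p) (fst p)) * \<Delta> k p \<partial>LL)"
      by (subst integral_swap_piece[of _ k, symmetric]) (simp_all add: anti)
    then have "2 * (\<integral>p. Z (fst p) * \<Delta> k p \<partial>LL)
        = (\<integral>p. Z (fst p) * \<Delta> k p - Z (mix (P k) (snd p) (fst p)) * \<Delta> k p \<partial>LL)"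
      using iZ\<Delta>[of k] by simp
    also have "\<dots> \<le> (\<integral>p. 1 / 2 * Q k p + 1 / 2 * (\<Delta> k p)\<^sup>2 \<partial>LL)"
    proof (rule integral_mono)
      fix p
      let ?q = "Z (fst p) - Z (mix (P k) (snd p) (fst p))"
      have "0 \<le> (?q - \<Delta> k p)\<^sup>2" by simp
      then show "Z (fst p) * \<Delta> k p - Z (mix (P k) (snd p) (fst p)) * \<Delta> k p \<le> 1 / 2 * Q k p + 1 / 2 * (\<Delta> k p)\<^sup>2"
        unfolding power2_diff Q_def left_diff_distrib[symmetric] by (simp add: power2_eq_square algebra_simps)
    qed (use iZ\<Delta>[of k] iQ[of k] i\<Delta>[of k] in auto)
    also have "\<dots> = (\<integral>p. Q k p \<partial>LL)" using iQ[of k] i\<Delta>[of k] \<Delta>_Q[of k] by simp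
    finally show ?thesis using Q_le[of k] by simp
  qed
  define V where "V n = (\<Sum>k<n. \<integral>p. Z (fst p) * \<Delta> k p \<partial>LL)" for n
  have V: "V n = (\<integral>p. Z (fst p) * (Z (fst p) - Z (mix (initial n) (snd p) (fst p))) \<partial>LL)" for n
  proof -
    have "V n = (\<integral>p. (\<Sum>k<n. Z (fst p) * \<Delta> k p) \<partial>LL)"
      unfolding V_def using iZ\<Delta> by (intro Bochner_Integration.integral_sum[symmetric]) auto
    also have "\<dots> = (\<integral>p. Z (fst p) * (Z (fst p) - Z (mix (initial n) (snd p) (fst p))) \<partial>LL)"
      by (intro Bochner_Integration.integral_cong refl)
         (simp add: sum_distrib_left[symmetric] \<Delta>_def sum_lessThan_telescope'[of "\<lambda>k. Z (mix (initial k) (snd _) (fst _))"])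
    finally show ?thesis .
  qed
  let ?var = "\<integral>\<xi>. (Z \<xi> - (\<integral>\<xi>. Z \<xi> \<partial>L))\<^sup>2 \<partial>L"
  have var: "?var = (\<integral>p. Z (fst p) * (Z (fst p) - Z (snd p)) \<partial>LL)"
  proof -
    have "(\<integral>p. Z (fst p) * (Z (fst p) - Z (snd p)) \<partial>LL) = (\<integral>\<xi>. (\<integral>\<eta>. Z \<xi> * (Z \<xi> - Z \<eta>) \<partial>L) \<partial>L)"
      using integral_LL_fst[of "\<lambda>p. Z (fst p) * (Z (fst p) - Z (snd p))" "c * (2 * c)"] ZZd by simp
    also have "\<dots> = (\<integral>\<xi>. (Z \<xi>)\<^sup>2 - Z \<xi> * (\<integral>\<xi>. Z \<xi> \<partial>L) \<partial>L)"
      using iZ by (simp add: right_diff_distrib prob_space power2_eq_square)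
    also have "\<dots> = (\<integral>\<xi>. (Z \<xi>)\<^sup>2 \<partial>L) - (\<integral>\<xi>. Z \<xi> \<partial>L)\<^sup>2"
      using iZ iZ2 by (simp add: power2_eq_square[of "expectation Z"])
    also have "\<dots> = ?var"
      by (rule variance_eq[OF iZ iZ2, symmetric])
    finally show ?thesis by simp
  qed
  have V_var: "\<bar>V n - ?var\<bar> \<le> c * deviation Z n" for n
  proof -
    have "V n - ?var = (\<integral>p. Z (fst p) * (Z (snd p) - Z (mix (initial n) (snd p) (fst p))) \<partial>LL)"
      unfolding V var using ZZd
      by (subst Bochner_Integration.integral_diff[symmetric])
         (auto intro!: pair.P.integrable_bounded[where c = "c * (2 * c)"] Bochner_Integration.integral_cong simp: algebra_simps)
    also have "\<bar>\<dots>\<bar> \<le> (\<integral>p. \<bar>Z (fst p) * (Z (snd p) - Z (mix (initial n) (snd p) (fst p)))\<bar> \<partial>LL)"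
      by (rule integral_abs_bound)
    also have "\<dots> \<le> (\<integral>p. c * \<bar>Z (mix (initial n) (snd p) (fst p)) - Z (snd p)\<bar> \<partial>LL)"
    proof (rule integral_mono)
      show "integrable LL (\<lambda>p. \<bar>Z (fst p) * (Z (snd p) - Z (mix (initial n) (snd p) (fst p)))\<bar>)"
        using ZZd by (intro pair.P.integrable_bounded[where c = "c * (2 * c)"]) auto
      show "integrable LL (\<lambda>p. c * \<bar>Z (mix (initial n) (snd p) (fst p)) - Z (snd p)\<bar>)"
        using Zd by (intro integrable_mult_right pair.P.integrable_bounded[where c = "2 * c"]) auto
      show "\<bar>Z (fst p) * (Z (snd p) - Z (mix (initial n) (snd p) (fst p)))\<bar>
          \<le> c * \<bar>Z (mix (initial n) (snd p) (fst p)) - Z (snd p)\<bar>" for p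
        unfolding abs_mult using Z[of "fst p"] by (subst abs_minus_commute) (intro mult_right_mono, auto)
    qed
    also have "\<dots> = c * (\<integral>p. \<bar>Z (mix (initial n) (snd p) (fst p)) - Z (snd p)\<bar> \<partial>LL)" by simp
    also have "(\<integral>p. \<bar>Z (mix (initial n) (snd p) (fst p)) - Z (snd p)\<bar> \<partial>LL) = deviation Z n"
    proof -
      have "deviation Z n = (\<integral>p. \<bar>Z (mix (initial n) (fst p) (snd p)) - Z (fst p)\<bar> \<partial>distr LL LL (\<lambda>p. (snd p, fst p)))"
        unfolding deviation_def distr_flip ..
      also have "\<dots> = (\<integral>p. \<bar>Z (mix (initial n) (snd p) (fst p)) - Z (snd p)\<bar> \<partial>LL)"
        by (subst integral_distr) auto
      finally show ?thesis by simp
    qed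
    finally show ?thesis .
  qed
  have "(\<lambda>n. V n - ?var) \<longlonglongrightarrow> 0"
  proof (rule Lim_null_comparison)
    show "\<forall>\<^sub>F n in sequentially. norm (V n - ?var) \<le> c * deviation Z n" using V_var by simp
    show "(\<lambda>n. c * deviation Z n) \<longlonglongrightarrow> 0"
      by (rule tendsto_mult_right_zero[OF deviation_tendsto_0[OF iZ]])
  qed
  then have "V \<longlonglongrightarrow> ?var" by (simp add: LIM_zero_iff)
  then have "(\<lambda>n. ennreal (V n)) \<longlonglongrightarrow> ennreal ?var" by (rule tendsto_ennrealI)
  then show ?thesis
  proof (rule LIMSEQ_le_const2, intro exI allI impI)
    fix n :: nat
    have "V n \<le> 1 / 2 * (\<Sum>k<n. \<integral>\<xi>. w k \<xi> \<partial>L)"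
      unfolding V_def sum_distrib_left by (intro sum_mono term_le)
    then have "ennreal (V n) \<le> ennreal (1 / 2 * (\<Sum>k<n. \<integral>\<xi>. w k \<xi> \<partial>L))" by (rule ennreal_leI)
    also have "\<dots> = ennreal (1 / 2) * (\<Sum>k<n. ennreal (\<integral>\<xi>. w k \<xi> \<partial>L))"
      using w(1) by (subst ennreal_mult) (auto intro!: sum_nonneg simp: sum_ennreal)
    also have "\<dots> \<le> ennreal (1 / 2) * (\<Sum>k. ennreal (\<integral>\<xi>. w k \<xi> \<partial>L))"
      by (intro mult_left_mono sum_le_suminf) auto
    finally show "ennreal (V n) \<le> ennreal (1 / 2) * (\<Sum>k. ennreal (\<integral>\<xi>. w k \<xi> \<partial>L))" .
  qed
qed

text \<open>The conditional expectations \<open>Yk k\<close> of \<open>Y\<close> given the first \<open>k\<close> cells form a martingale from the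
  expectation of \<open>Y\<close> to \<open>Y\<close>. By \<open>entropy_increment_le\<close>, one step increases the expectation of
  \<open>u * ln u\<close> by at most twice the expectation of \<open>W k\<close>, if \<open>W k\<close> depends on the first \<open>k\<close> cells only and
  dominates the squared increment of \<open>sqrt (Yk k)\<close>. As this square root is an \<open>L\<^sup>2\<close> norm of \<open>Z\<close>, the
  increment is bounded by the \<open>L\<^sup>2\<close> norm of the effect of resampling one cell, and the average of \<open>w k\<close>
  over the remaining cells is such a \<open>W k\<close>.\<close>

theorem entropy_le:
  fixes Z :: "('i \<Rightarrow> 'm) \<Rightarrow> real" and w :: "nat \<Rightarrow> ('i \<Rightarrow> 'm) \<Rightarrow> real"
  assumes Z_meas [measurable]: "Z \<in> borel_measurable L" and lo: "0 < lo" and Z: "\<And>\<xi>. lo \<le> Z \<xi>" "\<And>\<xi>. Z \<xi> \<le> c"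
    and w_meas [measurable]: "\<And>k. w k \<in> borel_measurable L"
    and w: "\<And>k \<xi>. 0 \<le> w k \<xi>" "\<And>k \<xi>. w k \<xi> \<le> c'"
    and osc: "\<And>k. AE p in LL. (Z (fst p) - Z (mix (P k) (snd p) (fst p)))\<^sup>2 \<le> w k (fst p)"
  defines "Y \<equiv> \<lambda>\<xi>. (Z \<xi>)\<^sup>2"
  shows "ennreal ((\<integral>\<xi>. Y \<xi> * ln (Y \<xi>) \<partial>L) - (\<integral>\<xi>. Y \<xi> \<partial>L) * ln (\<integral>\<xi>. Y \<xi> \<partial>L))
    \<le> 2 * (\<Sum>k. ennreal (\<integral>\<xi>. w k \<xi> \<partial>L))"
proof -
  have c: "lo \<le> c" using Z(1)[of undefined] Z(2)[of undefined] by linarith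
  define m where "m = lo\<^sup>2"
  define C where "C = c\<^sup>2"
  have m: "0 < m" and mC: "m \<le> C" using lo c by (auto simp: m_def C_def intro: power_mono)
  have Y: "m \<le> Y \<xi>" "Y \<xi> \<le> C" for \<xi>
    using Z[of \<xi>] lo by (auto simp: Y_def m_def C_def intro!: power_mono)
  have abs_le_C: "\<bar>y\<bar> \<le> C" if "m \<le> y" "y \<le> C" for y
    using that m by simp
  have [measurable]: "Y \<in> borel_measurable L" unfolding Y_def by measurable
  define lnC where "lnC = 1 + \<bar>ln m\<bar> + \<bar>ln C\<bar>"
  have ln_bound: "\<bar>1 + ln y\<bar> \<le> lnC" if "m \<le> y" "y \<le> C" for y
  proof -
    have "ln m \<le> ln y" "ln y \<le> ln C" using that m by auto
    then show ?thesis by (auto simp: lnC_def)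
  qed
  have phi_bound: "\<bar>y * ln y\<bar> \<le> C * lnC" if "m \<le> y" "y \<le> C" for y
  proof -
    have "ln m \<le> ln y" "ln y \<le> ln C" using that m by auto
    then have "\<bar>ln y\<bar> \<le> lnC" by (auto simp: lnC_def)
    then show ?thesis unfolding abs_mult using that m by (intro mult_mono) auto
  qed
  define Yk where "Yk k \<xi> = (\<integral>\<eta>. Y (mix (initial k) \<xi> \<eta>) \<partial>L)" for k \<xi>
  define W where "W k \<xi> = (\<integral>\<eta>. w k (mix (initial k) \<xi> \<eta>) \<partial>L)" for k \<xi>
  have [measurable]: "Yk k \<in> borel_measurable L" "W k \<in> borel_measurable L" for k
    unfolding Yk_def W_def by measurable
  have Yk: "m \<le> Yk k \<xi>" "Yk k \<xi> \<le> C" if [measurable]: "\<xi> \<in> space L" for k \<xi>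
    unfolding Yk_def using Y by (auto intro!: integral_in_interval)
  have W: "0 \<le> W k \<xi>" "W k \<xi> \<le> c'" if [measurable]: "\<xi> \<in> space L" for k \<xi>
    unfolding W_def using w by (auto intro!: integral_in_interval)
  have iW: "integrable L (W k)" and iw: "integrable L (w k)" for k
    using w W by (auto intro!: integrable_bounded[where c = c'])
  have EW: "(\<integral>\<xi>. W k \<xi> \<partial>L) = (\<integral>\<xi>. w k \<xi> \<partial>L)" for k
  proof -
    have "(\<integral>\<xi>. w k \<xi> \<partial>L) = (\<integral>p. w k (mix (initial k) (fst p) (snd p)) \<partial>LL)"
      using integrable_pair(4)[OF iw splits_S] by simp
    also have "\<dots> = (\<integral>\<xi>. W k \<xi> \<partial>L)"
      unfolding W_def using w by (subst integral_LL_fst[where c = c']) auto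
    finally show ?thesis by simp
  qed
  define G where "G k \<xi> = 1 + ln (Yk k \<xi>) + W k \<xi> / (3 * Yk k \<xi>)" for k \<xi>
  have [measurable]: "G k \<in> borel_measurable L" for k unfolding G_def by measurable
  have G_bound: "\<bar>G k \<xi>\<bar> \<le> lnC + c' / (3 * m)" if "\<xi> \<in> space L" for k \<xi>
  proof -
    have "0 \<le> W k \<xi> / (3 * Yk k \<xi>)" using W[OF that, of k] Yk[OF that, of k] m by simp
    moreover have "W k \<xi> / (3 * Yk k \<xi>) \<le> c' / (3 * m)"
      using W[OF that, of k] Yk[OF that, of k] m by (intro frac_le) auto
    ultimately show ?thesis using ln_bound[OF Yk[OF that, of k]] unfolding G_def by linarith
  qed
  \<comment> \<open>The factor \<open>G k\<close> depends on the first \<open>k\<close> cells only, so exchanging the cell \<open>k\<close> changes the sign of the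
  integrand \<open>F\<close>.\<close>
  have increment_orth: "(\<integral>\<xi>. (Yk (Suc k) \<xi> - Yk k \<xi>) * G k \<xi> \<partial>L) = 0" for k
  proof -
    define F where "F p = (Y (mix (initial (Suc k)) (fst p) (snd p)) - Y (mix (initial k) (fst p) (snd p))) * G k (fst p)" for p
    have [measurable]: "F \<in> borel_measurable LL" unfolding F_def by measurable
    have F_bound: "\<bar>F p\<bar> \<le> (2 * C) * (lnC + c' / (3 * m))" if "p \<in> space LL" for p
    proof -
      have "\<bar>Y \<xi> - Y \<eta>\<bar> \<le> 2 * C" for \<xi> \<eta> using Y[of \<xi>] Y[of \<eta>] m by linarith
      then show ?thesis unfolding F_def abs_mult using G_bound[of "fst p" k] that m mC
        by (intro mult_mono) (auto simp: space_pair_measure)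
    qed
    have "G k (mix (P k) (snd p) (fst p)) = G k (fst p)" for p
      by (simp add: mix_initial_piece(4) G_def Yk_def W_def)
    then have "F (mix (P k) (snd p) (fst p), mix (P k) (fst p) (snd p)) = - F p" for p
      by (simp add: F_def mix_initial_piece(1,2) algebra_simps)
    then have "(\<integral>p. F p \<partial>LL) = - (\<integral>p. F p \<partial>LL)"
      using integral_swap_piece[of F k] by simp
    then have "0 = (\<integral>p. F p \<partial>LL)" by simp
    also have "\<dots> = (\<integral>\<xi>. (\<integral>\<eta>. F (\<xi>, \<eta>) \<partial>L) \<partial>L)"
      by (rule integral_LL_fst[OF _ F_bound]) auto
    also have "\<dots> = (\<integral>\<xi>. (Yk (Suc k) \<xi> - Yk k \<xi>) * G k \<xi> \<partial>L)"
    proof (rule Bochner_Integration.integral_cong[OF refl])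
      fix \<xi> assume [measurable]: "\<xi> \<in> space L"
      have "integrable L (\<lambda>\<eta>. Y (mix (initial j) \<xi> \<eta>))" for j
        using Y m by (intro integrable_bounded[where c = C]) (auto intro!: abs_le_C)
      then show "(\<integral>\<eta>. F (\<xi>, \<eta>) \<partial>L) = (Yk (Suc k) \<xi> - Yk k \<xi>) * G k \<xi>"
        by (simp add: F_def Yk_def)
    qed
    finally show ?thesis by simp
  qed
  \<comment> \<open>The weight is evaluated at the mixture along \<open>initial k\<close>, so that its average \<open>W k\<close> depends on the first
  \<open>k\<close> cells only.\<close>
  have sqrt_increment: "AE \<xi> in L. (sqrt (Yk (Suc k) \<xi>) - sqrt (Yk k \<xi>))\<^sup>2 \<le> W k \<xi>" for k
  proof -
    let ?h = "\<lambda>p. (mix (initial k) (fst p) (snd p), mix (initial k) (snd p) (fst p))"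
    have "AE p in distr LL LL ?h. (Z (fst p) - Z (mix (P k) (snd p) (fst p)))\<^sup>2 \<le> w k (fst p)"
      unfolding distr_swap[OF splits_S] by (rule osc)
    then have "AE p in LL. (Z (mix (initial k) (fst p) (snd p)) - Z (mix (initial (Suc k)) (fst p) (snd p)))\<^sup>2
        \<le> w k (mix (initial k) (fst p) (snd p))"
      by (subst (asm) AE_distr_iff) (auto simp: mix_initial_piece)
    from pair.AE_pair[OF this] show ?thesis
      using AE_space
    proof eventually_elim
      case (elim \<xi>)
      note [measurable] = elim(2)
      have absZ: "\<bar>Z \<zeta>\<bar> \<le> c" for \<zeta> using Z[of \<zeta>] lo by simp
      have absZd: "\<bar>(Z \<zeta> - Z \<zeta>')\<^sup>2\<bar> \<le> (2 * c)\<^sup>2" for \<zeta> \<zeta>'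
        using Z[of \<zeta>] Z[of \<zeta>'] c lo abs_le_square_iff[of "Z \<zeta> - Z \<zeta>'" "2 * c"] by (simp add: abs_le_iff)
      have "(sqrt (Yk (Suc k) \<xi>) - sqrt (Yk k \<xi>))\<^sup>2
          \<le> (\<integral>\<eta>. (Z (mix (initial (Suc k)) \<xi> \<eta>) - Z (mix (initial k) \<xi> \<eta>))\<^sup>2 \<partial>L)"
        using Yk(1)[OF elim(2), of k] Yk(1)[OF elim(2), of "Suc k"] m absZ unfolding Yk_def Y_def
        by (intro sqrt_integral_diff_le[where c = c]) auto
      also have "\<dots> \<le> W k \<xi>"
        unfolding W_def
      proof (rule integral_mono_AE)
        show "integrable L (\<lambda>\<eta>. (Z (mix (initial (Suc k)) \<xi> \<eta>) - Z (mix (initial k) \<xi> \<eta>))\<^sup>2)"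
          using absZd by (intro integrable_bounded[where c = "(2 * c)\<^sup>2"]) auto
        show "integrable L (\<lambda>\<eta>. w k (mix (initial k) \<xi> \<eta>))"
          using w by (intro integrable_bounded[where c = c']) auto
        show "AE \<eta> in L. (Z (mix (initial (Suc k)) \<xi> \<eta>) - Z (mix (initial k) \<xi> \<eta>))\<^sup>2 \<le> w k (mix (initial k) \<xi> \<eta>)"
          using elim(1) by (simp add: power2_commute)
      qed
      finally show ?case .
    qed
  qed
  have iphi: "integrable L (\<lambda>\<xi>. Yk k \<xi> * ln (Yk k \<xi>))" for k
    using Yk phi_bound by (intro integrable_bounded[where c = "C * lnC"]) auto
  have iinc: "integrable L (\<lambda>\<xi>. (Yk (Suc k) \<xi> - Yk k \<xi>) * G k \<xi>)" for k
  proof (rule integrable_bounded[where c = "(2 * C) * (lnC + c' / (3 * m))"])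
    fix \<xi> assume s: "\<xi> \<in> space L"
    have "\<bar>Yk (Suc k) \<xi> - Yk k \<xi>\<bar> \<le> 2 * C"
      using Yk[OF s, of k] Yk[OF s, of "Suc k"] m by linarith
    then show "\<bar>(Yk (Suc k) \<xi> - Yk k \<xi>) * G k \<xi>\<bar> \<le> (2 * C) * (lnC + c' / (3 * m))"
      unfolding abs_mult using G_bound[OF s, of k] m mC by (intro mult_mono) auto
  qed measurable
  have step: "(\<integral>\<xi>. Yk (Suc k) \<xi> * ln (Yk (Suc k) \<xi>) \<partial>L) - (\<integral>\<xi>. Yk k \<xi> * ln (Yk k \<xi>) \<partial>L) \<le> 2 * (\<integral>\<xi>. w k \<xi> \<partial>L)" for k
  proof -
    have "(\<integral>\<xi>. Yk (Suc k) \<xi> * ln (Yk (Suc k) \<xi>) \<partial>L) - (\<integral>\<xi>. Yk k \<xi> * ln (Yk k \<xi>) \<partial>L)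
        = (\<integral>\<xi>. Yk (Suc k) \<xi> * ln (Yk (Suc k) \<xi>) - Yk k \<xi> * ln (Yk k \<xi>) \<partial>L)"
      using iphi by simp
    also have "\<dots> \<le> (\<integral>\<xi>. (Yk (Suc k) \<xi> - Yk k \<xi>) * G k \<xi> + 2 * W k \<xi> \<partial>L)"
    proof (rule integral_mono_AE)
      show "AE \<xi> in L. Yk (Suc k) \<xi> * ln (Yk (Suc k) \<xi>) - Yk k \<xi> * ln (Yk k \<xi>)
          \<le> (Yk (Suc k) \<xi> - Yk k \<xi>) * G k \<xi> + 2 * W k \<xi>"
        using sqrt_increment[of k] AE_space
      proof eventually_elim
        case (elim \<xi>)
        show ?case
          unfolding G_def using elim(1) Yk(1)[OF elim(2)] m by (intro entropy_increment_le) (auto intro: less_le_trans)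
      qed
    qed (use iphi iinc iW in auto)
    also have "\<dots> = 2 * (\<integral>\<xi>. w k \<xi> \<partial>L)"
      using iinc[of k] iW[of k] increment_orth[of k] EW[of k] by simp
    finally show ?thesis .
  qed
  let ?ent = "(\<integral>\<xi>. Y \<xi> * ln (Y \<xi>) \<partial>L) - (\<integral>\<xi>. Y \<xi> \<partial>L) * ln (\<integral>\<xi>. Y \<xi> \<partial>L)"
  have iY: "integrable L Y" using Y m by (intro integrable_bounded[where c = C]) (auto intro!: abs_le_C)
  have iYk: "integrable L (Yk k)" for k
    using Yk m by (intro integrable_bounded[where c = C]) (auto intro!: abs_le_C)
  have upper: "?ent - lnC * deviation Y n \<le> 2 * (\<Sum>k<n. \<integral>\<xi>. w k \<xi> \<partial>L)" for n
  proof -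
    have "(\<integral>\<xi>. Yk n \<xi> * ln (Yk n \<xi>) \<partial>L) - (\<integral>\<xi>. Yk 0 \<xi> * ln (Yk 0 \<xi>) \<partial>L) \<le> 2 * (\<Sum>k<n. \<integral>\<xi>. w k \<xi> \<partial>L)"
    proof (induction n)
      case (Suc n)
      then show ?case using step[of n] by (simp add: algebra_simps)
    qed simp
    moreover have "(\<integral>\<xi>. Yk 0 \<xi> * ln (Yk 0 \<xi>) \<partial>L) = (\<integral>\<xi>. Y \<xi> \<partial>L) * ln (\<integral>\<xi>. Y \<xi> \<partial>L)"
      by (simp add: Yk_def prob_space)
    \<comment> \<open>Convexity of \<open>u * ln u\<close>: a linear lower bound suffices for the passage to the limit.\<close>
    moreover have "(\<integral>\<xi>. Y \<xi> * ln (Y \<xi>) \<partial>L) - lnC * deviation Y n \<le> (\<integral>\<xi>. Yk n \<xi> * ln (Yk n \<xi>) \<partial>L)"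
    proof -
      have iphiY: "integrable L (\<lambda>\<xi>. Y \<xi> * ln (Y \<xi>))"
        using Y phi_bound by (intro integrable_bounded[where c = "C * lnC"]) auto
      have idev: "integrable L (\<lambda>\<xi>. \<bar>Yk n \<xi> - Y \<xi>\<bar>)" using iY iYk by auto
      have "(\<integral>\<xi>. \<bar>Yk n \<xi> - Y \<xi>\<bar> \<partial>L) \<le> (\<integral>\<xi>. (\<integral>\<eta>. \<bar>Y (mix (initial n) \<xi> \<eta>) - Y \<xi>\<bar> \<partial>L) \<partial>L)"
      proof (rule integral_mono[OF idev])
        have Yd: "\<bar>Y \<xi> - Y \<eta>\<bar> \<le> 2 * C" for \<xi> \<eta> using Y[of \<xi>] Y[of \<eta>] m by linarith
        show "integrable L (\<lambda>\<xi>. \<integral>\<eta>. \<bar>Y (mix (initial n) \<xi> \<eta>) - Y \<xi>\<bar> \<partial>L)"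
        proof (rule integrable_bounded[where c = "2 * C"])
          fix \<xi> assume [measurable]: "\<xi> \<in> space L"
          have "0 \<le> (\<integral>\<eta>. \<bar>Y (mix (initial n) \<xi> \<eta>) - Y \<xi>\<bar> \<partial>L)" by simp
          moreover have "(\<integral>\<eta>. \<bar>Y (mix (initial n) \<xi> \<eta>) - Y \<xi>\<bar> \<partial>L) \<le> 2 * C"
            using Yd by (intro integral_in_interval(2)[where m = 0]) auto
          ultimately show "\<bar>\<integral>\<eta>. \<bar>Y (mix (initial n) \<xi> \<eta>) - Y \<xi>\<bar> \<partial>L\<bar> \<le> 2 * C" by simp
        qed measurable
        fix \<xi> assume [measurable]: "\<xi> \<in> space L"
        have "integrable L (\<lambda>\<eta>. Y (mix (initial n) \<xi> \<eta>))"
          using Y m by (intro integrable_bounded[where c = C]) (auto intro!: abs_le_C)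
        then have "Yk n \<xi> - Y \<xi> = (\<integral>\<eta>. Y (mix (initial n) \<xi> \<eta>) - Y \<xi> \<partial>L)"
          by (simp add: Yk_def prob_space)
        then show "\<bar>Yk n \<xi> - Y \<xi>\<bar> \<le> (\<integral>\<eta>. \<bar>Y (mix (initial n) \<xi> \<eta>) - Y \<xi>\<bar> \<partial>L)"
          by (simp add: integral_abs_bound)
      qed
      also have "\<dots> = deviation Y n"
      proof -
        have "\<bar>Y \<xi> - Y \<eta>\<bar> \<le> 2 * C" for \<xi> \<eta> using Y[of \<xi>] Y[of \<eta>] m by linarith
        then show ?thesis unfolding deviation_def by (subst integral_LL_fst[where c = "2 * C"]) auto
      qed
      finally have dev: "(\<integral>\<xi>. \<bar>Yk n \<xi> - Y \<xi>\<bar> \<partial>L) \<le> deviation Y n" .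
      have lnC0: "0 \<le> lnC" by (simp add: lnC_def)
      have "(\<integral>\<xi>. Y \<xi> * ln (Y \<xi>) \<partial>L) - lnC * deviation Y n
          \<le> (\<integral>\<xi>. Y \<xi> * ln (Y \<xi>) - lnC * \<bar>Yk n \<xi> - Y \<xi>\<bar> \<partial>L)"
        using iphiY idev mult_left_mono[OF dev lnC0] by simp
      also have "\<dots> \<le> (\<integral>\<xi>. Yk n \<xi> * ln (Yk n \<xi>) \<partial>L)"
      proof (rule integral_mono)
        fix \<xi> assume s: "\<xi> \<in> space L"
        have "\<bar>(1 + ln (Y \<xi>)) * (Yk n \<xi> - Y \<xi>)\<bar> \<le> lnC * \<bar>Yk n \<xi> - Y \<xi>\<bar>"
          unfolding abs_mult using ln_bound[OF Y] by (rule mult_right_mono) simp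
        moreover have "Y \<xi> * ln (Y \<xi>) + (1 + ln (Y \<xi>)) * (Yk n \<xi> - Y \<xi>) \<le> Yk n \<xi> * ln (Yk n \<xi>)"
          using Y(1)[of \<xi>] Yk(1)[OF s, of n] m by (intro entropy_tangent_le) auto
        ultimately show "Y \<xi> * ln (Y \<xi>) - lnC * \<bar>Yk n \<xi> - Y \<xi>\<bar> \<le> Yk n \<xi> * ln (Yk n \<xi>)" by linarith
      qed (use iphiY idev iphi in auto)
      finally show ?thesis .
    qed
    ultimately show ?thesis by linarith
  qed
  have "(\<lambda>n. ?ent - lnC * deviation Y n) \<longlonglongrightarrow> ?ent - lnC * 0"
    by (intro tendsto_intros deviation_tendsto_0 iY)
  then have "(\<lambda>n. ennreal (?ent - lnC * deviation Y n)) \<longlonglongrightarrow> ennreal ?ent"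
    by (intro tendsto_ennrealI) simp
  then show ?thesis
  proof (rule LIMSEQ_le_const2, intro exI allI impI)
    fix n :: nat
    have "ennreal (?ent - lnC * deviation Y n) \<le> ennreal (2 * (\<Sum>k<n. \<integral>\<xi>. w k \<xi> \<partial>L))"
      by (rule ennreal_leI[OF upper])
    also have "\<dots> = 2 * (\<Sum>k<n. ennreal (\<integral>\<xi>. w k \<xi> \<partial>L))"
      using w(1) by (subst ennreal_mult) (auto intro!: sum_nonneg simp: sum_ennreal)
    also have "\<dots> \<le> 2 * (\<Sum>k. ennreal (\<integral>\<xi>. w k \<xi> \<partial>L))"
      by (intro mult_left_mono sum_le_suminf) auto
    finally show "ennreal (?ent - lnC * deviation Y n) \<le> 2 * (\<Sum>k. ennreal (\<integral>\<xi>. w k \<xi> \<partial>L))" .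
  qed
qed

end

section \<open>Removing the truncation\<close>

lemma (in prob_space) expectation_const: "expectation (\<lambda>_. c :: real) = c"
  by (simp add: prob_space)

lemma (in prob_space) ext_variance_le_truncations:
  assumes Z: "integrable M Z"
    and B: "\<And>n::nat. ennreal (variance (\<lambda>\<omega>. max (- real n) (min (real n) (Z \<omega>)))) \<le> B"
  shows "ext_variance M Z \<le> B"
proof -
  define Zn where "Zn n \<omega> = max (- real n) (min (real n) (Z \<omega>))" for n \<omega>
  have [measurable]: "Z \<in> borel_measurable M" using Z by auto
  have [measurable]: "Zn n \<in> borel_measurable M" for n unfolding Zn_def by measurable
  have Zn_bound: "\<bar>Zn n \<omega>\<bar> \<le> real n" "\<bar>Zn n \<omega>\<bar> \<le> \<bar>Z \<omega>\<bar>" for n \<omega>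
    by (auto simp: Zn_def)
  have Zn_lim: "(\<lambda>n. Zn n \<omega>) \<longlonglongrightarrow> Z \<omega>" for \<omega>
  proof (rule tendsto_eventually)
    obtain n0 where n0: "\<bar>Z \<omega>\<bar> \<le> real n0" using real_arch_simple by blast
    have "Zn n \<omega> = Z \<omega>" if "n0 \<le> n" for n using n0 that by (auto simp: Zn_def)
    then show "\<forall>\<^sub>F n in sequentially. Zn n \<omega> = Z \<omega>" by (auto simp: eventually_sequentially)
  qed
  have EZn_lim: "(\<lambda>n. expectation (Zn n)) \<longlonglongrightarrow> expectation Z"
    by (rule integral_dominated_convergence[where w = "\<lambda>\<omega>. \<bar>Z \<omega>\<bar>"])
       (use Z Zn_lim Zn_bound in auto)
  have "ext_variance M Z = (\<integral>\<^sup>+\<omega>. liminf (\<lambda>n. ennreal ((Zn n \<omega> - expectation (Zn n))\<^sup>2)) \<partial>M)"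
    unfolding ext_variance_def
  proof (rule nn_integral_cong)
    fix \<omega>
    have "(\<lambda>n. ennreal ((Zn n \<omega> - expectation (Zn n))\<^sup>2)) \<longlonglongrightarrow> ennreal ((Z \<omega> - expectation Z)\<^sup>2)"
      by (intro tendsto_ennrealI tendsto_intros Zn_lim EZn_lim)
    then show "ennreal ((Z \<omega> - expectation Z)\<^sup>2) = liminf (\<lambda>n. ennreal ((Zn n \<omega> - expectation (Zn n))\<^sup>2))"
      by (intro lim_imp_Liminf[symmetric]) auto
  qed
  also have "\<dots> \<le> liminf (\<lambda>n. \<integral>\<^sup>+\<omega>. ennreal ((Zn n \<omega> - expectation (Zn n))\<^sup>2) \<partial>M)"
    by (rule nn_integral_liminf) measurable
  also have "\<dots> \<le> liminf (\<lambda>n::nat. B)"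
  proof (intro Liminf_mono always_eventually allI)
    fix n
    have "integrable M (\<lambda>\<omega>. (Zn n \<omega> - expectation (Zn n))\<^sup>2)"
    proof (rule integrable_const_bound[where B = "(real n + \<bar>expectation (Zn n)\<bar>)\<^sup>2"])
      show "AE \<omega> in M. norm ((Zn n \<omega> - expectation (Zn n))\<^sup>2) \<le> (real n + \<bar>expectation (Zn n)\<bar>)\<^sup>2"
      proof (rule AE_I2)
        fix \<omega>
        have "\<bar>Zn n \<omega> - expectation (Zn n)\<bar> \<le> \<bar>real n + \<bar>expectation (Zn n)\<bar>\<bar>"
          using Zn_bound(1)[of n \<omega>] by simp
        then show "norm ((Zn n \<omega> - expectation (Zn n))\<^sup>2) \<le> (real n + \<bar>expectation (Zn n)\<bar>)\<^sup>2"
          unfolding abs_le_square_iff by simp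
      qed
    qed measurable
    then show "(\<integral>\<^sup>+\<omega>. ennreal ((Zn n \<omega> - expectation (Zn n))\<^sup>2) \<partial>M) \<le> B"
      using B[of n] by (subst nn_integral_eq_integral) (auto simp: Zn_def[abs_def])
  qed
  also have "\<dots> = B" by (simp add: Liminf_const)
  finally show ?thesis .
qed

lemma mult_ln_divide_ge:
  fixes y m :: real
  assumes "0 \<le> y" "0 < m"
  shows "- m \<le> y * ln (y / m)"
proof (cases "y = 0")
  case False
  then have y: "0 < y" using assms by simp
  have "ln (m / y) \<le> m / y - 1" using y assms by (intro ln_le_minus_one) simp
  then have "y * ln (m / y) \<le> y * (m / y - 1)" using y by (intro mult_left_mono) auto
  then show ?thesis using y assms by (simp add: ln_div algebra_simps)
qed (use assms in simp)

lemma mult_ln_tendsto_0: "(\<lambda>n. (1 / real (Suc n))\<^sup>2 * ln ((1 / real (Suc n))\<^sup>2)) \<longlonglongrightarrow> 0"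
proof -
  have "(\<lambda>n. ln (real (Suc n)) / real (Suc n)) \<longlonglongrightarrow> 0"
    by (rule LIMSEQ_Suc[OF lim_ln_over_n])
  then have "(\<lambda>n. - 2 * (ln (real (Suc n)) / real (Suc n)) * (1 / real (Suc n))) \<longlonglongrightarrow> - 2 * 0 * 0"
    by (intro tendsto_intros LIMSEQ_Suc[OF lim_1_over_n])
  moreover have "(1 / real (Suc n))\<^sup>2 * ln ((1 / real (Suc n))\<^sup>2)
      = - 2 * (ln (real (Suc n)) / real (Suc n)) * (1 / real (Suc n))" for n
    by (simp add: power2_eq_square ln_mult ln_div)
  ultimately show ?thesis by simp
qed

text \<open>Fatou's lemma is applied to functions bounded below by \<open>- c\<close>; this brings its conclusion into the form
  of a difference of two integrals.\<close>

lemma (in prob_space) ext_expectation_le: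
  fixes f :: "'a \<Rightarrow> real"
  assumes [measurable]: "f \<in> borel_measurable M" and f: "\<And>\<omega>. 0 \<le> f \<omega> + c" and c: "0 \<le> c"
    and le: "(\<integral>\<^sup>+\<omega>. ennreal (f \<omega> + c) \<partial>M) \<le> B + ennreal c"
  shows "ext_expectation M f \<le> enn2ereal B"
proof (cases "B = \<top>")
  case True
  then show ?thesis by simp
next
  case False
  then obtain b where b: "B = ennreal b" "0 \<le> b" by (cases B) auto
  have "(\<integral>\<^sup>+\<omega>. ennreal (f \<omega> + c) \<partial>M) < \<infinity>"
    using le b c by (simp add: ennreal_plus[symmetric] del: ennreal_plus) (metis ennreal_less_top le_less_trans)
  then have "integrable M (\<lambda>\<omega>. f \<omega> + c)"
    using f by (intro integrableI_nonneg) auto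
  then have "integrable M (\<lambda>\<omega>. (f \<omega> + c) - c)" by (intro Bochner_Integration.integrable_diff) auto
  then have i: "integrable M f" by simp
  have "ennreal (expectation f + c) \<le> ennreal (b + c)"
    using le b c f i by (subst (asm) nn_integral_eq_integral) (auto simp: prob_space)
  then have Ef: "expectation f \<le> b"
    using b c by (subst (asm) ennreal_le_iff) auto
  have fin: "(\<integral>\<^sup>+\<omega>. ennreal (f \<omega>) \<partial>M) \<noteq> \<infinity>" "(\<integral>\<^sup>+\<omega>. ennreal (- f \<omega>) \<partial>M) \<noteq> \<infinity>"
    using i by (auto simp: real_integrable_def)
  have "ext_expectation M f = ereal (expectation f)"
    unfolding ext_expectation_def real_lebesgue_integral_def[OF i]
    using fin by (cases "\<integral>\<^sup>+\<omega>. ennreal (f \<omega>) \<partial>M"; cases "\<integral>\<^sup>+\<omega>. ennreal (- f \<omega>) \<partial>M") (auto simp: enn2ereal_ennreal)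
  then show ?thesis using Ef b by (simp add: enn2ereal_ennreal)
qed

text \<open>The truncated squares are at most \<open>(Z \<omega>)\<^sup>2 + 1\<close>, so their expectations converge, and the integrands
  of the entropy are bounded below uniformly. The case that \<open>Z\<close> vanishes almost surely is separate, because
  the quotient in the entropy degenerates there.\<close>

lemma (in prob_space) ext_entropy_square_le_truncations:
  fixes Z :: "'a \<Rightarrow> real"
  defines "Yn \<equiv> \<lambda>n \<omega>. (max (1 / real (Suc n)) (min (real (Suc n)) \<bar>Z \<omega>\<bar>))\<^sup>2"
  assumes Z_meas [measurable]: "Z \<in> borel_measurable M" and Z2: "integrable M (\<lambda>\<omega>. (Z \<omega>)\<^sup>2)"
    and B: "\<And>n. ennreal (expectation (\<lambda>\<omega>. Yn n \<omega> * ln (Yn n \<omega>))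
      - expectation (Yn n) * ln (expectation (Yn n))) \<le> B"
  shows "ext_entropy M (\<lambda>\<omega>. (Z \<omega>)\<^sup>2) \<le> enn2ereal B"
proof -
  define m where "m = expectation (\<lambda>\<omega>. (Z \<omega>)\<^sup>2)"
  define f where "f \<omega> = (Z \<omega>)\<^sup>2 * ln ((Z \<omega>)\<^sup>2 / m)" for \<omega>
  have [measurable]: "f \<in> borel_measurable M" unfolding f_def by measurable
  have ent: "ext_entropy M (\<lambda>\<omega>. (Z \<omega>)\<^sup>2) = ext_expectation M f"
    by (simp add: ext_entropy_def f_def[abs_def] m_def)
  have m0: "0 \<le> m" unfolding m_def by simp
  show ?thesis
  proof (cases "m = 0")
    case True
    then have "AE \<omega> in M. (Z \<omega>)\<^sup>2 = 0"
      using integral_nonneg_eq_0_iff_AE[OF Z2] by (simp add: m_def)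
    then have "AE \<omega> in M. f \<omega> = 0" by eventually_elim (simp add: f_def)
    then have "(\<integral>\<^sup>+\<omega>. ennreal (f \<omega>) \<partial>M) = (\<integral>\<^sup>+\<omega>. 0 \<partial>M)" "(\<integral>\<^sup>+\<omega>. ennreal (- f \<omega>) \<partial>M) = (\<integral>\<^sup>+\<omega>. 0 \<partial>M)"
      by (intro nn_integral_cong_AE; eventually_elim; simp)+
    then have "ext_expectation M f = 0"
      by (simp add: ext_expectation_def)
    then show ?thesis using ent by simp
  next
    case False
    then have m: "0 < m" using m0 by simp
    have [measurable]: "Yn n \<in> borel_measurable M" for n unfolding Yn_def by measurable
    have Yn_pos: "0 < Yn n \<omega>" for n \<omega>
      unfolding Yn_def by (intro zero_less_power less_le_trans[OF _ max.cobounded1]) simp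
    have Yn_le: "Yn n \<omega> \<le> (Z \<omega>)\<^sup>2 + 1" for n \<omega>
    proof (cases "1 / real (Suc n) \<le> min (real (Suc n)) \<bar>Z \<omega>\<bar>")
      case True
      then have "Yn n \<omega> = (min (real (Suc n)) \<bar>Z \<omega>\<bar>)\<^sup>2"
        unfolding Yn_def by (subst max_absorb2) auto
      also have "\<dots> \<le> \<bar>Z \<omega>\<bar>\<^sup>2" by (intro power_mono) auto
      finally show ?thesis by simp
    next
      case False
      then have "max (1 / real (Suc n)) (min (real (Suc n)) \<bar>Z \<omega>\<bar>) = 1 / real (Suc n)"
        by (intro max_absorb1) (rule less_imp_le[OF not_le_imp_less])
      then have "Yn n \<omega> = (1 / real (Suc n))\<^sup>2" by (simp add: Yn_def)
      also have "\<dots> \<le> 1\<^sup>2" by (intro power_mono) auto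
      also have "\<dots> \<le> (Z \<omega>)\<^sup>2 + 1" by simp
      finally show ?thesis .
    qed
    have iYn: "integrable M (Yn n)" for n
      using Yn_le Yn_pos
      by (intro Bochner_Integration.integrable_bound[OF Bochner_Integration.integrable_add[OF Z2 integrable_const[of 1]]])
         (auto simp: less_imp_le intro!: AE_I2 order_trans[OF _ abs_ge_self])
    define mn where "mn n = expectation (Yn n)" for n
    have mn_le: "mn n \<le> m + 1" for n
    proof -
      have "mn n \<le> expectation (\<lambda>\<omega>. (Z \<omega>)\<^sup>2 + 1)"
        unfolding mn_def using iYn Z2 Yn_le by (intro integral_mono) auto
      then show ?thesis using Z2 by (simp add: m_def prob_space)
    qed
    have mn_pos: "0 < mn n" for n
    proof -
      have "(1 / real (Suc n))\<^sup>2 \<le> Yn n \<omega>" for \<omega>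
        unfolding Yn_def by (intro power_mono) auto
      then have "expectation (\<lambda>\<omega>. (1 / real (Suc n))\<^sup>2) \<le> mn n"
        unfolding mn_def using iYn by (intro integral_mono) auto
      then have "(1 / real (Suc n))\<^sup>2 \<le> mn n" by (simp only: expectation_const)
      moreover have "0 < (1 / real (Suc n))\<^sup>2" by simp
      ultimately show ?thesis by (rule less_le_trans[rotated])
    qed
    have Yn_eventually: "\<forall>\<^sub>F n in sequentially. Yn n \<omega> = (Z \<omega>)\<^sup>2" if "Z \<omega> \<noteq> 0" for \<omega>
    proof -
      obtain n1 where n1: "\<bar>Z \<omega>\<bar> \<le> real n1" using real_arch_simple by blast
      have "0 < \<bar>Z \<omega>\<bar>" using that by simp
      then obtain n2 where n2: "1 / real (Suc n2) < \<bar>Z \<omega>\<bar>" by (rule nat_approx_posE)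
      have "Yn n \<omega> = (Z \<omega>)\<^sup>2" if n: "max n1 n2 \<le> n" for n
      proof -
        have "1 / real (Suc n) \<le> 1 / real (Suc n2)" using n by (intro divide_left_mono) auto
        then have "1 / real (Suc n) \<le> \<bar>Z \<omega>\<bar>" using n2 by (rule order_trans[OF _ less_imp_le])
        moreover have "\<bar>Z \<omega>\<bar> \<le> real (Suc n)" using n n1 by simp
        ultimately have "max (1 / real (Suc n)) (min (real (Suc n)) \<bar>Z \<omega>\<bar>) = \<bar>Z \<omega>\<bar>"
          by (simp only: min_absorb2 max_absorb2)
        then show ?thesis by (simp add: Yn_def)
      qed
      then show ?thesis unfolding eventually_sequentially by blast
    qed
    have Yn_0: "\<forall>\<^sub>F n in sequentially. Yn n \<omega> = (1 / real (Suc n))\<^sup>2" if "Z \<omega> = 0" for \<omega>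
      using that by (auto simp: Yn_def)
    have Yn_lim: "(\<lambda>n. Yn n \<omega>) \<longlonglongrightarrow> (Z \<omega>)\<^sup>2" for \<omega>
    proof (cases "Z \<omega> = 0")
      case True
      have "(\<lambda>n. (1 / real (Suc n))\<^sup>2) \<longlonglongrightarrow> 0\<^sup>2" by (intro tendsto_intros LIMSEQ_Suc[OF lim_1_over_n])
      then show ?thesis using tendsto_cong[OF Yn_0[OF True]] True by simp
    next
      case False
      then show ?thesis by (rule tendsto_eventually[OF Yn_eventually])
    qed
    have mn_lim: "mn \<longlonglongrightarrow> m"
      unfolding mn_def m_def
    proof (rule integral_dominated_convergence[where w = "\<lambda>\<omega>. (Z \<omega>)\<^sup>2 + 1"])
      show "AE \<omega> in M. norm (Yn n \<omega>) \<le> (Z \<omega>)\<^sup>2 + 1" for n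
        using Yn_le Yn_pos by (auto simp: less_imp_le)
    qed (use Z2 Yn_lim in auto)
    have ln_mn_lim: "(\<lambda>n. ln (mn n)) \<longlonglongrightarrow> ln m" using mn_lim m by (intro tendsto_intros) auto
    define fn where "fn n \<omega> = Yn n \<omega> * ln (Yn n \<omega> / mn n)" for n \<omega>
    have [measurable]: "fn n \<in> borel_measurable M" for n unfolding fn_def by measurable
    have fn_eq: "fn n \<omega> = Yn n \<omega> * ln (Yn n \<omega>) - Yn n \<omega> * ln (mn n)" for n \<omega>
      using Yn_pos[of n \<omega>] mn_pos[of n] by (simp add: fn_def ln_div right_diff_distrib)
    have fn_lim: "(\<lambda>n. fn n \<omega>) \<longlonglongrightarrow> f \<omega>" for \<omega>
    proof (cases "Z \<omega> = 0")
      case True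
      have "(\<lambda>n. (1 / real (Suc n))\<^sup>2 * ln ((1 / real (Suc n))\<^sup>2) - (1 / real (Suc n))\<^sup>2 * ln (mn n)) \<longlonglongrightarrow> 0 - 0\<^sup>2 * ln m"
        by (intro tendsto_intros mult_ln_tendsto_0 ln_mn_lim LIMSEQ_Suc[OF lim_1_over_n])
      moreover have "\<forall>\<^sub>F n in sequentially. fn n \<omega> = (1 / real (Suc n))\<^sup>2 * ln ((1 / real (Suc n))\<^sup>2) - (1 / real (Suc n))\<^sup>2 * ln (mn n)"
        using Yn_0[OF True] by eventually_elim (simp add: fn_eq)
      ultimately show ?thesis using True by (subst tendsto_cong) (auto simp: f_def)
    next
      case False
      have "(\<lambda>n. (Z \<omega>)\<^sup>2 * ln ((Z \<omega>)\<^sup>2) - (Z \<omega>)\<^sup>2 * ln (mn n)) \<longlonglongrightarrow> (Z \<omega>)\<^sup>2 * ln ((Z \<omega>)\<^sup>2) - (Z \<omega>)\<^sup>2 * ln m"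
        by (intro tendsto_intros ln_mn_lim)
      moreover have "\<forall>\<^sub>F n in sequentially. fn n \<omega> = (Z \<omega>)\<^sup>2 * ln ((Z \<omega>)\<^sup>2) - (Z \<omega>)\<^sup>2 * ln (mn n)"
        using Yn_eventually[OF False] by eventually_elim (simp add: fn_eq)
      ultimately show ?thesis using False m
        by (subst tendsto_cong) (auto simp: f_def ln_div right_diff_distrib)
    qed
    have fn_ge: "0 \<le> fn n \<omega> + (m + 1)" for n \<omega>
      using mult_ln_divide_ge[of "Yn n \<omega>" "mn n"] Yn_pos[of n \<omega>] mn_pos[of n] mn_le[of n]
      unfolding fn_def by linarith
    have f_ge: "0 \<le> f \<omega> + (m + 1)" for \<omega>
      using mult_ln_divide_ge[of "(Z \<omega>)\<^sup>2" m] m unfolding f_def by simp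
    have Efn: "(\<integral>\<^sup>+\<omega>. ennreal (fn n \<omega> + (m + 1)) \<partial>M) \<le> B + ennreal (m + 1)" for n
    proof -
      have phi: "\<bar>Yn n \<omega> * ln (Yn n \<omega>)\<bar> \<le> (real (Suc n))\<^sup>2 * (2 * ln (real (Suc n)))" for \<omega>
      proof -
        define k where "k = real (Suc n)"
        define s where "s = max (1 / k) (min k \<bar>Z \<omega>\<bar>)"
        have k: "1 \<le> k" by (simp add: k_def)
        then have "1 / k \<le> k" by (auto intro: order_trans[of _ 1])
        then have s: "1 / k \<le> s" "s \<le> k" unfolding s_def by auto
        have "0 < 1 / k" using k by simp
        then have s0: "0 < s" using s(1) by linarith
        have Ys: "Yn n \<omega> = s\<^sup>2" by (simp only: Yn_def s_def k_def)
        have "ln (1 / k) \<le> ln s" "ln s \<le> ln k"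
          using s s0 k by (subst ln_le_cancel_iff; simp)+
        then have "\<bar>ln s\<bar> \<le> ln k" using k by (simp add: ln_div abs_le_iff)
        moreover have "ln (s\<^sup>2) = 2 * ln s" using s0 by (simp add: power2_eq_square ln_mult)
        ultimately have "\<bar>ln (Yn n \<omega>)\<bar> \<le> 2 * ln (real (Suc n))" unfolding Ys k_def[symmetric] by simp
        moreover have "\<bar>Yn n \<omega>\<bar> \<le> (real (Suc n))\<^sup>2"
          unfolding Ys k_def[symmetric] using s s0 by (simp add: power_mono)
        ultimately show ?thesis unfolding abs_mult by (intro mult_mono) auto
      qed
      have iphi: "integrable M (\<lambda>\<omega>. Yn n \<omega> * ln (Yn n \<omega>))"
        using phi by (intro integrable_const_bound[where B = "(real (Suc n))\<^sup>2 * (2 * ln (real (Suc n)))"]) auto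
      have ifn: "integrable M (fn n)" unfolding fn_eq[abs_def] using iphi iYn[of n] by auto
      have "expectation (fn n) = expectation (\<lambda>\<omega>. Yn n \<omega> * ln (Yn n \<omega>)) - expectation (Yn n) * ln (expectation (Yn n))"
        unfolding fn_eq[abs_def] using iphi iYn[of n] by (simp add: mn_def)
      then have B': "ennreal (expectation (fn n)) \<le> B" using B[of n] by simp
      have "(\<integral>\<^sup>+\<omega>. ennreal (fn n \<omega> + (m + 1)) \<partial>M) = ennreal (expectation (fn n) + (m + 1))"
        using ifn fn_ge by (subst nn_integral_eq_integral) (auto simp: prob_space)
      also have "\<dots> \<le> ennreal (max 0 (expectation (fn n)) + (m + 1))" by (intro ennreal_leI) auto
      also have "\<dots> = ennreal (expectation (fn n)) + ennreal (m + 1)"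
        using m by (subst ennreal_plus) (auto simp: max_def ennreal_neg)
      also have "\<dots> \<le> B + ennreal (m + 1)" using B' by (rule add_right_mono)
      finally show ?thesis .
    qed
    have "(\<integral>\<^sup>+\<omega>. ennreal (f \<omega> + (m + 1)) \<partial>M) = (\<integral>\<^sup>+\<omega>. liminf (\<lambda>n. ennreal (fn n \<omega> + (m + 1))) \<partial>M)"
    proof (rule nn_integral_cong)
      fix \<omega>
      have "(\<lambda>n. ennreal (fn n \<omega> + (m + 1))) \<longlonglongrightarrow> ennreal (f \<omega> + (m + 1))"
        by (intro tendsto_ennrealI tendsto_intros fn_lim)
      then show "ennreal (f \<omega> + (m + 1)) = liminf (\<lambda>n. ennreal (fn n \<omega> + (m + 1)))"
        by (intro lim_imp_Liminf[symmetric]) auto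
    qed
    also have "\<dots> \<le> liminf (\<lambda>n. \<integral>\<^sup>+\<omega>. ennreal (fn n \<omega> + (m + 1)) \<partial>M)"
      by (rule nn_integral_liminf) measurable
    also have "\<dots> \<le> liminf (\<lambda>n::nat. B + ennreal (m + 1))"
      using Efn by (intro Liminf_mono always_eventually allI)
    also have "\<dots> = B + ennreal (m + 1)" by (simp add: Liminf_const)
    finally have "ext_expectation M f \<le> enn2ereal B"
      using m f_ge by (intro ext_expectation_le[where c = "m + 1"]) auto
    then show ?thesis using ent by simp
  qed
qed

section \<open>Decoupling along a chain of scales\<close>

context field_law
begin

definition determined :: "('i \<Rightarrow> 'm) set \<Rightarrow> 'i set \<Rightarrow> bool" where
  "determined F S \<longleftrightarrow> (\<forall>\<xi>\<in>space L. \<forall>\<eta>\<in>space L. (\<forall>t\<in>S. \<xi> t = \<eta> t) \<longrightarrow> (\<xi> \<in> F \<longleftrightarrow> \<eta> \<in> F))"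

lemma determinedD:
  "determined F S \<Longrightarrow> \<xi> \<in> space L \<Longrightarrow> \<eta> \<in> space L \<Longrightarrow> (\<And>t. t \<in> S \<Longrightarrow> \<xi> t = \<eta> t) \<Longrightarrow> \<xi> \<in> F \<longleftrightarrow> \<eta> \<in> F"
  unfolding determined_def by blast

lemma determined_mono: "determined F S \<Longrightarrow> S \<subseteq> S' \<Longrightarrow> determined F S'"
  unfolding determined_def by blast

lemma determined_Int: "determined F S \<Longrightarrow> determined G S \<Longrightarrow> determined (F \<inter> G) S"
  unfolding determined_def by blast

lemma determined_Diff: "determined F S \<Longrightarrow> determined G S \<Longrightarrow> determined (F - G) S"
  unfolding determined_def by blast

text \<open>Exchanging the values on \<open>S\<close> turns \<open>F\<close> into an event that depends on the second configuration only, and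
  \<open>W\<close> into a function of the first.\<close>

lemma nn_integral_decouple:
  assumes S: "splits S" and F [measurable]: "F \<in> sets L" and det: "determined F S"
    and V [measurable]: "V \<in> borel_measurable L" and W [measurable]: "W \<in> borel_measurable L"
    and VW: "AE p in LL. V (fst p) \<le> W (mix S (snd p) (fst p))"
  shows "(\<integral>\<^sup>+\<xi>. V \<xi> * indicator F \<xi> \<partial>L) \<le> emeasure L F * (\<integral>\<^sup>+\<xi>. W \<xi> \<partial>L)"
proof -
  let ?g = "\<lambda>p. W (mix S (snd p) (fst p)) * indicator F (fst p)"
  let ?h = "\<lambda>p. (mix S (snd p) (fst p), mix S (fst p) (snd p))"
  have "(\<integral>\<^sup>+\<xi>. V \<xi> * indicator F \<xi> \<partial>L) = (\<integral>\<^sup>+p. V (fst p) * indicator F (fst p) \<partial>LL)"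
    by (subst distr_fst[symmetric], subst nn_integral_distr) auto
  also have "\<dots> \<le> (\<integral>\<^sup>+p. ?g p \<partial>LL)"
    using VW by (intro nn_integral_mono_AE) (auto elim!: eventually_mono intro: mult_right_mono)
  also have "\<dots> = (\<integral>\<^sup>+p. ?g p \<partial>distr LL LL ?h)"
    by (simp only: distr_swap'[OF S])
  also have "\<dots> = (\<integral>\<^sup>+p. ?g (?h p) \<partial>LL)"
    by (rule nn_integral_distr) measurable
  also have "\<dots> = (\<integral>\<^sup>+p. W (fst p) * indicator F (snd p) \<partial>LL)"
  proof (rule nn_integral_cong)
    fix p assume "p \<in> space LL"
    then have sp: "fst p \<in> space L" "snd p \<in> space L" by (auto simp: space_pair_measure)
    have "mix S (snd p) (fst p) \<in> F \<longleftrightarrow> snd p \<in> F"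
      by (rule determinedD[OF det mix_in_space[OF sp(2,1)] sp(2)]) (simp add: mix_def)
    then show "?g (?h p) = W (fst p) * indicator F (snd p)"
      by (simp add: indicator_def)
  qed
  also have "\<dots> = (\<integral>\<^sup>+\<xi>. (\<integral>\<^sup>+\<eta>. W \<xi> * indicator F \<eta> \<partial>L) \<partial>L)"
    by (subst nn_integral_fst[symmetric]) auto
  also have "\<dots> = emeasure L F * (\<integral>\<^sup>+\<xi>. W \<xi> \<partial>L)"
    by (simp add: nn_integral_cmult nn_integral_multc mult.commute)
  finally show ?thesis .
qed

lemma emeasure_Int_le:
  assumes S: "splits S" and F [measurable]: "F \<in> sets L" and det: "determined F S"
    and G [measurable]: "G \<in> sets L" and Gdet: "determined G (- S)"
  shows "emeasure L (F \<inter> G) \<le> emeasure L F * emeasure L G"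
proof -
  have "AE p in LL. indicator G (fst p) \<le> (indicator G (mix S (snd p) (fst p)) :: ennreal)"
  proof (rule AE_I2)
    fix p assume "p \<in> space LL"
    then have sp: "fst p \<in> space L" "snd p \<in> space L" by (auto simp: space_pair_measure)
    have "mix S (snd p) (fst p) \<in> G \<longleftrightarrow> fst p \<in> G"
      by (rule determinedD[OF Gdet mix_in_space[OF sp(2,1)] sp(1)]) (simp add: mix_def)
    then show "indicator G (fst p) \<le> (indicator G (mix S (snd p) (fst p)) :: ennreal)"
      by (simp add: indicator_def)
  qed
  from nn_integral_decouple[OF S F det _ _ this]
  have "(\<integral>\<^sup>+\<xi>. indicator G \<xi> * indicator F \<xi> \<partial>L) \<le> emeasure L F * emeasure L G" by simp
  then show ?thesis
    by (simp add: indicator_inter_arith[symmetric] Int_commute)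
qed

end

text \<open>The data around one fixed cell: \<open>nb l\<close> is its neighbourhood of scale \<open>l\<close>, \<open>C l\<close> the event that the action
  radius of this neighbourhood is at least \<open>l\<close>, \<open>G l j\<close> the event that this radius is at least \<open>2 ^ j * l\<close>
  and less than \<open>2 ^ Suc j * l\<close>, and \<open>W s\<close> the capped squared oscillation at scale \<open>s\<close>. The assumption \<open>G_sum\<close>
  says that the windows are paid for by \<open>I\<close>; the scale \<open>6 * 2 ^ j * l\<close> is twice the scale \<open>3 * 2 ^ j * l\<close>
  of a neighbourhood that determines \<open>G l j\<close>.\<close>

locale scale_chain = field_law L T N
  for L :: "('i \<Rightarrow> 'm) measure" and T N +
  fixes nb :: "nat \<Rightarrow> 'i set" and C :: "nat \<Rightarrow> ('i \<Rightarrow> 'm) set" and G :: "nat \<Rightarrow> nat \<Rightarrow> ('i \<Rightarrow> 'm) set"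
    and W :: "nat \<Rightarrow> ('i \<Rightarrow> 'm) \<Rightarrow> ennreal" and b :: real and I :: ennreal and n0 :: nat
  assumes splits_nb: "splits (nb l)" and nb_mono: "l \<le> l' \<Longrightarrow> nb l \<subseteq> nb l'"
    and n0: "1 \<le> n0"
    and W_meas [measurable]: "W s \<in> borel_measurable L"
    and W_mono: "s \<le> s' \<Longrightarrow> AE \<xi> in L. W s \<xi> \<le> W s' \<xi>"
    and W_le: "W s \<xi> \<le> ennreal b"
    and C_meas [measurable]: "n0 \<le> l \<Longrightarrow> C l \<in> sets L" and G_meas [measurable]: "n0 \<le> l \<Longrightarrow> G l j \<in> sets L"
    and G_det: "n0 \<le> l \<Longrightarrow> determined (G l j) (nb (l + 2 ^ Suc j * l) - nb l)"
    and G_cover: "n0 \<le> l \<Longrightarrow> AE \<xi> in L. \<xi> \<in> C l \<longrightarrow> (\<exists>j. \<xi> \<in> G l j)"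
    and W_local: "n0 \<le> l \<Longrightarrow> AE p in LL. fst p \<notin> C l \<longrightarrow> W (2 * l) (fst p) \<le> W (2 * l) (mix (nb l) (snd p) (fst p))"
    and G_prob: "n0 \<le> l \<Longrightarrow> (\<Sum>j. emeasure L (G l j)) \<le> ennreal (1 / 4)"
    and G_sum: "n0 \<le> l \<Longrightarrow> (\<Sum>j. emeasure L (G l j) * (\<integral>\<^sup>+\<xi>. W (6 * 2 ^ j * l) \<xi> \<partial>L)) \<le> ennreal (1 / 2) * I"
begin

definition e :: "nat \<Rightarrow> ennreal" where
  "e s = (\<integral>\<^sup>+\<xi>. W s \<xi> \<partial>L)"

text \<open>Off \<open>C l\<close> the event and the oscillation decouple directly. On \<open>C l\<close> the event is refined by the windows
  \<open>G l j\<close>, which are independent of it, and the induction hypothesis applies at the scale \<open>3 * 2 ^ j * l\<close>.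
  The factor \<open>2 / 3\<close> is the fixed point of \<open>c = 1 / 2 + c / 4\<close>, and the bound \<open>b\<close> starts the induction.\<close>

lemma chain_step:
  assumes "n0 \<le> l" and F [measurable]: "F \<in> sets L" and det: "determined F (nb l)"
  shows "(\<integral>\<^sup>+\<xi>. W (2 * l) \<xi> * indicator F \<xi> \<partial>L)
    \<le> emeasure L F * (e (2 * l) + ennreal (2 / 3) * I + ennreal (b * (1 / 4) ^ n))"
  using assms
proof (induction n arbitrary: l F)
  case 0
  note [measurable] = 0(2)
  have "(\<integral>\<^sup>+\<xi>. W (2 * l) \<xi> * indicator F \<xi> \<partial>L) \<le> (\<integral>\<^sup>+\<xi>. ennreal b * indicator F \<xi> \<partial>L)"
    by (intro nn_integral_mono mult_right_mono W_le) auto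
  also have "\<dots> = emeasure L F * ennreal b" by (simp add: nn_integral_cmult mult.commute)
  also have "\<dots> \<le> emeasure L F * (e (2 * l) + ennreal (2 / 3) * I + ennreal (b * (1 / 4) ^ 0))"
    by (intro mult_left_mono) (auto intro: add_increasing)
  finally show ?case .
next
  case (Suc n)
  note l = \<open>n0 \<le> l\<close>
  note [measurable] = Suc.prems(2) C_meas[OF l] G_meas[OF l]
  let ?K = "ennreal (2 / 3) * I + ennreal (b * (1 / 4) ^ n)"
  have "(\<integral>\<^sup>+\<xi>. W (2 * l) \<xi> * indicator F \<xi> \<partial>L)
      \<le> (\<integral>\<^sup>+\<xi>. W (2 * l) \<xi> * indicator (space L - C l) \<xi> * indicator F \<xi>
            + (\<Sum>j. W (2 * l) \<xi> * indicator (F \<inter> G l j) \<xi>) \<partial>L)"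
  proof (rule nn_integral_mono_AE)
    show "AE \<xi> in L. W (2 * l) \<xi> * indicator F \<xi> \<le> W (2 * l) \<xi> * indicator (space L - C l) \<xi> * indicator F \<xi>
            + (\<Sum>j. W (2 * l) \<xi> * indicator (F \<inter> G l j) \<xi>)"
      using G_cover[OF l] AE_space
    proof eventually_elim
      case (elim \<xi>)
      show ?case
      proof (cases "\<xi> \<in> F \<and> \<xi> \<in> C l")
        case True
        then obtain j where "\<xi> \<in> G l j" using elim by blast
        then have "W (2 * l) \<xi> * indicator F \<xi> \<le> (\<Sum>j\<in>{j}. W (2 * l) \<xi> * indicator (F \<inter> G l j) \<xi>)"
          using True by simp
        also have "\<dots> \<le> (\<Sum>j. W (2 * l) \<xi> * indicator (F \<inter> G l j) \<xi>)"
          by (rule sum_le_suminf) auto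
        finally show ?thesis by (rule add_increasing[rotated]) simp
      qed (use elim in auto)
    qed
  qed
  also have "\<dots> = (\<integral>\<^sup>+\<xi>. W (2 * l) \<xi> * indicator (space L - C l) \<xi> * indicator F \<xi> \<partial>L)
      + (\<Sum>j. \<integral>\<^sup>+\<xi>. W (2 * l) \<xi> * indicator (F \<inter> G l j) \<xi> \<partial>L)"
    by (subst nn_integral_add, measurable, subst nn_integral_suminf) simp_all
  also have "(\<integral>\<^sup>+\<xi>. W (2 * l) \<xi> * indicator (space L - C l) \<xi> * indicator F \<xi> \<partial>L) \<le> emeasure L F * e (2 * l)"
    unfolding e_def
  proof (rule nn_integral_decouple[OF splits_nb Suc.prems(2,3)])
    show "AE p in LL. W (2 * l) (fst p) * indicator (space L - C l) (fst p) \<le> W (2 * l) (mix (nb l) (snd p) (fst p))"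
      using W_local[OF l] by eventually_elim (auto simp: indicator_def)
  qed measurable
  also have "(\<Sum>j. \<integral>\<^sup>+\<xi>. W (2 * l) \<xi> * indicator (F \<inter> G l j) \<xi> \<partial>L)
      \<le> (\<Sum>j. emeasure L F * (emeasure L (G l j) * e (6 * 2 ^ j * l) + emeasure L (G l j) * ?K))"
  proof (intro suminf_le allI)
    fix j
    \<comment> \<open>The event \<open>F\<close> is determined at scale \<open>l\<close> and \<open>G l j\<close> at scale \<open>l + 2 ^ Suc j * l\<close>; both are at most \<open>l'\<close>.\<close>
    define l' where "l' = 3 * 2 ^ j * l"
    have l': "n0 \<le> l'" "l \<le> l'" "l + 2 ^ Suc j * l \<le> l'"
    proof -
      have "1 * l \<le> 2 ^ j * l" by (intro mult_right_mono) auto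
      moreover have "l' = 3 * (2 ^ j * l)" "2 ^ Suc j * l = 2 * (2 ^ j * l)" by (simp_all add: l'_def)
      ultimately show "n0 \<le> l'" "l \<le> l'" "l + 2 ^ Suc j * l \<le> l'" using l by linarith+
    qed
    have "(\<integral>\<^sup>+\<xi>. W (2 * l) \<xi> * indicator (F \<inter> G l j) \<xi> \<partial>L) \<le> (\<integral>\<^sup>+\<xi>. W (2 * l') \<xi> * indicator (F \<inter> G l j) \<xi> \<partial>L)"
      using W_mono[of "2 * l" "2 * l'"] l'
      by (intro nn_integral_mono_AE) (auto elim!: eventually_mono intro: mult_right_mono)
    also have "\<dots> \<le> emeasure L (F \<inter> G l j) * (e (2 * l') + ?K)"
    proof -
      have "determined (F \<inter> G l j) (nb l')"
        using Suc.prems(3) G_det[OF l, of j] l' nb_mono[of l l'] nb_mono[of "l + 2 ^ Suc j * l" l']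
        by (intro determined_Int) (auto elim!: determined_mono)
      then show ?thesis using Suc.IH[OF l'(1), of "F \<inter> G l j"] by (simp add: add.assoc)
    qed
    also have "\<dots> \<le> (emeasure L F * emeasure L (G l j)) * (e (2 * l') + ?K)"
      using G_det[OF l, of j]
      by (intro mult_right_mono emeasure_Int_le[OF splits_nb Suc.prems(2,3)])
         (auto elim!: determined_mono)
    also have "\<dots> = emeasure L F * (emeasure L (G l j) * e (6 * 2 ^ j * l) + emeasure L (G l j) * ?K)"
      by (simp add: l'_def distrib_left mult.assoc)
    finally show "(\<integral>\<^sup>+\<xi>. W (2 * l) \<xi> * indicator (F \<inter> G l j) \<xi> \<partial>L) \<le> \<dots>" .
  qed auto
  also have "\<dots> = emeasure L F * ((\<Sum>j. emeasure L (G l j) * e (6 * 2 ^ j * l)) + (\<Sum>j. emeasure L (G l j)) * ?K)"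
    by (simp add: ennreal_suminf_cmult ennreal_suminf_multc suminf_add[symmetric])
  also have "\<dots> \<le> emeasure L F * (ennreal (1 / 2) * I + ennreal (1 / 4) * ?K)"
    using G_sum[OF l] G_prob[OF l]
    by (intro mult_left_mono add_mono mult_right_mono) (auto simp: e_def)
  also have "ennreal (1 / 2) * I + ennreal (1 / 4) * ?K = ennreal (2 / 3) * I + ennreal (b * (1 / 4) ^ Suc n)"
  proof -
    have "ennreal (1 / 2) * I + ennreal (1 / 4) * (ennreal (2 / 3) * I) = ennreal (1 / 2 + 1 / 4 * (2 / 3)) * I"
    proof -
      have "ennreal (1 / 2 + 1 / 4 * (2 / 3)) = ennreal (1 / 2) + ennreal (1 / 4) * ennreal (2 / 3)"
        by (subst ennreal_mult[symmetric], simp, simp, subst ennreal_plus[symmetric]) simp_all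
      then show ?thesis by (simp only: distrib_right mult.assoc)
    qed
    moreover have "ennreal (1 / 4) * ennreal (b * (1 / 4) ^ n) = ennreal (b * (1 / 4) ^ Suc n)"
      by (simp add: ennreal_mult'[symmetric] mult.left_commute)
    moreover have "1 / 2 + 1 / 4 * (2 / 3) = (2 / 3 :: real)" by simp
    ultimately show ?thesis by (simp only: distrib_left add.assoc[symmetric])
  qed
  finally show ?case by (simp add: distrib_left add.assoc add_mono)
qed

lemma chain_bound:
  assumes "n0 \<le> l" and "F \<in> sets L" and "determined F (nb l)"
  shows "(\<integral>\<^sup>+\<xi>. W (2 * l) \<xi> * indicator F \<xi> \<partial>L) \<le> emeasure L F * (e (2 * l) + ennreal (2 / 3) * I)"
proof -
  have "(\<lambda>n. emeasure L F * (e (2 * l) + ennreal (2 / 3) * I + ennreal (b * (1 / 4) ^ n)))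
      \<longlonglongrightarrow> emeasure L F * (e (2 * l) + ennreal (2 / 3) * I + ennreal (b * 0))"
    by (intro ennreal_tendsto_cmult tendsto_add tendsto_const tendsto_ennrealI tendsto_mult LIMSEQ_realpow_zero)
       (auto simp: emeasure_eq_measure)
  then have "(\<lambda>n. emeasure L F * (e (2 * l) + ennreal (2 / 3) * I + ennreal (b * (1 / 4) ^ n)))
      \<longlonglongrightarrow> emeasure L F * (e (2 * l) + ennreal (2 / 3) * I)" by simp
  then show ?thesis
    by (rule LIMSEQ_le_const) (use chain_step[OF assms] in blast)
qed

text \<open>The first step differs from the others: the radius of the cell itself may be large with any
  probability, but its windows are determined by smaller neighbourhoods, of scale \<open>2 * 2 ^ j * n0\<close>. This
  leaves more room and gives \<open>1 / 4\<close> in place of \<open>1 / 2\<close>, and \<open>1 / 4 + 2 / 3 \<le> 1\<close>.\<close>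

theorem chain_start:
  assumes C0 [measurable]: "C0 \<in> sets L" and G0 [measurable]: "\<And>j. G0 j \<in> sets L"
    and det: "\<And>j. determined (G0 j) (nb (2 * 2 ^ j * n0))"
    and prob: "(\<Sum>j. emeasure L (G0 j)) \<le> 1"
    and sum: "(\<Sum>j. emeasure L (G0 j) * (\<integral>\<^sup>+\<xi>. W (4 * 2 ^ j * n0) \<xi> \<partial>L)) \<le> ennreal (1 / 4) * I"
  shows "(\<integral>\<^sup>+\<xi>. W n0 \<xi> * indicator (space L - C0) \<xi> + (\<Sum>j. W (2 * 2 ^ j * n0) \<xi> * indicator (G0 j) \<xi>) \<partial>L)
    \<le> (\<integral>\<^sup>+\<xi>. W n0 \<xi> \<partial>L) + I"
proof -
  have "(\<integral>\<^sup>+\<xi>. W n0 \<xi> * indicator (space L - C0) \<xi> + (\<Sum>j. W (2 * 2 ^ j * n0) \<xi> * indicator (G0 j) \<xi>) \<partial>L)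
      = (\<integral>\<^sup>+\<xi>. W n0 \<xi> * indicator (space L - C0) \<xi> \<partial>L) + (\<Sum>j. \<integral>\<^sup>+\<xi>. W (2 * 2 ^ j * n0) \<xi> * indicator (G0 j) \<xi> \<partial>L)"
    by (subst nn_integral_add, measurable, subst nn_integral_suminf) simp_all
  also have "\<dots> \<le> e n0 + (\<Sum>j. emeasure L (G0 j) * e (4 * 2 ^ j * n0) + emeasure L (G0 j) * (ennreal (2 / 3) * I))"
  proof (intro add_mono suminf_le allI)
    show "(\<integral>\<^sup>+\<xi>. W n0 \<xi> * indicator (space L - C0) \<xi> \<partial>L) \<le> e n0"
      unfolding e_def by (intro nn_integral_mono) (auto simp: indicator_def)
    fix j
    define l where "l = 2 * 2 ^ j * n0"
    have l: "n0 \<le> l"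
    proof -
      have "1 * n0 \<le> 2 ^ j * n0" by (intro mult_right_mono) auto
      moreover have "l = 2 * (2 ^ j * n0)" by (simp add: l_def)
      ultimately show ?thesis by linarith
    qed
    have "(\<integral>\<^sup>+\<xi>. W l \<xi> * indicator (G0 j) \<xi> \<partial>L) \<le> (\<integral>\<^sup>+\<xi>. W (2 * l) \<xi> * indicator (G0 j) \<xi> \<partial>L)"
      using W_mono[of l "2 * l"]
      by (intro nn_integral_mono_AE) (auto elim!: eventually_mono intro: mult_right_mono)
    also have "\<dots> \<le> emeasure L (G0 j) * (e (2 * l) + ennreal (2 / 3) * I)"
      using det[of j] by (intro chain_bound[OF l]) (auto simp: l_def)
    finally show "(\<integral>\<^sup>+\<xi>. W (2 * 2 ^ j * n0) \<xi> * indicator (G0 j) \<xi> \<partial>L)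
        \<le> emeasure L (G0 j) * e (4 * 2 ^ j * n0) + emeasure L (G0 j) * (ennreal (2 / 3) * I)"
      by (simp add: l_def distrib_left mult.assoc)
  qed auto
  also have "(\<Sum>j. emeasure L (G0 j) * e (4 * 2 ^ j * n0) + emeasure L (G0 j) * (ennreal (2 / 3) * I))
      = (\<Sum>j. emeasure L (G0 j) * e (4 * 2 ^ j * n0)) + (\<Sum>j. emeasure L (G0 j)) * (ennreal (2 / 3) * I)"
    by (simp add: ennreal_suminf_multc suminf_add[symmetric])
  also have "\<dots> \<le> ennreal (1 / 4) * I + 1 * (ennreal (2 / 3) * I)"
    using sum prob by (intro add_mono mult_right_mono) (auto simp: e_def)
  also have "\<dots> = ennreal (1 / 4 + 2 / 3) * I"
    by (subst ennreal_plus) (auto simp: distrib_right)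
  also have "\<dots> \<le> 1 * I" by (intro mult_right_mono) (auto simp: ennreal_le_1)
  finally show ?thesis by (simp add: e_def add_mono)
qed

end

section \<open>Summation over dyadic scales\<close>

text \<open>With \<open>b j = 2 ^ j * a\<close>, the intervals \<open>J j\<close> from \<open>k * b j\<close> to \<open>8 * b j\<close> are disjoint because \<open>k \<ge> 4\<close>. On
  \<open>J j\<close> the density \<open>8 / t * p (t / 2)\<close> is at least \<open>p (4 * b j) / b j\<close>, and the interval has length
  \<open>(8 - k) * b j\<close>.\<close>

lemma scale_windows_sum_le:
  fixes p :: "real \<Rightarrow> real" and H :: "real \<Rightarrow> ennreal" and e :: "nat \<Rightarrow> ennreal" and a k :: nat
  assumes R: "1 \<le> R" "R \<le> real a" and k: "4 \<le> k" "k \<le> 8"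
    and p_nonneg: "\<And>l. 0 \<le> l \<Longrightarrow> 0 \<le> p l" and p_anti: "antimono_on {0..} p"
    and H: "\<And>s. AE t in lborel. real s \<le> t \<longrightarrow> e s \<le> H t"
  shows "ennreal (8 - real k) * (\<Sum>j. ennreal (p (4 * (2 ^ j * real a))) * e (k * 2 ^ j * a))
    \<le> (\<integral>\<^sup>+t. H t * ennreal (8 / t * p (t / 2)) * indicator {4 * R<..} t \<partial>lborel)"
proof -
  define b where "b j = 2 ^ j * real a" for j :: nat
  have b_pos: "0 < b j" for j using R by (simp add: b_def)
  have b_mono: "2 * b i \<le> b j" if "i < j" for i j
  proof -
    have "(2::real) ^ Suc i \<le> 2 ^ j" using that by (intro power_increasing) auto
    then have "2 ^ Suc i * real a \<le> 2 ^ j * real a" by (intro mult_right_mono) auto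
    then show ?thesis by (simp add: b_def)
  qed
  have R_b: "R \<le> b j" for j
  proof -
    have "1 * real a \<le> 2 ^ j * real a" by (intro mult_right_mono) auto
    then show ?thesis using R unfolding b_def by linarith
  qed
  define J where "J j = {real k * b j<..<8 * b j}" for j
  define c where "c j = ennreal (p (4 * b j) / b j) * e (k * 2 ^ j * a)" for j
  have window: "ennreal (8 - real k) * (ennreal (p (4 * b j)) * e (k * 2 ^ j * a)) = (\<integral>\<^sup>+t. c j * indicator (J j) t \<partial>lborel)" for j
  proof -
    have "emeasure lborel (J j) = ennreal ((8 - real k) * b j)"
      unfolding J_def using k b_pos[of j] by (subst emeasure_lborel_Ioo) (auto simp: left_diff_distrib mult_right_mono)
    then have "(\<integral>\<^sup>+t. c j * indicator (J j) t \<partial>lborel) = c j * ennreal ((8 - real k) * b j)"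
      by (simp add: nn_integral_cmult_indicator J_def)
    also have "\<dots> = (ennreal (p (4 * b j) / b j) * ennreal ((8 - real k) * b j)) * e (k * 2 ^ j * a)"
      by (simp add: c_def mult_ac)
    also have "ennreal (p (4 * b j) / b j) * ennreal ((8 - real k) * b j) = ennreal ((8 - real k) * p (4 * b j))"
    proof -
      have "p (4 * b j) / b j * ((8 - real k) * b j) = (8 - real k) * p (4 * b j)"
        using b_pos[of j] by simp
      then show ?thesis
        using b_pos[of j] p_nonneg[of "4 * b j"] k by (subst ennreal_mult[symmetric]) auto
    qed
    also have "\<dots> = ennreal (8 - real k) * ennreal (p (4 * b j))"
      using b_pos[of j] p_nonneg[of "4 * b j"] k by (intro ennreal_mult) auto
    finally show ?thesis by (simp add: mult.assoc)
  qed
  have disj: "i = j" if "t \<in> J i" "t \<in> J j" for i j t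
  proof (rule ccontr)
    have *: False if "i < j" "t \<in> J i" "t \<in> J j" for i j
    proof -
      have "4 * b j \<le> real k * b j" using k b_pos[of j] by (intro mult_right_mono) auto
      then show False using b_mono[OF that(1)] that(2,3) by (auto simp: J_def)
    qed
    assume "i \<noteq> j"
    then show False using *[of i j] *[of j i] that by (cases i j rule: linorder_cases) auto
  qed
  have "ennreal (8 - real k) * (\<Sum>j. ennreal (p (4 * b j)) * e (k * 2 ^ j * a)) = (\<Sum>j. \<integral>\<^sup>+t. c j * indicator (J j) t \<partial>lborel)"
    by (subst ennreal_suminf_cmult[symmetric]) (simp add: window)
  also have "\<dots> = (\<integral>\<^sup>+t. (\<Sum>j. c j * indicator (J j) t) \<partial>lborel)"
    by (rule nn_integral_suminf[symmetric]) (simp add: J_def)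
  also have "\<dots> \<le> (\<integral>\<^sup>+t. H t * ennreal (8 / t * p (t / 2)) * indicator {4 * R<..} t \<partial>lborel)"
  proof (rule nn_integral_mono_AE)
    have "AE t in lborel. \<forall>s. real s \<le> t \<longrightarrow> e s \<le> H t" using H by (simp add: AE_all_countable)
    then show "AE t in lborel. (\<Sum>j. c j * indicator (J j) t) \<le> H t * ennreal (8 / t * p (t / 2)) * indicator {4 * R<..} t"
    proof eventually_elim
      case (elim t)
      show ?case
      proof (cases "\<exists>j. t \<in> J j")
        case True
        then obtain j where j: "t \<in> J j" by blast
        have "(\<Sum>i. c i * indicator (J i) t) = (\<Sum>i\<in>{j}. c i * indicator (J i) t)"
          using disj[OF j] by (intro suminf_finite) (auto simp: indicator_def)
        also have "\<dots> = e (k * 2 ^ j * a) * ennreal (p (4 * b j) / b j)" using j by (simp add: c_def mult.commute)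
        also have "\<dots> \<le> H t * ennreal (8 / t * p (t / 2))"
        proof (intro mult_mono ennreal_leI)
          have "real (k * 2 ^ j * a) = real k * b j" by (simp add: b_def)
          moreover have "real k * b j \<le> t" using j by (simp add: J_def)
          ultimately have "real (k * 2 ^ j * a) \<le> t" by (simp only:)
          then show "e (k * 2 ^ j * a) \<le> H t" using elim by blast
          have t: "0 < t" "t < 8 * b j" using j b_pos[of j] k by (auto simp: J_def intro: le_less_trans[rotated])
          have "p (4 * b j) \<le> p (t / 2)"
            using t b_pos[of j] by (intro monotone_onD[OF p_anti]) auto
          moreover have "1 / b j \<le> 8 / t" using t b_pos[of j] by (simp add: field_simps)
          ultimately have "1 / b j * p (4 * b j) \<le> 8 / t * p (t / 2)"
            using t b_pos[of j] p_nonneg[of "4 * b j"] by (intro mult_mono) auto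
          then show "p (4 * b j) / b j \<le> 8 / t * p (t / 2)" by simp
        qed auto
        also have "\<dots> = H t * ennreal (8 / t * p (t / 2)) * indicator {4 * R<..} t"
        proof -
          have "4 * b j \<le> real k * b j" using k b_pos[of j] by (intro mult_right_mono) auto
          then have "4 * R < t" using j R_b[of j] by (auto simp: J_def)
          then show ?thesis by simp
        qed
        finally show ?thesis .
      next
        case False
        then show ?thesis by simp
      qed
    qed
  qed
  finally show ?thesis by (simp add: b_def)
qed

lemma borel_measurable_antimono_on_nonneg:
  fixes p :: "real \<Rightarrow> real"
  assumes "antimono_on {0..} p"
  shows "(\<lambda>t. p (max 0 t)) \<in> borel_measurable borel"
proof -
  have "mono (\<lambda>t. - p (max 0 t))"
    using assms by (auto simp: monotone_on_def intro!: monoI)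
  from borel_measurable_mono[OF this] have "(\<lambda>t. - (- p (max 0 t))) \<in> borel_measurable borel"
    by measurable
  then show ?thesis by simp
qed

text \<open>The measure on scales in the statement: \<open>(t + 1) ^ (- d) * \<pi> t\<close> for \<open>t \<ge> 0\<close>.\<close>

definition scale_density :: "nat \<Rightarrow> real \<Rightarrow> (real \<Rightarrow> real) \<Rightarrow> real \<Rightarrow> ennreal" where
  "scale_density d R p t = ennreal (inverse ((t + 1) ^ d) * weight d R p t) * indicator {0..} t"

lemma scale_density_eq:
  assumes "0 \<le> t"
  shows "scale_density d R p t = (if t \<le> 4 * R then 1 else ennreal (8 / t * p (t / 2)))"
proof -
  have "inverse ((t + 1) ^ d) * ((t + 1) ^ d * x) = x" for x :: real
    using assms by (simp add: field_simps)
  then have "inverse ((t + 1) ^ d) * weight d R p t = (if t \<le> 4 * R then 1 else 8 / t * p (t / 2))"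
    unfolding weight_def by simp
  then show ?thesis using assms by (simp add: scale_density_def del: times_divide_eq_left)
qed

lemma scale_density_measurable:
  assumes "antimono_on {0..} p"
  shows "scale_density d R p \<in> borel_measurable borel"
proof -
  note [measurable] = borel_measurable_antimono_on_nonneg[OF assms]
  have m: "(\<lambda>t. p (max 0 (t / 2))) \<in> borel_measurable borel" by measurable
  have eq: "scale_density d R p t = (if t < 0 then 0 else if t \<le> 4 * R then 1 else ennreal (8 / t * p (max 0 (t / 2))))" for t
    by (cases "0 \<le> t") (auto simp: scale_density_eq, auto simp: scale_density_def)
  note [measurable] = m
  show ?thesis unfolding eq[abs_def] by measurable
qed

text \<open>The scales between \<open>2 * R\<close> and \<open>4 * R\<close> have density \<open>1\<close> and total length \<open>2 * R \<ge> 1\<close>, which pays for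
  the constant \<open>c\<close>.\<close>

lemma base_plus_windows_le:
  fixes p :: "real \<Rightarrow> real" and H :: "real \<Rightarrow> ennreal"
  assumes R: "1 \<le> R" and n0: "real n0 \<le> 2 * R"
    and p_anti: "antimono_on {0..} p"
    and H_meas [measurable]: "H \<in> borel_measurable borel"
    and H: "AE t in lborel. real n0 \<le> t \<longrightarrow> c \<le> H t"
  shows "c + (\<integral>\<^sup>+t. H t * ennreal (8 / t * p (t / 2)) * indicator {4 * R<..} t \<partial>lborel)
    \<le> (\<integral>\<^sup>+t. H t * scale_density d R p t \<partial>lborel)"
proof -
  note [measurable] = scale_density_measurable[OF p_anti, of d R]
  have "c * 1 \<le> c * ennreal (2 * R)" using R by (intro mult_left_mono) (auto simp: ennreal_ge_1)
  also have "\<dots> = (\<integral>\<^sup>+t. c * indicator {2 * R..4 * R} t \<partial>lborel)"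
    using R by (subst nn_integral_cmult_indicator) auto
  also have "\<dots> \<le> (\<integral>\<^sup>+t. H t * scale_density d R p t * indicator {..4 * R} t \<partial>lborel)"
    using H by (intro nn_integral_mono_AE, elim eventually_mono) (use R n0 in \<open>auto simp: indicator_def scale_density_eq\<close>)
  finally have base: "c \<le> (\<integral>\<^sup>+t. H t * scale_density d R p t * indicator {..4 * R} t \<partial>lborel)" by simp
  have tail: "(\<integral>\<^sup>+t. H t * ennreal (8 / t * p (t / 2)) * indicator {4 * R<..} t \<partial>lborel)
      = (\<integral>\<^sup>+t. H t * scale_density d R p t * indicator {4 * R<..} t \<partial>lborel)"
    using R by (intro nn_integral_cong) (auto simp: indicator_def scale_density_eq)
  have parts: "(\<integral>\<^sup>+t. H t * scale_density d R p t * indicator {..4 * R} t \<partial>lborel)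
      + (\<integral>\<^sup>+t. H t * scale_density d R p t * indicator {4 * R<..} t \<partial>lborel)
      = (\<integral>\<^sup>+t. H t * scale_density d R p t \<partial>lborel)"
    by (subst nn_integral_add[symmetric]) (auto intro!: nn_integral_cong simp: indicator_def)
  show ?thesis unfolding tail parts[symmetric] by (rule add_right_mono[OF base])
qed

section \<open>Factorization and the law of a completely independent field\<close>

text \<open>The Doob-Dynkin lemma. The function \<open>h\<close> is rebuilt from its rational superlevel sets.\<close>

lemma vimage_algebra_factor:
  fixes f :: "'a \<Rightarrow> ereal"
  assumes f: "f \<in> borel_measurable (vimage_algebra X g K)" and g: "g \<in> X \<rightarrow> space K"
  obtains h where "h \<in> borel_measurable K" "\<And>x. x \<in> X \<Longrightarrow> f x = h (g x)"
proof -
  have "\<exists>B\<in>sets K. {x \<in> X. ereal (of_rat q) < f x} = g -` B \<inter> X" for q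
  proof -
    have "{x \<in> space (vimage_algebra X g K). ereal (of_rat q) < f x} \<in> sets (vimage_algebra X g K)"
      using f by measurable
    then show ?thesis using sets_vimage_algebra2[OF g] by auto
  qed
  then obtain B where B: "\<And>q. B q \<in> sets K" "\<And>q. {x \<in> X. ereal (of_rat q) < f x} = g -` B q \<inter> X"
    by metis
  note [measurable] = B(1)
  define h where "h y = (SUP q. if y \<in> B q then ereal (of_rat q) else - \<infinity>)" for y
  have "h \<in> borel_measurable K" unfolding h_def by measurable
  moreover have "f x = h (g x)" if "x \<in> X" for x
  proof -
    have mem: "g x \<in> B q \<longleftrightarrow> ereal (of_rat q) < f x" for q using B(2)[of q] that by blast
    show ?thesis
    proof (rule antisym)
      show "h (g x) \<le> f x" unfolding h_def by (rule SUP_least) (simp add: mem less_imp_le)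
      show "f x \<le> h (g x)"
      proof (rule ccontr)
        assume "\<not> f x \<le> h (g x)"
        then have "h (g x) < f x" by simp
        then obtain q where q: "h (g x) < ereal (of_rat q)" "ereal (of_rat q) < f x" using ereal_dense3 by blast
        then have "ereal (of_rat q) \<le> h (g x)"
          unfolding h_def by (intro SUP_upper2[of q]) (auto simp: mem)
        then show False using q(1) by simp
      qed
    qed
  qed
  ultimately show ?thesis using that by blast
qed

context prob_space
begin

text \<open>The blocks of pieces indexed by \<open>J\<close> and by its complement are independent, and the restriction to a
  union of pieces is glued from the corresponding block.\<close>

lemma indep_var_union_pieces:
  fixes P :: "'z \<Rightarrow> 'i set" and N :: "'b measure"
  assumes ind: "indep_vars (\<lambda>z. PiM (P z) (\<lambda>_. N)) (\<lambda>z \<omega>. restrict (X \<omega>) (P z)) UNIV"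
    and disj: "disjoint_family P"
  shows "indep_var (PiM (\<Union>z\<in>J. P z) (\<lambda>_. N)) (\<lambda>\<omega>. restrict (X \<omega>) (\<Union>z\<in>J. P z))
    (PiM (\<Union>z\<in>- J. P z) (\<lambda>_. N)) (\<lambda>\<omega>. restrict (X \<omega>) (\<Union>z\<in>- J. P z))"
proof -
  define piece where "piece t = (THE z. t \<in> P z)" for t
  have piece: "piece t = z" if "t \<in> P z" for t z
    unfolding piece_def using that disj by (intro the_equality) (auto simp: disjoint_family_on_def)
  define glue where "glue J h = (\<lambda>t\<in>(\<Union>z\<in>J. P z). h (piece t) t)" for J and h :: "'z \<Rightarrow> 'i \<Rightarrow> 'b"
  have glue_meas: "glue J \<in> PiM J (\<lambda>z. PiM (P z) (\<lambda>_. N)) \<rightarrow>\<^sub>M PiM (\<Union>z\<in>J. P z) (\<lambda>_. N)" for J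
    unfolding glue_def[abs_def]
  proof (rule measurable_restrict)
    fix t assume "t \<in> (\<Union>z\<in>J. P z)"
    then obtain z where z: "z \<in> J" "t \<in> P z" by blast
    have "(\<lambda>h. h z t) \<in> PiM J (\<lambda>z. PiM (P z) (\<lambda>_. N)) \<rightarrow>\<^sub>M N"
      by (rule measurable_compose[OF measurable_component_singleton[OF z(1)]])
         (rule measurable_component_singleton[OF z(2)])
    then show "(\<lambda>h. h (piece t) t) \<in> PiM J (\<lambda>z. PiM (P z) (\<lambda>_. N)) \<rightarrow>\<^sub>M N"
      using piece[OF z(2)] by simp
  qed
  have glue_eq: "glue J \<circ> (\<lambda>\<omega>. restrict (\<lambda>z. restrict (X \<omega>) (P z)) J) = (\<lambda>\<omega>. restrict (X \<omega>) (\<Union>z\<in>J. P z))" for J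
  proof (intro ext)
    fix \<omega> t
    show "(glue J \<circ> (\<lambda>\<omega>. restrict (\<lambda>z. restrict (X \<omega>) (P z)) J)) \<omega> t = restrict (X \<omega>) (\<Union>z\<in>J. P z) t"
    proof (cases "t \<in> (\<Union>z\<in>J. P z)")
      case True
      then obtain z where z: "z \<in> J" "t \<in> P z" by blast
      then show ?thesis using piece[OF z(2)] True by (simp add: glue_def)
    next
      case False
      then show ?thesis unfolding glue_def comp_def by (simp only: restrict_apply if_False)
    qed
  qed
  have "indep_var (PiM J (\<lambda>z. PiM (P z) (\<lambda>_. N))) (\<lambda>\<omega>. restrict (\<lambda>z. restrict (X \<omega>) (P z)) J)
      (PiM (- J) (\<lambda>z. PiM (P z) (\<lambda>_. N))) (\<lambda>\<omega>. restrict (\<lambda>z. restrict (X \<omega>) (P z)) (- J))"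
    by (rule indep_var_restrict[OF ind]) auto
  from indep_var_compose[OF this glue_meas glue_meas] show ?thesis
    by (simp only: glue_eq)
qed

lemma field_law_distr:
  assumes "X \<in> M \<rightarrow>\<^sub>M PiM T (\<lambda>_. N)"
  shows "field_law (distr M (PiM T (\<lambda>_. N)) X) T N"
proof -
  interpret L: prob_space "distr M (PiM T (\<lambda>_. N)) X" by (rule prob_space_distr[OF assms])
  show ?thesis by unfold_locales simp
qed

lemma splits_union_pieces:
  fixes P :: "'z \<Rightarrow> 'i set" and N :: "'b measure"
  assumes X [measurable]: "X \<in> M \<rightarrow>\<^sub>M PiM T (\<lambda>_. N)"
    and ind: "indep_vars (\<lambda>z. PiM (P z) (\<lambda>_. N)) (\<lambda>z \<omega>. restrict (X \<omega>) (P z)) UNIV"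
    and disj: "disjoint_family P" and cover: "(\<Union>z. P z) = T"
  shows "field_law.splits (distr M (PiM T (\<lambda>_. N)) X) (\<Union>z\<in>J. P z)"
proof -
  define L where "L = distr M (PiM T (\<lambda>_. N)) X"
  interpret L: field_law L T N unfolding L_def by (rule field_law_distr[OF X])
  define S where "S = (\<Union>z\<in>J. P z)"
  define S' where "S' = (\<Union>z\<in>- J. P z)"
  have ST: "S \<subseteq> T" "S' \<subseteq> T" "S \<union> S' = T" "S' = T - S"
  proof -
    show un: "S \<union> S' = T" unfolding S_def S'_def cover[symmetric] by auto
    then show "S \<subseteq> T" "S' \<subseteq> T" by auto
    have "t \<notin> S'" if "t \<in> S" for t
    proof
      assume "t \<in> S'"
      with that obtain z z' where "z \<in> J" "z' \<notin> J" "t \<in> P z" "t \<in> P z'" by (auto simp: S_def S'_def)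
      then show False using disjoint_family_onD[OF disj, of z z'] by auto
    qed
    with un show "S' = T - S" by auto
  qed
  let ?K = "PiM S (\<lambda>_. N)" and ?K' = "PiM S' (\<lambda>_. N)"
  let ?XS = "\<lambda>\<omega>. restrict (X \<omega>) S" and ?XS' = "\<lambda>\<omega>. restrict (X \<omega>) S'"
  have [measurable]: "(\<lambda>\<xi>. restrict \<xi> S) \<in> L \<rightarrow>\<^sub>M ?K" "(\<lambda>\<xi>. restrict \<xi> S') \<in> L \<rightarrow>\<^sub>M ?K'"
    using ST by (simp_all add: measurable_cong_sets[OF L.sets_L refl] measurable_restrict_subset)
  have [measurable]: "?XS \<in> M \<rightarrow>\<^sub>M ?K" "?XS' \<in> M \<rightarrow>\<^sub>M ?K'"
    using measurable_compose[OF X measurable_restrict_subset[OF ST(1)]]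
      measurable_compose[OF X measurable_restrict_subset[OF ST(2)]] by auto
  have [measurable]: "merge S S' \<in> ?K \<Otimes>\<^sub>M ?K' \<rightarrow>\<^sub>M PiM T (\<lambda>_. N)"
    using measurable_merge[of S S' "\<lambda>_. N"] ST(3) by simp
  have "indep_var ?K ?XS ?K' ?XS'"
    unfolding S_def S'_def by (rule indep_var_union_pieces[OF ind disj])
  then have joint: "distr M ?K ?XS \<Otimes>\<^sub>M distr M ?K' ?XS' = distr M (?K \<Otimes>\<^sub>M ?K') (\<lambda>\<omega>. (?XS \<omega>, ?XS' \<omega>))"
    by (simp add: indep_var_distribution_eq)
  have dS: "distr L ?K (\<lambda>\<xi>. restrict \<xi> S) = distr M ?K ?XS" "distr L ?K' (\<lambda>\<xi>. restrict \<xi> S') = distr M ?K' ?XS'"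
    unfolding L_def by (subst distr_distr; simp add: comp_def measurable_restrict_subset ST)+
  have sf: "sigma_finite_measure (distr L ?K' (\<lambda>\<xi>. restrict \<xi> S'))"
    by (intro prob_space_imp_sigma_finite prob_space.prob_space_distr) (auto intro: L.prob_space_axioms)
  have mix_merge: "mix S \<xi> \<eta> = merge S S' (restrict \<xi> S, restrict \<eta> S')" if "\<xi> \<in> space L" "\<eta> \<in> space L" for \<xi> \<eta>
    using that ST by (auto simp: mix_def merge_def fun_eq_iff L.space_L PiE_def extensional_def)
  have "distr L.LL L (\<lambda>(\<xi>, \<eta>). mix S \<xi> \<eta>) = distr L.LL (PiM T (\<lambda>_. N)) (\<lambda>(\<xi>, \<eta>). merge S S' (restrict \<xi> S, restrict \<eta> S'))"
    using L.sets_L by (intro distr_cong) (auto simp: space_pair_measure mix_merge)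
  also have "\<dots> = distr (distr L.LL (?K \<Otimes>\<^sub>M ?K') (\<lambda>(\<xi>, \<eta>). (restrict \<xi> S, restrict \<eta> S'))) (PiM T (\<lambda>_. N)) (merge S S')"
    by (subst distr_distr) (auto simp: comp_def case_prod_beta')
  also have "distr L.LL (?K \<Otimes>\<^sub>M ?K') (\<lambda>(\<xi>, \<eta>). (restrict \<xi> S, restrict \<eta> S'))
      = distr M (?K \<Otimes>\<^sub>M ?K') (\<lambda>\<omega>. (?XS \<omega>, ?XS' \<omega>))"
    using pair_measure_distr[OF _ _ sf, of "\<lambda>\<xi>. restrict \<xi> S" L ?K] joint by (simp add: dS)
  also have "distr \<dots> (PiM T (\<lambda>_. N)) (merge S S') = distr M (PiM T (\<lambda>_. N)) (\<lambda>\<omega>. merge S S' (?XS \<omega>, ?XS' \<omega>))"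
    by (subst distr_distr) (auto simp: comp_def)
  also have "\<dots> = L"
    unfolding L_def
  proof (rule distr_cong[OF refl refl])
    fix \<omega> assume "\<omega> \<in> space M"
    then have "X \<omega> \<in> (\<Pi>\<^sub>E t\<in>T. space N)" using measurable_space[OF X] by (simp add: space_PiM)
    then show "merge S S' (?XS \<omega>, ?XS' \<omega>) = X \<omega>"
      using ST by (auto simp: merge_def fun_eq_iff PiE_def extensional_def)
  qed
  finally show ?thesis unfolding L.splits_def S_def[symmetric] L_def[symmetric] .
qed

end

section \<open>Lattice geometry and fields with action radii\<close>

lemma norm_le_sqrt_card:
  fixes y :: "real ^ 'd"
  assumes "0 \<le> c" "\<And>i. \<bar>y $ i\<bar> \<le> c"
  shows "norm y \<le> sqrt (real CARD('d)) * c"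
proof -
  have "(\<Sum>i\<in>UNIV. (norm (y $ i))\<^sup>2) \<le> (\<Sum>i\<in>(UNIV :: 'd set). c\<^sup>2)"
  proof (rule sum_mono)
    fix i
    show "(norm (y $ i))\<^sup>2 \<le> c\<^sup>2" unfolding real_norm_def using assms(2) by (intro power_mono) auto
  qed
  then have "norm y \<le> sqrt (real CARD('d) * c\<^sup>2)"
    unfolding norm_vec_def L2_set_def by (intro real_sqrt_le_mono) simp
  then show ?thesis using assms(1) by (simp add: real_sqrt_mult)
qed

text \<open>The factor \<open>sqrt (real CARD('d))\<close> compares cubes with balls, and the half accounts for the side of a unit
  cell, so that the cube of side \<open>2 * l + 1\<close> is contained in \<open>scale_ball q l\<close>.\<close>

abbreviation scale_ball :: "real ^ 'd \<Rightarrow> real \<Rightarrow> (real ^ 'd) set" where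
  "scale_ball q s \<equiv> cball q (sqrt (real CARD('d)) * (s + 1 / 2))"

lemma cube_plus_cball_subset:
  fixes q :: "real ^ 'd"
  assumes "0 \<le> l" "0 \<le> r" "r \<le> s"
  shows "cube (2 * l + 1) q + cball 0 r \<subseteq> scale_ball q (l + s)"
proof
  fix v assume "v \<in> cube (2 * l + 1) q + cball 0 r"
  then obtain y b where v: "v = q + (2 * l + 1) *\<^sub>R y + b" and y: "y \<in> unit_cube" and b: "norm b \<le> r"
    by (auto simp: cube_def set_plus_def)
  have "norm y \<le> sqrt (real CARD('d)) * (1 / 2)"
  proof (rule norm_le_sqrt_card)
    show "\<bar>y $ i\<bar> \<le> 1 / 2" for i
    proof -
      have "- (1 / 2) \<le> y $ i \<and> y $ i < 1 / 2" using y unfolding unit_cube_def by blast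
      then show ?thesis by linarith
    qed
  qed simp
  then have "norm ((2 * l + 1) *\<^sub>R y) \<le> (2 * l + 1) * (sqrt (real CARD('d)) * (1 / 2))"
    using assms by (simp add: mult_left_mono)
  moreover have "norm b \<le> sqrt (real CARD('d)) * s"
  proof -
    have "1 * s \<le> sqrt (real CARD('d)) * s" using assms by (intro mult_right_mono) auto
    then show ?thesis using b assms by simp
  qed
  moreover have "dist q v \<le> norm ((2 * l + 1) *\<^sub>R y) + norm b"
  proof -
    have "dist q v = norm ((2 * l + 1) *\<^sub>R y + b)"
      unfolding v by (subst dist_commute) (simp add: dist_norm add.assoc)
    then show ?thesis using norm_triangle_ineq[of "(2 * l + 1) *\<^sub>R y" b] by simp
  qed
  ultimately show "v \<in> scale_ball q (l + s)"
    by (simp add: algebra_simps)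
qed

text \<open>This is how an oscillation around a lattice point is compared with those around all points of its cell,
  over which the right-hand side of the theorem integrates.\<close>

lemma scale_ball_subset_cball:
  fixes q x :: "real ^ 'd"
  assumes "\<And>i. \<bar>x $ i - q $ i\<bar> \<le> 1 / 2" "s \<le> t"
  shows "scale_ball q s \<subseteq> cball x (sqrt (real CARD('d)) * (t + 1))"
proof
  fix v assume "v \<in> scale_ball q s"
  moreover have "norm (x - q) \<le> sqrt (real CARD('d)) * (1 / 2)"
    using assms by (intro norm_le_sqrt_card) auto
  moreover have "dist x v \<le> norm (x - q) + dist q v"
    by (metis dist_norm dist_triangle)
  moreover have "sqrt (real CARD('d)) * (s + 1 / 2) + sqrt (real CARD('d)) * (1 / 2) \<le> sqrt (real CARD('d)) * (t + 1)"
    using assms(2) unfolding distrib_left[symmetric] by (intro mult_left_mono) auto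
  ultimately show "v \<in> cball x (sqrt (real CARD('d)) * (t + 1))"
    unfolding mem_cball by linarith
qed

lemma scale_ball_mono:
  fixes q :: "real ^ 'd"
  shows "s \<le> t \<Longrightarrow> scale_ball q s \<subseteq> scale_ball q t"
  by (intro subset_cball mult_left_mono) auto

text \<open>Open cells instead of half-open ones: they are boxes, of the same measure.\<close>

definition open_cell :: "int ^ 'd \<Rightarrow> (real ^ 'd) set" where
  "open_cell z = {x. \<forall>i. \<bar>x $ i - of_lattice z $ i\<bar> < 1 / 2}"

lemma open_cell_eq_box:
  fixes z :: "int ^ 'd"
  shows "open_cell z = box (of_lattice z - (\<chi> i. 1 / 2)) (of_lattice z + (\<chi> i. 1 / 2))"
proof -
  have "\<bar>x $ i - c\<bar> < 1 / 2 \<longleftrightarrow> c - 1 / 2 < x $ i \<and> x $ i < c + 1 / 2" for x :: "real ^ 'd" and i c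
    by linarith
  then show ?thesis by (simp only: open_cell_def set_eq_iff mem_box_cart mem_Collect_eq
      vector_minus_component vector_add_component vec_lambda_beta simp_thms)
qed

lemma open_cell_measurable [measurable]: "open_cell z \<in> sets borel"
  by (simp add: open_cell_eq_box)

lemma emeasure_open_cell:
  fixes z :: "int ^ 'd"
  shows "emeasure lborel (open_cell z) = 1"
proof -
  have "(of_lattice z - (\<chi> i. 1 / 2)) \<bullet> b \<le> (of_lattice z + (\<chi> i. 1 / 2)) \<bullet> b"
    and "(of_lattice z + (\<chi> i. 1 / 2) - (of_lattice z - (\<chi> i. 1 / 2))) \<bullet> b = 1"
    if Basis: "b \<in> Basis" for b :: "real ^ 'd"
  proof -
    obtain i where "b = axis i 1" using axis_inverse[OF Basis] by blast
    then show "(of_lattice z - (\<chi> i. 1 / 2)) \<bullet> b \<le> (of_lattice z + (\<chi> i. 1 / 2)) \<bullet> b"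
      and "(of_lattice z + (\<chi> i. 1 / 2) - (of_lattice z - (\<chi> i. 1 / 2))) \<bullet> b = 1"
      by (simp_all add: inner_axis)
  qed
  then show ?thesis unfolding open_cell_eq_box by (subst emeasure_lborel_box) simp_all
qed

lemma open_cell_disjoint:
  assumes "x \<in> open_cell z" "x \<in> open_cell z'"
  shows "z = z'"
proof -
  have "z $ i = z' $ i" for i
  proof -
    have "\<bar>real_of_int (z $ i) - real_of_int (z' $ i)\<bar> < 1"
    proof -
      have "\<bar>x $ i - real_of_int (z $ i)\<bar> < 1 / 2" "\<bar>x $ i - real_of_int (z' $ i)\<bar> < 1 / 2"
        using assms by (auto simp: open_cell_def of_lattice_def)
      then show ?thesis by linarith
    qed
    then show ?thesis by linarith
  qed
  then show ?thesis by (simp add: vec_eq_iff)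
qed

locale action_field = prob_space M
  for M :: "'w measure" +
  fixes E :: "'i measure" and N :: "'m measure" and P :: "int ^ 'd \<Rightarrow> 'i set"
    and X X' :: "'w \<Rightarrow> 'i \<Rightarrow> 'm" and A :: "('i \<Rightarrow> 'm) \<Rightarrow> real ^ 'd \<Rightarrow> real"
    and \<rho> :: "int ^ 'd \<Rightarrow> nat \<Rightarrow> 'w \<Rightarrow> real"
  assumes partition: "lattice_partition E P"
    and X_meas [measurable]: "X \<in> M \<rightarrow>\<^sub>M PiM (space E) (\<lambda>_. N)"
    and complete_indep: "completely_independent M N P X"
    and X'_meas [measurable]: "X' \<in> M \<rightarrow>\<^sub>M PiM (space E) (\<lambda>_. N)"
    and iid: "iid_copy M E N X X'"
    and A_joint: "(\<lambda>(\<xi>, y). A \<xi> y) \<in> borel_measurable (PiM (space E) (\<lambda>_. N) \<Otimes>\<^sub>M borel)"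
    and radius: "\<And>x l. action_radius M E N P X X' A x l (\<rho> x l)"
    and radius_annulus: "\<And>x l r. 0 \<le> r \<Longrightarrow> {\<omega>\<in>space M. \<rho> x l \<omega> > r}
      \<in> sets (sigma_restrict M X N (nbhd P x (real l + r) - nbhd P x (real l)))"
begin

definition L :: "('i \<Rightarrow> 'm) measure" where
  "L = distr M (PiM (space E) (\<lambda>_. N)) X"

sublocale config: field_law L "space E" N
  unfolding L_def by (rule field_law_distr[OF X_meas])

lemma X_measL [measurable]: "X \<in> M \<rightarrow>\<^sub>M L" and X'_measL [measurable]: "X' \<in> M \<rightarrow>\<^sub>M L"
  by (simp_all add: L_def)

lemma distr_X: "distr M L X = L"
  unfolding L_def by (rule distr_cong) auto

lemma pair_law: "distr M config.LL (\<lambda>\<omega>. (X \<omega>, X' \<omega>)) = config.LL"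
proof -
  let ?K = "PiM (space E) (\<lambda>_. N)"
  have same: "distr M ?K X' = distr M ?K X" using iid by (simp add: iid_copy_def)
  have "distr M ?K X \<Otimes>\<^sub>M distr M ?K X' = distr M (?K \<Otimes>\<^sub>M ?K) (\<lambda>\<omega>. (X \<omega>, X' \<omega>))"
    using iid unfolding iid_copy_def indep_var_distribution_eq by blast
  then have "config.LL = distr M (?K \<Otimes>\<^sub>M ?K) (\<lambda>\<omega>. (X \<omega>, X' \<omega>))"
    unfolding same L_def .
  also have "\<dots> = distr M config.LL (\<lambda>\<omega>. (X \<omega>, X' \<omega>))"
    by (rule distr_cong) (auto intro!: sets_pair_measure_cong simp: config.sets_L)
  finally show ?thesis by simp
qed

lemma AE_config:
  assumes "Measurable.pred L Q"
  shows "(AE \<xi> in L. Q \<xi>) \<longleftrightarrow> (AE \<omega> in M. Q (X \<omega>))"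
proof -
  have "(AE \<xi> in distr M L X. Q \<xi>) \<longleftrightarrow> (AE \<omega> in M. Q (X \<omega>))"
    using assms by (intro AE_distr_iff) auto
  then show ?thesis by (simp only: distr_X)
qed

lemma AE_configD: "AE \<xi> in L. Q \<xi> \<Longrightarrow> AE \<omega> in M. Q (X \<omega>)"
  by (rule AE_distrD[OF X_measL]) (simp only: distr_X)

text \<open>Only measurable consequences of an almost sure statement about the two fields pass to their joint law. In
  particular the defining property of an action radius, which quantifies over uncountably many points,
  does not pass by itself.\<close>

lemma AE_config_pair:
  assumes "Measurable.pred config.LL Q" "AE \<omega> in M. Q (X \<omega>, X' \<omega>)"
  shows "AE p in config.LL. Q p"
proof -
  have "(AE p in distr M config.LL (\<lambda>\<omega>. (X \<omega>, X' \<omega>)). Q p) \<longleftrightarrow> (AE \<omega> in M. Q (X \<omega>, X' \<omega>))"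
    using assms(1) by (intro AE_distr_iff) auto
  then show ?thesis using assms(2) by (simp only: pair_law)
qed

lemma nn_integral_config:
  "f \<in> borel_measurable L \<Longrightarrow> (\<integral>\<^sup>+\<xi>. f \<xi> \<partial>L) = (\<integral>\<^sup>+\<omega>. f (X \<omega>) \<partial>M)"
  by (subst distr_X[symmetric], subst nn_integral_distr) auto

lemma splits_pieces: "config.splits (\<Union>z\<in>J. P z)"
  using partition complete_indep unfolding L_def
  by (intro splits_union_pieces[OF X_meas]) (auto simp: lattice_partition_def completely_independent_def)

lemma splits_nbhd: "config.splits (nbhd P x r)"
  unfolding nbhd_def by (rule splits_pieces)

lemma nbhd_mono: "r \<le> r' \<Longrightarrow> nbhd P x r \<subseteq> nbhd P x r'"
  unfolding nbhd_def by (rule UN_mono) auto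

lemma nbhd_subset_space: "nbhd P x r \<subseteq> space E"
  using partition by (auto simp: nbhd_def lattice_partition_def)

lemma nbhd_0: "nbhd P x 0 = P x"
proof -
  have "infnorm (of_lattice x - of_lattice y :: real ^ 'd) \<le> 0 \<longleftrightarrow> y = x" for y
  proof -
    have "infnorm (of_lattice x - of_lattice y :: real ^ 'd) \<le> 0 \<longleftrightarrow> of_lattice x = (of_lattice y :: real ^ 'd)"
      using infnorm_pos_le[of "of_lattice x - of_lattice y :: real ^ 'd"] infnorm_eq_0[of "of_lattice x - of_lattice y :: real ^ 'd"]
      by auto
    also have "\<dots> \<longleftrightarrow> y = x" by (auto simp: of_lattice_def vec_eq_iff)
    finally show ?thesis .
  qed
  then show ?thesis by (simp add: nbhd_def)
qed

lemma field_measurable: "(\<lambda>\<xi>. restrict (A \<xi>) S) \<in> L \<rightarrow>\<^sub>M PiM S (\<lambda>_. borel)"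
proof (rule measurable_restrict)
  fix y :: "real ^ 'd"
  have "(\<lambda>\<xi>. (\<xi>, y)) \<in> PiM (space E) (\<lambda>_. N) \<rightarrow>\<^sub>M PiM (space E) (\<lambda>_. N) \<Otimes>\<^sub>M borel" by measurable
  from measurable_compose[OF this A_joint]
  have "(\<lambda>\<xi>. A \<xi> y) \<in> borel_measurable (PiM (space E) (\<lambda>_. N))" by simp
  then show "(\<lambda>\<xi>. A \<xi> y) \<in> borel_measurable L"
    by (simp add: measurable_cong_sets[OF config.sets_L refl])
qed

lemma AX_measurable: "(\<lambda>\<omega>. A (X \<omega>)) \<in> M \<rightarrow>\<^sub>M PiM UNIV (\<lambda>_. borel)"
  using measurable_compose[OF X_measL field_measurable[of UNIV]] by (simp add: restrict_def)

text \<open>The hypothesis on radii concerns strict inequalities; \<open>r \<le> \<rho> x l \<omega>\<close> is the intersection of the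
  conditions \<open>\<rho> x l \<omega> > q k\<close> for \<open>q k\<close> increasing to \<open>r\<close>.\<close>

lemma radius_event:
  assumes "0 < r"
  obtains C where "C \<in> sets L" "\<forall>\<omega>\<in>space M. X \<omega> \<in> C \<longleftrightarrow> r \<le> \<rho> x l \<omega>"
    "config.determined C (nbhd P x (real l + r) - nbhd P x (real l))"
proof -
  let ?S = "nbhd P x (real l + r) - nbhd P x (real l)"
  define q where "q k = r - r / real (Suc k)" for k
  have q: "0 \<le> q k" "q k < r" for k using assms by (auto simp: q_def field_simps)
  have q_lim: "q \<longlonglongrightarrow> r - r * 0"
  proof -
    have "(\<lambda>k. r - r * (1 / real (Suc k))) \<longlonglongrightarrow> r - r * 0"
      by (intro tendsto_intros LIMSEQ_Suc[OF lim_1_over_n])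
    then show ?thesis by (simp add: q_def[abs_def])
  qed
  have "{\<omega>\<in>space M. \<rho> x l \<omega> > q k} \<in> sets (sigma_restrict M X N ?S)" for k
  proof -
    have "subalgebra (sigma_restrict M X N ?S) (sigma_restrict M X N (nbhd P x (real l + q k) - nbhd P x (real l)))"
      using q(2)[of k] nbhd_mono[of "real l + q k" "real l + r" x] nbhd_subset_space
      by (intro subalgebra_sigma_restrict_mono[OF X_meas]) auto
    then show ?thesis using radius_annulus[OF q(1), of k x l] unfolding subalgebra_def by blast
  qed
  then have "(\<Inter>k. {\<omega>\<in>space M. \<rho> x l \<omega> > q k}) \<in> sets (sigma_restrict M X N ?S)" by auto
  also have "(\<Inter>k. {\<omega>\<in>space M. \<rho> x l \<omega> > q k}) = {\<omega>\<in>space M. r \<le> \<rho> x l \<omega>}"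
  proof -
    have "r \<le> \<rho> x l \<omega>" if "\<And>k. q k < \<rho> x l \<omega>" for \<omega>
      using q_lim that by (intro LIMSEQ_le_const2[of q]) (auto intro: less_imp_le)
    then show ?thesis using q(2) by (auto intro: less_le_trans)
  qed
  finally have meas: "{\<omega>\<in>space M. r \<le> \<rho> x l \<omega>} \<in> sets (sigma_restrict M X N ?S)" .
  have XS: "(\<lambda>\<omega>. restrict (X \<omega>) ?S) \<in> space M \<rightarrow> space (PiM ?S (\<lambda>_. N))"
    using measurable_space[OF X_meas] nbhd_subset_space by (fastforce simp: space_PiM PiE_def Pi_def)
  obtain B where B: "B \<in> sets (PiM ?S (\<lambda>_. N))"
    "{\<omega>\<in>space M. r \<le> \<rho> x l \<omega>} = (\<lambda>\<omega>. restrict (X \<omega>) ?S) -` B \<inter> space M"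
    using meas unfolding sigma_restrict_def sets_vimage_algebra2[OF XS] by auto
  define C where "C = (\<lambda>\<xi>. restrict \<xi> ?S) -` B \<inter> space L"
  show ?thesis
  proof (rule that[of C])
    have "(\<lambda>\<xi>. restrict \<xi> ?S) \<in> L \<rightarrow>\<^sub>M PiM ?S (\<lambda>_. N)"
      using nbhd_subset_space by (subst measurable_cong_sets[OF config.sets_L refl]) (auto intro!: measurable_restrict_subset)
    then show "C \<in> sets L" unfolding C_def using B(1) by (rule measurable_sets)
    show "\<forall>\<omega>\<in>space M. X \<omega> \<in> C \<longleftrightarrow> r \<le> \<rho> x l \<omega>"
      using B(2) measurable_space[OF X_measL] by (auto simp: C_def)
    show "config.determined C ?S"
      unfolding config.determined_def
    proof (intro ballI impI)
      fix \<xi> \<eta> assume "\<xi> \<in> space L" "\<eta> \<in> space L" "\<forall>t\<in>?S. \<xi> t = \<eta> t"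
      moreover from this have "restrict \<xi> ?S = restrict \<eta> ?S" by (intro restrict_ext) auto
      ultimately show "\<xi> \<in> C \<longleftrightarrow> \<eta> \<in> C" by (simp add: C_def)
    qed
  qed
qed

end

section \<open>Oscillations as functions of the configuration\<close>

lemma square_le_e2ennreal:
  assumes "ereal \<bar>x\<bar> \<le> u"
  shows "ennreal (x\<^sup>2) \<le> e2ennreal (u\<^sup>2)"
proof (cases u)
  case (real r)
  then have "\<bar>x\<bar> \<le> r" using assms by simp
  then have "x\<^sup>2 \<le> r\<^sup>2" using power_mono[of "\<bar>x\<bar>" r 2] by simp
  then show ?thesis using real by (simp add: e2ennreal_ereal ennreal_leI)
qed (use assms in \<open>auto simp: power2_eq_square\<close>)

lemma e2ennreal_square_mono:
  fixes u v :: ereal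
  assumes "0 \<le> u" "u \<le> v"
  shows "e2ennreal (u\<^sup>2) \<le> e2ennreal (v\<^sup>2)"
  using assms by (intro e2ennreal_mono) (auto simp: power2_eq_square intro: ereal_mult_mono)

lemma pred_ereal_le [measurable (raw)]:
  fixes f g :: "'a \<Rightarrow> ereal"
  shows "f \<in> borel_measurable K \<Longrightarrow> g \<in> borel_measurable K \<Longrightarrow> Measurable.pred K (\<lambda>x. f x \<le> g x)"
  unfolding pred_def by (rule borel_measurable_le)

locale field_observable = action_field M E N P X X' A \<rho>
  for M :: "'w measure" and E :: "'i measure" and N :: "'m measure" and P :: "int ^ 'd \<Rightarrow> 'i set"
    and X X' A \<rho> +
  fixes Z :: "'w \<Rightarrow> real"
  assumes Z_meas: "Z \<in> borel_measurable (sigma_restrict M (\<lambda>\<omega>. A (X \<omega>)) borel UNIV)"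
begin

abbreviation AX where "AX \<equiv> \<lambda>\<omega>. A (X \<omega>)"

definition outside :: "(real ^ 'd) set \<Rightarrow> ('i \<Rightarrow> 'm) \<Rightarrow> real ^ 'd \<Rightarrow> real" where
  "outside S \<xi> = restrict (A \<xi>) (UNIV - S)"

text \<open>Conditional essential suprema live on the probability space, where resampling is not a map. Here they
  are written as functions of the configuration, factored through the field outside \<open>S\<close>.\<close>

definition cond_sup :: "('w \<Rightarrow> ereal) \<Rightarrow> (real ^ 'd) set \<Rightarrow> ('i \<Rightarrow> 'm) \<Rightarrow> ereal" where
  "cond_sup Y S \<xi> = (SOME u. u \<in> borel_measurable (PiM (UNIV - S) (\<lambda>_. borel)) \<and>
      (\<forall>\<omega>\<in>space M. cond_esssup M (sigma_restrict M AX borel (UNIV - S)) Y \<omega> = u (outside S (X \<omega>)))) (outside S \<xi>)"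

lemma cond_sup_local: "outside S \<xi> = outside S \<eta> \<Longrightarrow> cond_sup Y S \<xi> = cond_sup Y S \<eta>"
  by (simp add: cond_sup_def)

lemma subalgebra_outside: "subalgebra M (sigma_restrict M AX borel (UNIV - S))"
  by (rule subalgebra_sigma_restrict[OF AX_measurable]) simp

lemma cond_sup:
  shows cond_sup_measurable [measurable]: "cond_sup Y S \<in> borel_measurable L"
    and cond_sup_eq: "\<And>\<omega>. \<omega> \<in> space M \<Longrightarrow> cond_esssup M (sigma_restrict M AX borel (UNIV - S)) Y \<omega> = cond_sup Y S (X \<omega>)"
    and cond_sup_ge: "AE \<omega> in M. Y \<omega> \<le> cond_sup Y S (X \<omega>)"
proof -
  let ?U = "cond_esssup M (sigma_restrict M AX borel (UNIV - S)) Y"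
  let ?Q = "\<lambda>u. u \<in> borel_measurable (PiM (UNIV - S) (\<lambda>_. borel)) \<and> (\<forall>\<omega>\<in>space M. ?U \<omega> = u (outside S (X \<omega>)))"
  have U: "is_cond_esssup M (sigma_restrict M AX borel (UNIV - S)) Y ?U"
    by (rule cond_esssup[OF subalgebra_outside])
  then have "?U \<in> borel_measurable (vimage_algebra (space M) (\<lambda>\<omega>. outside S (X \<omega>)) (PiM (UNIV - S) (\<lambda>_. borel)))"
    by (simp add: is_cond_esssup_def sigma_restrict_def outside_def)
  then obtain u where "?Q u"
    by (rule vimage_algebra_factor) (auto simp: outside_def space_PiM)
  then have "\<exists>u. ?Q u" by blast
  from someI_ex[OF this] have Q: "?Q (Eps ?Q)" .
  have cs: "cond_sup Y S = (\<lambda>\<xi>. (Eps ?Q) (outside S \<xi>))" by (simp add: cond_sup_def fun_eq_iff)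
  have "outside S \<in> L \<rightarrow>\<^sub>M PiM (UNIV - S) (\<lambda>_. borel)"
    unfolding outside_def[abs_def] by (rule field_measurable)
  then show "cond_sup Y S \<in> borel_measurable L"
    unfolding cs by (rule measurable_compose[OF _ conjunct1[OF Q]])
  show eq: "?U \<omega> = cond_sup Y S (X \<omega>)" if "\<omega> \<in> space M" for \<omega>
    using Q that unfolding cs by blast
  have "AE \<omega> in M. Y \<omega> \<le> ?U \<omega>" using U by (simp add: is_cond_esssup_def)
  with AE_space show "AE \<omega> in M. Y \<omega> \<le> cond_sup Y S (X \<omega>)"
    by eventually_elim (simp add: eq)
qed

definition obs :: "('i \<Rightarrow> 'm) \<Rightarrow> real" where
  "obs = (SOME z. z \<in> borel_measurable L \<and> (\<forall>\<omega>\<in>space M. Z \<omega> = z (X \<omega>)))"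

lemma obs_measurable [measurable]: "obs \<in> borel_measurable L"
  and obs_eq: "\<And>\<omega>. \<omega> \<in> space M \<Longrightarrow> Z \<omega> = obs (X \<omega>)"
proof -
  let ?Q = "\<lambda>z. z \<in> borel_measurable L \<and> (\<forall>\<omega>\<in>space M. Z \<omega> = z (X \<omega>))"
  have "(\<lambda>\<omega>. ereal (Z \<omega>)) \<in> borel_measurable (vimage_algebra (space M) (\<lambda>\<omega>. restrict (A (X \<omega>)) UNIV) (PiM UNIV (\<lambda>_. borel)))"
    using Z_meas unfolding sigma_restrict_def by measurable
  then obtain h where h: "h \<in> borel_measurable (PiM UNIV (\<lambda>_. borel))"
      "\<And>\<omega>. \<omega> \<in> space M \<Longrightarrow> ereal (Z \<omega>) = h (restrict (A (X \<omega>)) UNIV)"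
    by (rule vimage_algebra_factor) (auto simp: space_PiM)
  have "?Q (\<lambda>\<xi>. real_of_ereal (h (restrict (A \<xi>) UNIV)))"
  proof
    have "(\<lambda>\<xi>. h (restrict (A \<xi>) UNIV)) \<in> borel_measurable L"
      by (rule measurable_compose[OF field_measurable h(1)])
    then show "(\<lambda>\<xi>. real_of_ereal (h (restrict (A \<xi>) UNIV))) \<in> borel_measurable L" by measurable
    show "\<forall>\<omega>\<in>space M. Z \<omega> = real_of_ereal (h (restrict (A (X \<omega>)) UNIV))"
      by (simp add: h(2)[symmetric])
  qed
  then have "\<exists>z. ?Q z" by blast
  from someI_ex[OF this] have "?Q (Eps ?Q)" .
  then show "obs \<in> borel_measurable L" "\<And>\<omega>. \<omega> \<in> space M \<Longrightarrow> Z \<omega> = obs (X \<omega>)"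
    unfolding obs_def by blast+
qed

definition config_osc :: "(real ^ 'd) set \<Rightarrow> ('i \<Rightarrow> 'm) \<Rightarrow> ereal" where
  "config_osc S \<xi> = cond_sup (\<lambda>\<omega>. ereal (Z \<omega>)) S \<xi> + cond_sup (\<lambda>\<omega>. ereal (- Z \<omega>)) S \<xi>"

lemma config_osc_measurable [measurable]: "config_osc S \<in> borel_measurable L"
  unfolding config_osc_def[abs_def] by measurable

lemma osc_eq: "\<omega> \<in> space M \<Longrightarrow> osc M AX S Z \<omega> = config_osc S (X \<omega>)"
  by (simp add: osc_def config_osc_def cond_sup_eq)

lemma obs_le_cond_sup:
  "AE \<xi> in L. ereal (obs \<xi>) \<le> cond_sup (\<lambda>\<omega>. ereal (Z \<omega>)) S \<xi> \<and> ereal (- obs \<xi>) \<le> cond_sup (\<lambda>\<omega>. ereal (- Z \<omega>)) S \<xi>"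
proof (subst AE_config)
  show "AE \<omega> in M. ereal (obs (X \<omega>)) \<le> cond_sup (\<lambda>\<omega>. ereal (Z \<omega>)) S (X \<omega>)
      \<and> ereal (- obs (X \<omega>)) \<le> cond_sup (\<lambda>\<omega>. ereal (- Z \<omega>)) S (X \<omega>)"
    using cond_sup_ge[of "\<lambda>\<omega>. ereal (Z \<omega>)" S] cond_sup_ge[of "\<lambda>\<omega>. ereal (- Z \<omega>)" S] AE_space
    by eventually_elim (simp add: obs_eq)
qed measurable

lemma config_osc_nonneg: "AE \<xi> in L. 0 \<le> config_osc S \<xi>"
  using obs_le_cond_sup[of S]
proof eventually_elim
  case (elim \<xi>)
  then have "ereal (obs \<xi>) + ereal (- obs \<xi>) \<le> config_osc S \<xi>" unfolding config_osc_def by (intro add_mono) auto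
  then show ?case by (simp add: zero_ereal_def)
qed

lemma config_osc_mono: "S \<subseteq> S' \<Longrightarrow> AE \<xi> in L. config_osc S \<xi> \<le> config_osc S' \<xi>"
proof (subst AE_config)
  assume "S \<subseteq> S'"
  from osc_mono[OF AX_measurable this, of Z] AE_space
  show "AE \<omega> in M. config_osc S (X \<omega>) \<le> config_osc S' (X \<omega>)"
    by eventually_elim (simp add: osc_eq)
qed measurable

text \<open>If the radius is less than \<open>r\<close>, the perturbation acts inside \<open>S\<close> only.\<close>

lemma outside_perturbed:
  assumes C: "C \<in> sets L" "\<forall>\<omega>\<in>space M. X \<omega> \<in> C \<longleftrightarrow> r \<le> \<rho> x l \<omega>"
    and S: "cube (2 * real l + 1) (of_lattice x) + cball 0 r \<subseteq> S"
  shows "AE \<omega> in M. X \<omega> \<notin> C \<longrightarrow> outside S (mix (nbhd P x (real l)) (X' \<omega>) (X \<omega>)) = outside S (X \<omega>)"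
proof -
  have "AE \<omega> in M. \<forall>y\<in>UNIV - (cube (2 * real l + 1) (of_lattice x) + cball 0 (\<rho> x l \<omega>)).
      A (perturb X X' (nbhd P x (real l)) \<omega>) y = A (X \<omega>) y"
    using radius[of x l] by (simp add: action_radius_def)
  with AE_space show ?thesis
  proof eventually_elim
    case (elim \<omega>)
    show ?case
    proof
      assume "X \<omega> \<notin> C"
      then have "\<rho> x l \<omega> < r" using C(2) elim by auto
      then have "cball (0 :: real ^ 'd) (\<rho> x l \<omega>) \<subseteq> cball 0 r" by (intro subset_cball) simp
      then have "cube (2 * real l + 1) (of_lattice x) + cball 0 (\<rho> x l \<omega>) \<subseteq> S"
        by (rule order_trans[OF set_plus_mono2[OF order_refl] S])
      moreover have "mix (nbhd P x (real l)) (X' \<omega>) (X \<omega>) = perturb X X' (nbhd P x (real l)) \<omega>"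
        by (simp add: mix_def perturb_def)
      ultimately show "outside S (mix (nbhd P x (real l)) (X' \<omega>) (X \<omega>)) = outside S (X \<omega>)"
        unfolding outside_def using elim(2) by (intro restrict_ext) auto
    qed
  qed
qed

lemma cond_sup_perturbed:
  assumes C [measurable]: "C \<in> sets L" and C': "\<forall>\<omega>\<in>space M. X \<omega> \<in> C \<longleftrightarrow> r \<le> \<rho> x l \<omega>"
    and S: "cube (2 * real l + 1) (of_lattice x) + cball 0 r \<subseteq> S"
  shows "AE p in config.LL. fst p \<notin> C \<longrightarrow> cond_sup Y S (mix (nbhd P x (real l)) (snd p) (fst p)) = cond_sup Y S (fst p)"
proof (rule AE_config_pair)
  show "AE \<omega> in M. fst (X \<omega>, X' \<omega>) \<notin> C \<longrightarrow>
      cond_sup Y S (mix (nbhd P x (real l)) (snd (X \<omega>, X' \<omega>)) (fst (X \<omega>, X' \<omega>))) = cond_sup Y S (fst (X \<omega>, X' \<omega>))"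
    using outside_perturbed[OF C C' S] by eventually_elim (auto intro: cond_sup_local)
qed measurable

lemma config_osc_perturbed:
  assumes C: "C \<in> sets L" "\<forall>\<omega>\<in>space M. X \<omega> \<in> C \<longleftrightarrow> r \<le> \<rho> x l \<omega>"
    and S: "cube (2 * real l + 1) (of_lattice x) + cball 0 r \<subseteq> S"
  shows "AE p in config.LL. fst p \<notin> C \<longrightarrow> config_osc S (mix (nbhd P x (real l)) (snd p) (fst p)) = config_osc S (fst p)"
  using cond_sup_perturbed[OF C S, of "\<lambda>\<omega>. ereal (Z \<omega>)"] cond_sup_perturbed[OF C S, of "\<lambda>\<omega>. ereal (- Z \<omega>)"]
  by eventually_elim (simp add: config_osc_def)

text \<open>Both values of the observable are bounded by the two conditional essential suprema, and by
  \<open>cond_sup_perturbed\<close> these are the same before and after the resampling. So the difference of the two values is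
  at most the sum of the suprema, which is the oscillation.\<close>

lemma obs_perturbed:
  assumes C: "C \<in> sets L" "\<forall>\<omega>\<in>space M. X \<omega> \<in> C \<longleftrightarrow> r \<le> \<rho> x l \<omega>"
    and S: "cube (2 * real l + 1) (of_lattice x) + cball 0 r \<subseteq> S"
  shows "AE p in config.LL. fst p \<notin> C \<longrightarrow> ereal \<bar>obs (fst p) - obs (mix (nbhd P x (real l)) (snd p) (fst p))\<bar> \<le> config_osc S (fst p)"
proof -
  let ?m = "\<lambda>p. mix (nbhd P x (real l)) (snd p) (fst p)"
  let ?u = "cond_sup (\<lambda>\<omega>. ereal (Z \<omega>)) S" and ?v = "cond_sup (\<lambda>\<omega>. ereal (- Z \<omega>)) S"
  have fst: "AE p in config.LL. ereal (obs (fst p)) \<le> ?u (fst p) \<and> ereal (- obs (fst p)) \<le> ?v (fst p)"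
    by (rule config.AE_LL_fst[OF obs_le_cond_sup])
  have dm: "distr config.LL L ?m = L"
  proof -
    have "distr config.LL L ?m = distr (distr config.LL config.LL (\<lambda>p. (snd p, fst p))) L (\<lambda>p. mix (nbhd P x (real l)) (fst p) (snd p))"
      by (subst distr_distr) (auto simp: comp_def)
    then show ?thesis by (simp only: config.distr_flip config.distr_mix[OF splits_nbhd])
  qed
  have mix: "AE p in config.LL. ereal (obs (?m p)) \<le> ?u (?m p) \<and> ereal (- obs (?m p)) \<le> ?v (?m p)"
    by (rule AE_distrD[of ?m config.LL L]) (measurable, unfold dm, rule obs_le_cond_sup)
  show ?thesis
    using fst mix cond_sup_perturbed[OF C S, of "\<lambda>\<omega>. ereal (Z \<omega>)"] cond_sup_perturbed[OF C S, of "\<lambda>\<omega>. ereal (- Z \<omega>)"]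
  proof eventually_elim
    case (elim p)
    show ?case
    proof
      assume "fst p \<notin> C"
      then have m: "ereal (obs (?m p)) \<le> ?u (fst p)" "ereal (- obs (?m p)) \<le> ?v (fst p)" using elim by auto
      have "ereal (obs (fst p)) + ereal (- obs (?m p)) \<le> config_osc S (fst p)"
        unfolding config_osc_def using m elim by (intro add_mono) auto
      moreover have "ereal (obs (?m p)) + ereal (- obs (fst p)) \<le> config_osc S (fst p)"
        unfolding config_osc_def using m elim by (intro add_mono) auto
      ultimately show "ereal \<bar>obs (fst p) - obs (?m p)\<bar> \<le> config_osc S (fst p)"
        by (cases "obs (fst p) \<le> obs (?m p)") (auto simp: abs_if)
    qed
  qed
qed

end

section \<open>The weight of a single cell\<close>

lemma dyadic_window:
  fixes a r :: real
  assumes "0 < a" "a \<le> r"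
  shows "\<exists>j. 2 ^ j * a \<le> r \<and> r < 2 ^ Suc j * a"
proof -
  obtain n where n: "r / a < 2 ^ n" using real_arch_pow[of 2 "r / a"] by auto
  define k where "k = (LEAST k. r / a < 2 ^ k)"
  have k: "r / a < 2 ^ k" unfolding k_def using n by (rule LeastI)
  have "k \<noteq> 0" using k assms by (auto simp: field_simps intro: ccontr)
  then obtain j where j: "k = Suc j" by (cases k) auto
  have "\<not> r / a < 2 ^ j" using not_less_Least[of j "\<lambda>k. r / a < 2 ^ k"] j by (simp add: k_def)
  then have "2 ^ j * a \<le> r" using assms by (simp add: field_simps)
  moreover have "r < 2 ^ Suc j * a" using k j assms by (simp add: field_simps)
  ultimately show ?thesis by blast
qed

context field_observable
begin

text \<open>The cap \<open>b\<close> makes all integrals finite. It costs nothing, because the truncated observable has squared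
  increments bounded by \<open>b\<close>.\<close>

definition capped_osc :: "real \<Rightarrow> int ^ 'd \<Rightarrow> nat \<Rightarrow> ('i \<Rightarrow> 'm) \<Rightarrow> ennreal" where
  "capped_osc b z s \<xi> = min (ennreal b) (e2ennreal ((config_osc (scale_ball (of_lattice z) (real s)) \<xi>)\<^sup>2))"

lemma capped_osc_measurable [measurable]: "capped_osc b z s \<in> borel_measurable L"
  unfolding capped_osc_def[abs_def] power2_eq_square by measurable

lemma capped_osc_mono: "s \<le> s' \<Longrightarrow> AE \<xi> in L. capped_osc b z s \<xi> \<le> capped_osc b z s' \<xi>"
proof -
  assume "s \<le> s'"
  then have "scale_ball (of_lattice z :: real ^ 'd) (real s) \<subseteq> scale_ball (of_lattice z) (real s')"
    by (intro scale_ball_mono) simp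
  from config_osc_mono[OF this] config_osc_nonneg[of "scale_ball (of_lattice z) (real s)"]
  show ?thesis
    unfolding capped_osc_def by eventually_elim (intro min.mono order_refl e2ennreal_square_mono)
qed

lemma emeasure_window:
  assumes [measurable]: "C \<in> sets L" "C' \<in> sets L"
    and "\<forall>\<omega>\<in>space M. X \<omega> \<in> C \<longleftrightarrow> r \<le> \<rho> z l \<omega>" "\<forall>\<omega>\<in>space M. X \<omega> \<in> C' \<longleftrightarrow> r' \<le> \<rho> z l \<omega>"
  shows "{\<omega>\<in>space M. r \<le> \<rho> z l \<omega> \<and> \<rho> z l \<omega> < r'} \<in> sets M"
    "emeasure L (C - C') = emeasure M {\<omega>\<in>space M. r \<le> \<rho> z l \<omega> \<and> \<rho> z l \<omega> < r'}"
proof -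
  have eq: "X -` (C - C') \<inter> space M = {\<omega>\<in>space M. r \<le> \<rho> z l \<omega> \<and> \<rho> z l \<omega> < r'}"
    using assms(3,4) by auto
  have "X -` (C - C') \<inter> space M \<in> sets M" by measurable
  then show "{\<omega>\<in>space M. r \<le> \<rho> z l \<omega> \<and> \<rho> z l \<omega> < r'} \<in> sets M" by (simp only: eq)
  have "emeasure (distr M L X) (C - C') = emeasure M (X -` (C - C') \<inter> space M)"
    by (rule emeasure_distr) auto
  then show "emeasure L (C - C') = emeasure M {\<omega>\<in>space M. r \<le> \<rho> z l \<omega> \<and> \<rho> z l \<omega> < r'}"
    by (simp only: distr_X eq)
qed

text \<open>The weight is the capped squared oscillation at the scale of the window that contains the action radius
  of the cell. Here \<open>Cv l r\<close> is a set of configurations representing the event \<open>r \<le> \<rho> z l\<close>, and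
  \<open>G l a j\<close> represents the window from \<open>2 ^ j * a\<close> to \<open>2 ^ Suc j * a\<close> for \<open>\<rho> z l\<close>. All windows start at the
  scale \<open>n0\<close> or above, the least integer scale at which the tail of the radii is controlled.\<close>

lemma resampling_weight_exists:
  fixes z :: "int ^ 'd" and b R :: real and p :: "real \<Rightarrow> real" and H :: "real \<Rightarrow> ennreal"
  assumes R: "1 \<le> R"
    and tail: "\<And>l. R \<le> real l \<Longrightarrow> measure M {\<omega>\<in>space M. \<rho> z l \<omega> \<ge> real l} \<le> 1 / 4"
    and p_nonneg: "\<And>l. 0 \<le> l \<Longrightarrow> 0 \<le> p l" and p_anti: "antimono_on {0..} p"
    and window: "\<And>l\<^sub>0 l. real l\<^sub>0 \<le> 1 / 4 * l \<Longrightarrow>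
      measure M {\<omega>\<in>space M. 1 / 4 * l \<le> \<rho> z l\<^sub>0 \<omega> \<and> \<rho> z l\<^sub>0 \<omega> < l} \<le> p l"
    and b: "0 \<le> b" and H_meas [measurable]: "H \<in> borel_measurable borel"
    and H: "\<And>s. AE t in lborel. real s \<le> t \<longrightarrow> (\<integral>\<^sup>+\<xi>. capped_osc b z s \<xi> \<partial>L) \<le> H t"
  shows "\<exists>w. w \<in> borel_measurable L \<and> (\<forall>\<xi>. 0 \<le> w \<xi> \<and> w \<xi> \<le> b) \<and>
    (AE q in config.LL. min b ((obs (fst q) - obs (mix (P z) (snd q) (fst q)))\<^sup>2) \<le> w (fst q)) \<and>
    ennreal (\<integral>\<xi>. w \<xi> \<partial>L) \<le> (\<integral>\<^sup>+t. H t * scale_density CARD('d) R p t \<partial>lborel)"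
proof -
  define n0 where "n0 = nat \<lceil>R\<rceil>"
  have n0: "1 \<le> n0" "R \<le> real n0" "real n0 \<le> 2 * R" using R unfolding n0_def by linarith+
  define is_event where "is_event l r C \<longleftrightarrow> C \<in> sets L \<and> (\<forall>\<omega>\<in>space M. X \<omega> \<in> C \<longleftrightarrow> r \<le> \<rho> z l \<omega>)
      \<and> config.determined C (nbhd P z (real l + r) - nbhd P z (real l))" for l r C
  define Cv where "Cv l r = (SOME C. is_event l r C)" for l r
  have "is_event l r (Cv l r)" if r: "0 < r" for l r
  proof -
    obtain C where "C \<in> sets L" "\<forall>\<omega>\<in>space M. X \<omega> \<in> C \<longleftrightarrow> r \<le> \<rho> z l \<omega>"
      "config.determined C (nbhd P z (real l + r) - nbhd P z (real l))"
      by (rule radius_event[OF r, of z l])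
    then have "is_event l r C" by (simp add: is_event_def)
    then show ?thesis unfolding Cv_def by (rule someI)
  qed
  then have Cv: "\<And>l r. 0 < r \<Longrightarrow> Cv l r \<in> sets L"
      "\<And>l r. 0 < r \<Longrightarrow> (\<forall>\<omega>\<in>space M. X \<omega> \<in> Cv l r \<longleftrightarrow> r \<le> \<rho> z l \<omega>)"
      "\<And>l r. 0 < r \<Longrightarrow> config.determined (Cv l r) (nbhd P z (real l + r) - nbhd P z (real l))"
    unfolding is_event_def by blast+
  define G where "G l a j = Cv l (2 ^ j * real a) - Cv l (2 ^ Suc j * real a)" for l a :: nat and j :: nat
  have pos: "0 < 2 ^ j * real a" if "n0 \<le> a" for j a using that n0 by simp
  have G_meas: "G l a j \<in> sets L" if "n0 \<le> a" for l a j
    unfolding G_def by (intro sets.Diff Cv(1)[OF pos[OF that]])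
  define Win where "Win l a j = {\<omega>\<in>space M. 2 ^ j * real a \<le> \<rho> z l \<omega> \<and> \<rho> z l \<omega> < 2 ^ Suc j * real a}" for l a :: nat and j :: nat
  have Win_meas: "Win l a j \<in> sets M" and G_Win: "emeasure L (G l a j) = emeasure M (Win l a j)" if "n0 \<le> a" for l a j
    unfolding G_def Win_def
    using emeasure_window[OF Cv(1)[OF pos[OF that]] Cv(1)[OF pos[OF that]] Cv(2)[OF pos[OF that]] Cv(2)[OF pos[OF that]]]
    by blast+
  have Win_disj: "disjoint_family (Win l a)" if "n0 \<le> a" for l a
  proof -
    have *: "Win l a i \<inter> Win l a j = {}" if "i < j" for i j
    proof -
      have "(2::real) ^ Suc i \<le> 2 ^ j" using that by (intro power_increasing) auto
      then have "2 ^ Suc i * real a \<le> 2 ^ j * real a" by (intro mult_right_mono) auto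
      then show ?thesis unfolding Win_def by fastforce
    qed
    show ?thesis
      unfolding disjoint_family_on_def
    proof (intro ballI impI)
      fix i j :: nat assume "i \<noteq> j"
      then show "Win l a i \<inter> Win l a j = {}" using *[of i j] *[of j i] by (cases i j rule: linorder_cases) auto
    qed
  qed
  have G_sum_eq: "(\<Sum>j. emeasure L (G l a j)) = emeasure M (\<Union>j. Win l a j)" if "n0 \<le> a" for l a
    using Win_meas[OF that] Win_disj[OF that] by (subst suminf_emeasure[symmetric]) (auto simp: G_Win[OF that])
  \<comment> \<open>The upper end of the window is enlarged from \<open>2 * 2 ^ j * a\<close> to \<open>4 * 2 ^ j * a\<close>, to match the windows of
  ratio \<open>4\<close> in the hypothesis.\<close>
  have G_p: "emeasure L (G l a j) \<le> ennreal (p (4 * (2 ^ j * real a)))" if "n0 \<le> a" "l \<le> a" for l a j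
  proof -
    have [measurable]: "\<rho> z l \<in> borel_measurable M"
    proof -
      have "(\<lambda>\<omega>. (X \<omega>, X' \<omega>)) \<in> M \<rightarrow>\<^sub>M PiM (space E) (\<lambda>_. N) \<Otimes>\<^sub>M PiM (space E) (\<lambda>_. N)" by measurable
      then have "sets (vimage_algebra (space M) (\<lambda>\<omega>. (X \<omega>, X' \<omega>)) (PiM (space E) (\<lambda>_. N) \<Otimes>\<^sub>M PiM (space E) (\<lambda>_. N))) \<subseteq> sets M"
        by (rule sets_image_in_sets[OF refl])
      then have "subalgebra M (vimage_algebra (space M) (\<lambda>\<omega>. (X \<omega>, X' \<omega>)) (PiM (space E) (\<lambda>_. N) \<Otimes>\<^sub>M PiM (space E) (\<lambda>_. N)))"
        by (simp add: subalgebra_def)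
      then show ?thesis using radius[of z l] unfolding action_radius_def by (auto intro: measurable_from_subalg)
    qed
    have "1 * real a \<le> 2 ^ j * real a" by (intro mult_right_mono) auto
    then have le: "real l \<le> 1 / 4 * (4 * (2 ^ j * real a))" using that by simp
    have "Win l a j \<subseteq> {\<omega>\<in>space M. 1 / 4 * (4 * (2 ^ j * real a)) \<le> \<rho> z l \<omega> \<and> \<rho> z l \<omega> < 4 * (2 ^ j * real a)}"
      using pos[OF that(1), of j] unfolding Win_def by auto
    then have "emeasure M (Win l a j) \<le> emeasure M \<dots>" by (intro emeasure_mono) measurable
    also have "\<dots> \<le> ennreal (p (4 * (2 ^ j * real a)))"
      using window[OF le] by (simp add: emeasure_eq_measure ennreal_leI)
    finally show ?thesis by (simp add: G_Win[OF that(1)])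
  qed
  have G_cover: "AE \<xi> in L. \<xi> \<in> Cv l (real a) \<longrightarrow> (\<exists>j. \<xi> \<in> G l a j)" if a: "n0 \<le> a" for l a
  proof (subst AE_config)
    have a0: "0 < real a" using a n0 by simp
    note [measurable] = Cv(1)[OF a0, of l] G_meas[OF a, of l]
    show "Measurable.pred L (\<lambda>\<xi>. \<xi> \<in> Cv l (real a) \<longrightarrow> (\<exists>j. \<xi> \<in> G l a j))" by measurable
    show "AE \<omega> in M. X \<omega> \<in> Cv l (real a) \<longrightarrow> (\<exists>j. X \<omega> \<in> G l a j)"
    proof (rule AE_I2, rule impI)
      fix \<omega> assume \<omega>: "\<omega> \<in> space M" "X \<omega> \<in> Cv l (real a)"
      then have "real a \<le> \<rho> z l \<omega>" using Cv(2)[OF a0, of l] by blast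
      from dyadic_window[OF a0 this] obtain j where "2 ^ j * real a \<le> \<rho> z l \<omega>" "\<rho> z l \<omega> < 2 ^ Suc j * real a" by blast
      then have "X \<omega> \<in> G l a j"
        unfolding G_def using Cv(2)[OF pos[OF a], of l] \<omega>(1) by (metis Diff_iff not_le)
      then show "\<exists>j. X \<omega> \<in> G l a j" by blast
    qed
  qed
  have G_det: "config.determined (G l a j) (nbhd P z (real l + 2 ^ Suc j * real a) - nbhd P z (real l))" if a: "n0 \<le> a" for l a j
  proof -
    have "2 ^ j * real a \<le> 2 ^ Suc j * real a" by (intro mult_right_mono) auto
    then have "nbhd P z (real l + 2 ^ j * real a) \<subseteq> nbhd P z (real l + 2 ^ Suc j * real a)" by (intro nbhd_mono) simp
    then have "config.determined (Cv l (2 ^ j * real a)) (nbhd P z (real l + 2 ^ Suc j * real a) - nbhd P z (real l))"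
      by (intro config.determined_mono[OF Cv(3)[OF pos[OF a]]]) blast
    then show ?thesis unfolding G_def by (intro config.determined_Diff Cv(3)[OF pos[OF a]])
  qed
  define I where "I = (\<integral>\<^sup>+t. H t * ennreal (8 / t * p (t / 2)) * indicator {4 * R<..} t \<partial>lborel)"
  have sum_le: "ennreal (8 - real k) * (\<Sum>j. emeasure L (G l a j) * (\<integral>\<^sup>+\<xi>. capped_osc b z (k * 2 ^ j * a) \<xi> \<partial>L)) \<le> I"
    if "n0 \<le> a" "l \<le> a" "4 \<le> k" "k \<le> 8" for k l a :: nat
  proof -
    have "(\<Sum>j. emeasure L (G l a j) * (\<integral>\<^sup>+\<xi>. capped_osc b z (k * 2 ^ j * a) \<xi> \<partial>L))
        \<le> (\<Sum>j. ennreal (p (4 * (2 ^ j * real a))) * (\<integral>\<^sup>+\<xi>. capped_osc b z (k * 2 ^ j * a) \<xi> \<partial>L))"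
      by (intro suminf_le allI mult_right_mono G_p that) auto
    then have "ennreal (8 - real k) * (\<Sum>j. emeasure L (G l a j) * (\<integral>\<^sup>+\<xi>. capped_osc b z (k * 2 ^ j * a) \<xi> \<partial>L))
        \<le> ennreal (8 - real k) * (\<Sum>j. ennreal (p (4 * (2 ^ j * real a))) * (\<integral>\<^sup>+\<xi>. capped_osc b z (k * 2 ^ j * a) \<xi> \<partial>L))"
      by (rule mult_left_mono) simp
    also have "\<dots> \<le> I"
      unfolding I_def using that n0 R by (intro scale_windows_sum_le p_nonneg p_anti H) auto
    finally show ?thesis .
  qed
  have divide: "x \<le> ennreal (1 / c) * I" if "0 < c" "ennreal c * x \<le> I" for c x
  proof -
    have "ennreal (1 / c) * (ennreal c * x) \<le> ennreal (1 / c) * I" using that(2) by (rule mult_left_mono) simp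
    moreover have "ennreal (1 / c) * (ennreal c * x) = x"
      using that(1) by (simp add: mult.assoc[symmetric] ennreal_mult[symmetric])
    ultimately show ?thesis by simp
  qed
  interpret chain: scale_chain L "space E" N "\<lambda>l. nbhd P z (real l)" "\<lambda>l. Cv l (real l)" "\<lambda>l. G l l" "capped_osc b z" b I n0
  proof unfold_locales
    fix l assume l: "n0 \<le> l"
    have l0: "0 < real l" using l n0 by simp
    show "Cv l (real l) \<in> sets L" by (rule Cv(1)[OF l0])
    show "G l l j \<in> sets L" for j by (rule G_meas[OF l])
    show "config.determined (G l l j) (nbhd P z (real (l + 2 ^ Suc j * l)) - nbhd P z (real l))" for j
      using G_det[OF l, of l j] by simp
    show "AE \<xi> in L. \<xi> \<in> Cv l (real l) \<longrightarrow> (\<exists>j. \<xi> \<in> G l l j)" by (rule G_cover[OF l])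
    show "AE q in config.LL. fst q \<notin> Cv l (real l) \<longrightarrow> capped_osc b z (2 * l) (fst q) \<le> capped_osc b z (2 * l) (mix (nbhd P z (real l)) (snd q) (fst q))"
    proof -
      have S: "cube (2 * real l + 1) (of_lattice z) + cball 0 (real l) \<subseteq> scale_ball (of_lattice z :: real ^ 'd) (real (2 * l))"
        using cube_plus_cball_subset[of "real l" "real l" "real l" "of_lattice z :: real ^ 'd"] by simp
      from config_osc_perturbed[OF Cv(1)[OF l0] Cv(2)[OF l0] S] show ?thesis
        by eventually_elim (simp add: capped_osc_def)
    qed
    show "(\<Sum>j. emeasure L (G l l j)) \<le> ennreal (1 / 4)"
    proof -
      have "{\<omega> \<in> space M. real l \<le> \<rho> z l \<omega>} = X -` Cv l (real l) \<inter> space M" using Cv(2)[OF l0, of l] by auto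
      then have ev: "{\<omega> \<in> space M. real l \<le> \<rho> z l \<omega>} \<in> sets M" using measurable_sets[OF X_measL Cv(1)[OF l0]] by simp
      have "real l \<le> 2 ^ j * real l" for j
      proof -
        have "1 * real l \<le> 2 ^ j * real l" by (intro mult_right_mono) auto
        then show ?thesis by simp
      qed
      then have "(\<Union>j. Win l l j) \<subseteq> {\<omega> \<in> space M. real l \<le> \<rho> z l \<omega>}" unfolding Win_def by (auto intro: order_trans)
      then have "emeasure M (\<Union>j. Win l l j) \<le> emeasure M {\<omega> \<in> space M. real l \<le> \<rho> z l \<omega>}"
        using ev by (rule emeasure_mono)
      also have "\<dots> \<le> ennreal (1 / 4)" using tail[of l] l n0 by (simp add: emeasure_eq_measure ennreal_leI)
      finally show ?thesis by (simp add: G_sum_eq[OF l])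
    qed
    show "(\<Sum>j. emeasure L (G l l j) * (\<integral>\<^sup>+\<xi>. capped_osc b z (6 * 2 ^ j * l) \<xi> \<partial>L)) \<le> ennreal (1 / 2) * I"
      using divide[of 2] sum_le[OF l, of l 6] by simp
  next
    show "config.splits (nbhd P z (real l))" for l by (rule splits_nbhd)
    show "nbhd P z (real l) \<subseteq> nbhd P z (real l')" if "l \<le> l'" for l l' using that by (intro nbhd_mono) simp
    show "1 \<le> n0" by (rule n0)
    show "capped_osc b z s \<in> borel_measurable L" for s by measurable
    show "AE \<xi> in L. capped_osc b z s \<xi> \<le> capped_osc b z s' \<xi>" if "s \<le> s'" for s s' by (rule capped_osc_mono[OF that])
    show "capped_osc b z s \<xi> \<le> ennreal b" for s \<xi> by (simp add: capped_osc_def)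
  qed
  have n00: "0 < real n0" using n0 by simp
  define C0 where "C0 = Cv 0 (real n0)"
  define V where "V \<xi> = capped_osc b z n0 \<xi> * indicator (space L - C0) \<xi> + (\<Sum>j. capped_osc b z (2 * 2 ^ j * n0) \<xi> * indicator (G 0 n0 j) \<xi>)" for \<xi>
  have [measurable]: "C0 \<in> sets L" "\<And>j. G 0 n0 j \<in> sets L"
    using Cv(1)[OF n00] G_meas[of n0] by (auto simp: C0_def)
  have V_meas [measurable]: "V \<in> borel_measurable L" unfolding V_def by measurable
  have "(\<integral>\<^sup>+\<xi>. V \<xi> \<partial>L) \<le> (\<integral>\<^sup>+\<xi>. capped_osc b z n0 \<xi> \<partial>L) + I"
    unfolding V_def
  proof (rule chain.chain_start)
    show "config.determined (G 0 n0 j) (nbhd P z (real (2 * 2 ^ j * n0)))" for j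
      using G_det[of n0 0 j] by (auto elim!: config.determined_mono)
    show "(\<Sum>j. emeasure L (G 0 n0 j)) \<le> 1"
      unfolding G_sum_eq[OF order_refl] by (rule emeasure_le_1)
    show "(\<Sum>j. emeasure L (G 0 n0 j) * (\<integral>\<^sup>+\<xi>. capped_osc b z (4 * 2 ^ j * n0) \<xi> \<partial>L)) \<le> ennreal (1 / 4) * I"
      using divide[of 4] sum_le[of n0 0 4] by simp
  qed measurable
  also have "\<dots> \<le> (\<integral>\<^sup>+t. H t * scale_density CARD('d) R p t \<partial>lborel)"
    unfolding I_def by (rule base_plus_windows_le[OF R n0(3) p_anti H_meas H])
  finally have V_le: "(\<integral>\<^sup>+\<xi>. V \<xi> \<partial>L) \<le> (\<integral>\<^sup>+t. H t * scale_density CARD('d) R p t \<partial>lborel)" .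
  define w where "w \<xi> = enn2real (min (ennreal b) (V \<xi>))" for \<xi>
  have w_meas [measurable]: "w \<in> borel_measurable L" unfolding w_def by measurable
  have w_ennreal: "ennreal (w \<xi>) = min (ennreal b) (V \<xi>)" for \<xi>
    unfolding w_def by (intro ennreal_enn2real) (simp add: min_less_iff_disj)
  have w_bounds: "0 \<le> w \<xi>" "w \<xi> \<le> b" for \<xi>
  proof -
    show "0 \<le> w \<xi>" by (simp add: w_def)
    have "ennreal (w \<xi>) \<le> ennreal b" by (simp add: w_ennreal)
    then show "w \<xi> \<le> b" using b by simp
  qed
  have w_int: "ennreal (\<integral>\<xi>. w \<xi> \<partial>L) \<le> (\<integral>\<^sup>+t. H t * scale_density CARD('d) R p t \<partial>lborel)"
  proof -
    have "integrable L w" using w_bounds by (intro config.integrable_bounded[where c = b]) auto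
    then have "ennreal (\<integral>\<xi>. w \<xi> \<partial>L) = (\<integral>\<^sup>+\<xi>. ennreal (w \<xi>) \<partial>L)"
      using w_bounds by (intro nn_integral_eq_integral[symmetric]) auto
    also have "\<dots> \<le> (\<integral>\<^sup>+\<xi>. V \<xi> \<partial>L)" by (intro nn_integral_mono) (simp add: w_ennreal)
    finally show ?thesis using V_le by simp
  qed
  let ?\<Delta> = "\<lambda>q. obs (fst q) - obs (mix (P z) (snd q) (fst q))"
  have ball: "cube (2 * real 0 + 1) (of_lattice z) + cball 0 (real r) \<subseteq> scale_ball (of_lattice z :: real ^ 'd) (real r)" for r :: nat
    using cube_plus_cball_subset[of 0 "real r" "real r" "of_lattice z :: real ^ 'd"] by simp
  have nb0: "nbhd P z (real 0) = P z" by (simp add: nbhd_0)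
  have osc_r: "AE q in config.LL. fst q \<notin> Cv 0 (real r) \<longrightarrow> ennreal (min b ((?\<Delta> q)\<^sup>2)) \<le> capped_osc b z r (fst q)" if "0 < r" for r
  proof -
    have r: "0 < real r" using that by simp
    from obs_perturbed[OF Cv(1)[OF r] Cv(2)[OF r] ball[of r]] show ?thesis
      unfolding nb0
    proof eventually_elim
      case (elim q)
      show ?case
      proof
        assume "fst q \<notin> Cv 0 (real r)"
        then have "ennreal ((?\<Delta> q)\<^sup>2) \<le> e2ennreal ((config_osc (scale_ball (of_lattice z) (real r)) (fst q))\<^sup>2)"
          using elim by (intro square_le_e2ennreal) auto
        then show "ennreal (min b ((?\<Delta> q)\<^sup>2)) \<le> capped_osc b z r (fst q)"
          unfolding capped_osc_def
          by (intro min.boundedI order_trans[OF ennreal_leI[OF min.cobounded2]] ennreal_leI[OF min.cobounded1])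
      qed
    qed
  qed
  have base: "AE q in config.LL. fst q \<notin> C0 \<longrightarrow> ennreal (min b ((?\<Delta> q)\<^sup>2)) \<le> capped_osc b z n0 (fst q)"
    unfolding C0_def using n0 by (intro osc_r) simp
  have windows: "AE q in config.LL. \<forall>j. fst q \<notin> Cv 0 (real (2 * 2 ^ j * n0)) \<longrightarrow> ennreal (min b ((?\<Delta> q)\<^sup>2)) \<le> capped_osc b z (2 * 2 ^ j * n0) (fst q)"
    unfolding AE_all_countable using n0 by (intro allI osc_r) simp
  have cover: "AE q in config.LL. fst q \<in> C0 \<longrightarrow> (\<exists>j. fst q \<in> G 0 n0 j)"
    unfolding C0_def by (rule config.AE_LL_fst[OF G_cover[OF order_refl]])
  have "AE q in config.LL. min b ((?\<Delta> q)\<^sup>2) \<le> w (fst q)"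
    using base windows cover AE_space
  proof eventually_elim
    case (elim q)
    then have q: "fst q \<in> space L" by (auto simp: space_pair_measure)
    have "ennreal (min b ((?\<Delta> q)\<^sup>2)) \<le> V (fst q)"
    proof (cases "fst q \<in> C0")
      case False
      then have "ennreal (min b ((?\<Delta> q)\<^sup>2)) \<le> capped_osc b z n0 (fst q) * indicator (space L - C0) (fst q)" using elim(1) q by simp
      then show ?thesis unfolding V_def by (rule order_trans) simp
    next
      case True
      then obtain j where j: "fst q \<in> G 0 n0 j" using elim(3) by blast
      then have "fst q \<notin> Cv 0 (real (2 * 2 ^ j * n0))" by (simp add: G_def)
      then have "ennreal (min b ((?\<Delta> q)\<^sup>2)) \<le> capped_osc b z (2 * 2 ^ j * n0) (fst q)" using elim(2) by blast
      also have "\<dots> = (\<Sum>j\<in>{j}. capped_osc b z (2 * 2 ^ j * n0) (fst q) * indicator (G 0 n0 j) (fst q))" using j by simp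
      also have "\<dots> \<le> (\<Sum>j. capped_osc b z (2 * 2 ^ j * n0) (fst q) * indicator (G 0 n0 j) (fst q))"
        by (rule sum_le_suminf) auto
      also have "\<dots> \<le> V (fst q)" unfolding V_def by simp
      finally show ?thesis .
    qed
    then have "ennreal (min b ((?\<Delta> q)\<^sup>2)) \<le> ennreal (w (fst q))"
      unfolding w_ennreal by (intro min.boundedI) (auto intro: ennreal_leI)
    then show ?case using w_bounds(1) by simp
  qed
  with w_meas w_bounds w_int show ?thesis by blast
qed

end

section \<open>Integration over space and scales\<close>

context field_observable
begin

definition mean_square :: "(real ^ 'd \<Rightarrow> real \<Rightarrow> 'w \<Rightarrow> ereal) \<Rightarrow> real ^ 'd \<Rightarrow> real \<Rightarrow> ennreal" where
  "mean_square D x t = (\<integral>\<^sup>+\<omega>. e2ennreal ((D x t \<omega>)\<^sup>2) \<partial>M)"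

lemma version_measurable:
  assumes D: "osc_version M AX Z D"
    and [measurable]: "f \<in> borel_measurable K" "g \<in> borel_measurable K" "h \<in> K \<rightarrow>\<^sub>M M"
  shows "(\<lambda>y. e2ennreal ((D (f y) (g y) (h y))\<^sup>2)) \<in> borel_measurable K"
proof -
  have "(\<lambda>((x, l), \<omega>). D x l \<omega>) \<in> borel_measurable ((borel \<Otimes>\<^sub>M borel) \<Otimes>\<^sub>M M)"
    using D by (simp add: osc_version_def)
  then have "(\<lambda>y. (\<lambda>((x, l), \<omega>). D x l \<omega>) ((f y, g y), h y)) \<in> borel_measurable K"
    by (rule measurable_compose[rotated]) measurable
  then have [measurable]: "(\<lambda>y. D (f y) (g y) (h y)) \<in> borel_measurable K" by simp
  show ?thesis unfolding power2_eq_square by measurable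
qed

lemma mean_square_measurable:
  assumes D: "osc_version M AX Z D"
    and [measurable]: "f \<in> borel_measurable K" "g \<in> borel_measurable K"
  shows "(\<lambda>y. mean_square D (f y) (g y)) \<in> borel_measurable K"
proof -
  have "(\<lambda>p. e2ennreal ((D (f (fst p)) (g (fst p)) (snd p))\<^sup>2)) \<in> borel_measurable (K \<Otimes>\<^sub>M M)"
    by (rule version_measurable[OF D]) measurable
  then show ?thesis
    unfolding mean_square_def by (intro borel_measurable_nn_integral) (simp add: case_prod_beta')
qed

definition cell_mean_square :: "(real ^ 'd \<Rightarrow> real \<Rightarrow> 'w \<Rightarrow> ereal) \<Rightarrow> int ^ 'd \<Rightarrow> real \<Rightarrow> ennreal" where
  "cell_mean_square D z t = (\<integral>\<^sup>+x. mean_square D x t * indicator (open_cell z) x \<partial>lborel)"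

lemma cell_mean_square_measurable:
  assumes D: "osc_version M AX Z D"
  shows "cell_mean_square D z \<in> borel_measurable borel"
proof -
  have "(\<lambda>p. mean_square D (snd p) (fst p)) \<in> borel_measurable (borel \<Otimes>\<^sub>M lborel)"
    by (rule mean_square_measurable[OF D]) measurable
  then show ?thesis
    unfolding cell_mean_square_def[abs_def]
    by (intro lborel.borel_measurable_nn_integral) (simp add: case_prod_beta')
qed

text \<open>For almost every \<open>t\<close> and almost every \<open>x\<close> in the cell, the version \<open>D x t\<close> agrees with the oscillation
  over a ball that contains \<open>scale_ball (of_lattice z) s\<close>.\<close>

lemma capped_osc_le_cell_mean_square:
  assumes D: "osc_version M AX Z D"
  shows "AE t in lborel. real s \<le> t \<longrightarrow> (\<integral>\<^sup>+\<xi>. capped_osc b z s \<xi> \<partial>L) \<le> cell_mean_square D z t"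
proof -
  let ?e = "\<integral>\<^sup>+\<xi>. capped_osc b z s \<xi> \<partial>L"
  let ?Q = "\<lambda>x t. x \<in> open_cell z \<longrightarrow> real s \<le> t \<longrightarrow> ?e \<le> mean_square D x t"
  have "AE q in lborel \<Otimes>\<^sub>M lborel. 0 \<le> snd q \<longrightarrow>
      (AE \<omega> in M. D (fst q) (snd q) \<omega> = osc M AX (cball (fst q) (sqrt (real CARD('d)) * (snd q + 1))) Z \<omega>)"
    using D by (simp add: osc_version_def case_prod_beta')
  then have "AE q in lborel \<Otimes>\<^sub>M lborel. ?Q (fst q) (snd q)"
  proof eventually_elim
    case (elim q)
    show ?case
    proof (intro impI)
      assume x: "fst q \<in> open_cell z" and t: "real s \<le> snd q"
      let ?S = "scale_ball (of_lattice z :: real ^ 'd) (real s)"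
      let ?S' = "cball (fst q) (sqrt (real CARD('d)) * (snd q + 1))"
      have "0 \<le> snd q" using t by (rule order_trans[rotated]) simp
      with elim have D_eq: "AE \<omega> in M. D (fst q) (snd q) \<omega> = osc M AX ?S' Z \<omega>" by simp
      have "?S \<subseteq> ?S'"
        using x t by (intro scale_ball_subset_cball) (auto simp: open_cell_def intro: less_imp_le)
      note le = AE_configD[OF config_osc_mono[OF this]] and nonneg = AE_configD[OF config_osc_nonneg[of ?S]]
      have "?e = (\<integral>\<^sup>+\<omega>. capped_osc b z s (X \<omega>) \<partial>M)" by (rule nn_integral_config) measurable
      also have "\<dots> \<le> mean_square D (fst q) (snd q)"
        unfolding mean_square_def
      proof (rule nn_integral_mono_AE)
        show "AE \<omega> in M. capped_osc b z s (X \<omega>) \<le> e2ennreal ((D (fst q) (snd q) \<omega>)\<^sup>2)"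
          using le nonneg D_eq AE_space
        proof eventually_elim
          case (elim \<omega>)
          then have "D (fst q) (snd q) \<omega> = config_osc ?S' (X \<omega>)" using osc_eq[of \<omega> ?S'] by simp
          then show ?case using e2ennreal_square_mono[OF elim(2,1)] by (simp add: capped_osc_def min.coboundedI2)
        qed
      qed
      finally show "?e \<le> mean_square D (fst q) (snd q)" .
    qed
  qed
  from lborel_pair.AE_pair[OF this] have "AE x in lborel. AE t in lborel. ?Q x t" by simp
  moreover have "{q \<in> space (lborel \<Otimes>\<^sub>M lborel). ?Q (fst q) (snd q)} \<in> sets (lborel \<Otimes>\<^sub>M lborel)"
  proof -
    have [measurable]: "(\<lambda>q. mean_square D (fst q) (snd q)) \<in> borel_measurable (lborel \<Otimes>\<^sub>M lborel)"
      by (rule mean_square_measurable[OF D]) measurable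
    show ?thesis by measurable
  qed
  ultimately have "AE t in lborel. AE x in lborel. ?Q x t"
    using lborel_pair.AE_commute[of ?Q] by blast
  then show ?thesis
  proof eventually_elim
    case (elim t)
    show ?case
    proof
      assume t: "real s \<le> t"
      have "?e = (\<integral>\<^sup>+x. ?e * indicator (open_cell z) x \<partial>lborel)"
        by (subst nn_integral_cmult_indicator) (auto simp: emeasure_open_cell)
      also have "\<dots> \<le> cell_mean_square D z t"
        unfolding cell_mean_square_def using elim t
        by (intro nn_integral_mono_AE) (auto elim!: eventually_mono simp: indicator_def)
      finally show "?e \<le> cell_mean_square D z t" .
    qed
  qed
qed

lemma multiscale_osc_eq:
  assumes D: "osc_version M AX Z D" and p: "antimono_on {0..} p"
  shows "multiscale_osc M (weight CARD('d) R p) D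
    = (\<integral>\<^sup>+t. (\<integral>\<^sup>+x. mean_square D x t \<partial>lborel) * scale_density CARD('d) R p t \<partial>lborel)"
proof -
  note [measurable] = scale_density_measurable[OF p, of "CARD('d)" R]
  interpret Mt: pair_sigma_finite "lborel :: real measure" M ..
  have 3: "(\<lambda>q. e2ennreal ((D (snd q) (snd (fst q)) (fst (fst q)))\<^sup>2)) \<in> borel_measurable ((M \<Otimes>\<^sub>M (lborel :: real measure)) \<Otimes>\<^sub>M (lborel :: (real ^ 'd) measure))"
    by (rule version_measurable[OF D]) measurable
  then have inner [measurable]: "(\<lambda>q. \<integral>\<^sup>+x. e2ennreal ((D x (snd q) (fst q))\<^sup>2) \<partial>lborel) \<in> borel_measurable (M \<Otimes>\<^sub>M (lborel :: real measure))"
    by (intro lborel.borel_measurable_nn_integral) (simp add: case_prod_beta')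
  have inner': "(\<lambda>(t, \<omega>). (\<integral>\<^sup>+x. e2ennreal ((D x t \<omega>)\<^sup>2) \<partial>lborel)) \<in> borel_measurable ((lborel :: real measure) \<Otimes>\<^sub>M M)"
    using measurable_compose[OF measurable_pair_swap' inner] by (simp add: case_prod_beta')
  have "multiscale_osc M (weight CARD('d) R p) D
      = (\<integral>\<^sup>+\<omega>. (\<integral>\<^sup>+t. (\<integral>\<^sup>+x. e2ennreal ((D x t \<omega>)\<^sup>2) \<partial>lborel) * scale_density CARD('d) R p t \<partial>lborel) \<partial>M)"
    unfolding multiscale_osc_def scale_density_def by (simp add: mult.assoc)
  also have "\<dots> = (\<integral>\<^sup>+t. (\<integral>\<^sup>+\<omega>. (\<integral>\<^sup>+x. e2ennreal ((D x t \<omega>)\<^sup>2) \<partial>lborel) * scale_density CARD('d) R p t \<partial>M) \<partial>lborel)"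
    using inner' by (intro Mt.Fubini') (simp add: case_prod_beta')
  also have "\<dots> = (\<integral>\<^sup>+t. (\<integral>\<^sup>+x. mean_square D x t \<partial>lborel) * scale_density CARD('d) R p t \<partial>lborel)"
  proof (rule nn_integral_cong)
    fix t :: real
    interpret Mx: pair_sigma_finite "lborel :: (real ^ 'd) measure" M ..
    have m1: "(\<lambda>q. e2ennreal ((D (snd q) t (fst q))\<^sup>2)) \<in> borel_measurable (M \<Otimes>\<^sub>M (lborel :: (real ^ 'd) measure))"
      by (rule version_measurable[OF D]) measurable
    then have m2: "(\<lambda>\<omega>. \<integral>\<^sup>+x. e2ennreal ((D x t \<omega>)\<^sup>2) \<partial>lborel) \<in> borel_measurable M"
      by (intro lborel.borel_measurable_nn_integral) (simp add: case_prod_beta')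
    have m3: "(\<lambda>q. e2ennreal ((D (fst q) t (snd q))\<^sup>2)) \<in> borel_measurable ((lborel :: (real ^ 'd) measure) \<Otimes>\<^sub>M M)"
      by (rule version_measurable[OF D]) measurable
    have "(\<integral>\<^sup>+\<omega>. (\<integral>\<^sup>+x. e2ennreal ((D x t \<omega>)\<^sup>2) \<partial>lborel) * scale_density CARD('d) R p t \<partial>M)
        = (\<integral>\<^sup>+\<omega>. (\<integral>\<^sup>+x. e2ennreal ((D x t \<omega>)\<^sup>2) \<partial>lborel) \<partial>M) * scale_density CARD('d) R p t"
      by (rule nn_integral_multc[OF m2])
    also have "(\<integral>\<^sup>+\<omega>. (\<integral>\<^sup>+x. e2ennreal ((D x t \<omega>)\<^sup>2) \<partial>lborel) \<partial>M) = (\<integral>\<^sup>+x. mean_square D x t \<partial>lborel)"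
      unfolding mean_square_def using m3 by (intro Mx.Fubini') (simp add: case_prod_beta')
    finally show "(\<integral>\<^sup>+\<omega>. (\<integral>\<^sup>+x. e2ennreal ((D x t \<omega>)\<^sup>2) \<partial>lborel) * scale_density CARD('d) R p t \<partial>M)
        = (\<integral>\<^sup>+x. mean_square D x t \<partial>lborel) * scale_density CARD('d) R p t" .
  qed
  finally show ?thesis .
qed

text \<open>The cells are disjoint, so the sum of the integrals over them is at most the integral over space.\<close>

lemma sum_cells_le_multiscale_osc:
  assumes D: "osc_version M AX Z D" and p: "antimono_on {0..} p" and e: "inj e"
  shows "(\<Sum>k. \<integral>\<^sup>+t. cell_mean_square D (e k) t * scale_density CARD('d) R p t \<partial>lborel)
    \<le> multiscale_osc M (weight CARD('d) R p) D"
proof -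
  note [measurable] = scale_density_measurable[OF p, of "CARD('d)" R] cell_mean_square_measurable[OF D]
  have "(\<Sum>k. \<integral>\<^sup>+t. cell_mean_square D (e k) t * scale_density CARD('d) R p t \<partial>lborel)
      = (\<integral>\<^sup>+t. (\<Sum>k. cell_mean_square D (e k) t * scale_density CARD('d) R p t) \<partial>lborel)"
    by (rule nn_integral_suminf[symmetric]) measurable
  also have "\<dots> \<le> (\<integral>\<^sup>+t. (\<integral>\<^sup>+x. mean_square D x t \<partial>lborel) * scale_density CARD('d) R p t \<partial>lborel)"
  proof (rule nn_integral_mono)
    fix t :: real
    have [measurable]: "(\<lambda>x. mean_square D x t) \<in> borel_measurable lborel"
      by (rule mean_square_measurable[OF D]) measurable
    have "(\<Sum>k. cell_mean_square D (e k) t) = (\<integral>\<^sup>+x. (\<Sum>k. mean_square D x t * indicator (open_cell (e k)) x) \<partial>lborel)"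
      unfolding cell_mean_square_def by (rule nn_integral_suminf[symmetric]) measurable
    also have "\<dots> \<le> (\<integral>\<^sup>+x. mean_square D x t \<partial>lborel)"
    proof (rule nn_integral_mono)
      fix x :: "real ^ 'd"
      show "(\<Sum>k. mean_square D x t * indicator (open_cell (e k)) x) \<le> mean_square D x t"
      proof (cases "\<exists>k. x \<in> open_cell (e k)")
        case True
        then obtain k where k: "x \<in> open_cell (e k)" by blast
        have "x \<notin> open_cell (e j)" if "j \<noteq> k" for j
          using open_cell_disjoint[OF k, of "e j"] that e by (auto dest: injD)
        then have "(\<Sum>j. mean_square D x t * indicator (open_cell (e j)) x)
            = (\<Sum>j\<in>{k}. mean_square D x t * indicator (open_cell (e j)) x)"
          by (intro suminf_finite) auto
        then show ?thesis using k by simp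
      next
        case False
        then show ?thesis by simp
      qed
    qed
    finally show "(\<Sum>k. cell_mean_square D (e k) t * scale_density CARD('d) R p t)
        \<le> (\<integral>\<^sup>+x. mean_square D x t \<partial>lborel) * scale_density CARD('d) R p t"
      by (simp add: ennreal_suminf_multc mult_right_mono)
  qed
  also have "\<dots> = multiscale_osc M (weight CARD('d) R p) D"
    by (rule multiscale_osc_eq[OF D p, symmetric])
  finally show ?thesis .
qed

end

lemma lattice_enumeration:
  obtains e :: "nat \<Rightarrow> int ^ 'd" where "bij e"
proof -
  have "inj (\<lambda>n :: int. (\<chi> i. n) :: int ^ 'd)" by (auto simp: inj_def vec_eq_iff)
  then have "infinite (UNIV :: (int ^ 'd) set)"
    by (meson finite_imageD finite_subset infinite_UNIV_int subset_UNIV)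
  then have "bij_betw (from_nat_into (UNIV :: (int ^ 'd) set)) UNIV UNIV"
    by (intro bij_betw_from_nat_into) auto
  then show ?thesis by (rule that)
qed

lemma clip_square_diff_le:
  fixes x y :: real
  assumes "\<bar>f x - f y\<bar> \<le> \<bar>x - y\<bar>" "\<bar>f x\<bar> \<le> n" "\<bar>f y\<bar> \<le> n"
  shows "(f x - f y)\<^sup>2 \<le> min ((2 * n)\<^sup>2) ((x - y)\<^sup>2)"
proof -
  have "(f x - f y)\<^sup>2 \<le> (x - y)\<^sup>2" using assms(1) by (simp add: abs_le_square_iff)
  moreover have "\<bar>f x - f y\<bar> \<le> \<bar>2 * n\<bar>" using assms(2,3) by linarith
  then have "(f x - f y)\<^sup>2 \<le> (2 * n)\<^sup>2" by (simp only: abs_le_square_iff)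
  ultimately show ?thesis by simp
qed

theorem theorem2p8:
  fixes M :: "'w measure" and E :: "'i measure" and N :: "'m measure"
    and P :: "int ^ 'd \<Rightarrow> 'i set" and \<tau> :: "int ^ 'd \<Rightarrow> 'i \<Rightarrow> 'i"
    and X X' :: "'w \<Rightarrow> 'i \<Rightarrow> 'm"
    and A :: "('i \<Rightarrow> 'm) \<Rightarrow> real ^ 'd \<Rightarrow> real"
    and \<rho> :: "int ^ 'd \<Rightarrow> nat \<Rightarrow> 'w \<Rightarrow> real"
    and R :: real and \<pi>\<^sub>0 :: "real \<Rightarrow> real"
    and Z :: "'w \<Rightarrow> real" and D :: "real ^ 'd \<Rightarrow> real \<Rightarrow> 'w \<Rightarrow> ereal"
  assumes "prob_space M"
    and "lattice_partition E P" and "lattice_translation E P \<tau>"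
    and "X \<in> M \<rightarrow>\<^sub>M PiM (space E) (\<lambda>_. N)" and "completely_independent M N P X"
    and "X' \<in> M \<rightarrow>\<^sub>M PiM (space E) (\<lambda>_. N)" and "iid_copy M E N X X'"
    and "(\<lambda>(\<xi>, y). A \<xi> y) \<in> borel_measurable (PiM (space E) (\<lambda>_. N) \<Otimes>\<^sub>M borel)"
    and a: "\<And>x l. action_radius M E N P X X' A x l (\<rho> x l)"
    and b: "stationary_transformation M E \<tau> X A"
    and c: "\<And>x l r. 0 \<le> r \<Longrightarrow>
      {\<omega>\<in>space M. \<rho> x l \<omega> > r} \<in> sets (sigma_restrict M X N (nbhd P x (real l + r) - nbhd P x (real l)))"
    and "1 \<le> R"
    and "\<And>x l. R \<le> real l \<Longrightarrow> measure M {\<omega>\<in>space M. \<rho> x l \<omega> \<ge> real l} \<le> 1 / 4"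
    and "\<And>l. 0 \<le> l \<Longrightarrow> 0 \<le> \<pi>\<^sub>0 l" and "antimono_on {0..} \<pi>\<^sub>0"
    and "\<And>x l\<^sub>0 l. real l\<^sub>0 \<le> 1 / 4 * l \<Longrightarrow>
      measure M {\<omega>\<in>space M. 1 / 4 * l \<le> \<rho> x l\<^sub>0 \<omega> \<and> \<rho> x l\<^sub>0 \<omega> < l} \<le> \<pi>\<^sub>0 l"
    and "Z \<in> borel_measurable (sigma_restrict M (\<lambda>\<omega>. A (X \<omega>)) borel UNIV)"
    and "osc_version M (\<lambda>\<omega>. A (X \<omega>)) Z D"
  shows "(integrable M Z \<longrightarrow>
        ext_variance M Z \<le> ennreal (1 / 2) * multiscale_osc M (weight CARD('d) R \<pi>\<^sub>0) D) \<and>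
      (integrable M (\<lambda>\<omega>. (Z \<omega>)\<^sup>2) \<longrightarrow>
        ext_entropy M (\<lambda>\<omega>. (Z \<omega>)\<^sup>2)
          \<le> enn2ereal (2 * multiscale_osc M (weight CARD('d) R \<pi>\<^sub>0) D))"
proof -
  interpret prob_space M by fact
  interpret field_observable M E N P X X' A \<rho> Z
    using assms(2,4-8) a c assms(17) by unfold_locales auto
  note version = assms(18)
  let ?S = "multiscale_osc M (weight CARD('d) R \<pi>\<^sub>0) D"
  obtain e :: "nat \<Rightarrow> int ^ 'd" where e: "bij e" by (rule lattice_enumeration)
  interpret tensor: tensor_field L "space E" N "\<lambda>k. P (e k)"
  proof
    have P: "disjoint_family P" "(\<Union>z. P z) = space E" using assms(2) by (auto simp: lattice_partition_def)
    show "disjoint_family (\<lambda>k. P (e k))"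
      using P(1) e unfolding disjoint_family_on_def by (auto dest: bij_is_inj injD)
    have "(\<Union>k. P (e k)) = (\<Union>z. P z)" using bij_is_surj[OF e] by (metis image_image)
    then show "space E \<subseteq> (\<Union>k. P (e k))" using P(2) by simp
    show "config.splits (\<Union>k\<in>J. P (e k))" for J
      using splits_pieces[of "e ` J"] by (simp add: image_image)
  qed
  have weights: "\<exists>w. (\<forall>k. w k \<in> borel_measurable L) \<and> (\<forall>k \<xi>. 0 \<le> w k \<xi> \<and> w k \<xi> \<le> b) \<and>
      (\<forall>k. AE q in config.LL. min b ((obs (fst q) - obs (mix (P (e k)) (snd q) (fst q)))\<^sup>2) \<le> w k (fst q)) \<and>
      (\<Sum>k. ennreal (\<integral>\<xi>. w k \<xi> \<partial>L)) \<le> ?S" if b: "0 \<le> b" for b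
  proof -
    have "\<forall>k. \<exists>w. w \<in> borel_measurable L \<and> (\<forall>\<xi>. 0 \<le> w \<xi> \<and> w \<xi> \<le> b) \<and>
      (AE q in config.LL. min b ((obs (fst q) - obs (mix (P (e k)) (snd q) (fst q)))\<^sup>2) \<le> w (fst q)) \<and>
      ennreal (\<integral>\<xi>. w \<xi> \<partial>L) \<le> (\<integral>\<^sup>+t. cell_mean_square D (e k) t * scale_density CARD('d) R \<pi>\<^sub>0 t \<partial>lborel)"
      using assms(12-16) b
      by (intro allI resampling_weight_exists cell_mean_square_measurable[OF version] capped_osc_le_cell_mean_square[OF version]) auto
    from choice[OF this] obtain w where w: "\<And>k. w k \<in> borel_measurable L" "\<And>k \<xi>. 0 \<le> w k \<xi> \<and> w k \<xi> \<le> b"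
      "\<And>k. AE q in config.LL. min b ((obs (fst q) - obs (mix (P (e k)) (snd q) (fst q)))\<^sup>2) \<le> w k (fst q)"
      "\<And>k. ennreal (\<integral>\<xi>. w k \<xi> \<partial>L) \<le> (\<integral>\<^sup>+t. cell_mean_square D (e k) t * scale_density CARD('d) R \<pi>\<^sub>0 t \<partial>lborel)"
      by blast
    have "(\<Sum>k. ennreal (\<integral>\<xi>. w k \<xi> \<partial>L))
        \<le> (\<Sum>k. \<integral>\<^sup>+t. cell_mean_square D (e k) t * scale_density CARD('d) R \<pi>\<^sub>0 t \<partial>lborel)"
      by (intro suminf_le allI w(4)) auto
    also have "\<dots> \<le> ?S"
      by (rule sum_cells_le_multiscale_osc[OF version assms(15) bij_is_inj[OF e]])
    finally show ?thesis using w by (intro exI[of _ w]) blast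
  qed
  have transfer: "expectation (\<lambda>\<omega>. f (Z \<omega>)) = (\<integral>\<xi>. f (obs \<xi>) \<partial>L)" if "f \<in> borel_measurable borel" for f :: "real \<Rightarrow> real"
  proof -
    have "expectation (\<lambda>\<omega>. f (Z \<omega>)) = expectation (\<lambda>\<omega>. f (obs (X \<omega>)))"
      by (intro Bochner_Integration.integral_cong) (simp_all add: obs_eq)
    also have "\<dots> = (\<integral>\<xi>. f (obs \<xi>) \<partial>distr M L X)"
      by (intro integral_distr[symmetric] X_measL measurable_compose[OF obs_measurable that])
    finally show ?thesis by (simp only: distr_X)
  qed
  have "ext_variance M Z \<le> ennreal (1 / 2) * ?S" if "integrable M Z"
  proof (rule ext_variance_le_truncations[OF that])
    fix n :: nat
    define f where "f x = max (- real n) (min (real n) x)" for x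
    have [measurable]: "f \<in> borel_measurable borel" unfolding f_def by measurable
    have f: "\<bar>f x - f y\<bar> \<le> \<bar>x - y\<bar>" "\<bar>f x\<bar> \<le> real n" for x y by (auto simp: f_def)
    obtain w where w: "\<And>k. w k \<in> borel_measurable L" "\<And>k \<xi>. 0 \<le> w k \<xi> \<and> w k \<xi> \<le> (2 * real n)\<^sup>2"
      "\<And>k. AE q in config.LL. min ((2 * real n)\<^sup>2) ((obs (fst q) - obs (mix (P (e k)) (snd q) (fst q)))\<^sup>2) \<le> w k (fst q)"
      "(\<Sum>k. ennreal (\<integral>\<xi>. w k \<xi> \<partial>L)) \<le> ?S"
      using weights[of "(2 * real n)\<^sup>2"] by auto
    have "ennreal (\<integral>\<xi>. (f (obs \<xi>) - (\<integral>\<xi>. f (obs \<xi>) \<partial>L))\<^sup>2 \<partial>L) \<le> ennreal (1 / 2) * (\<Sum>k. ennreal (\<integral>\<xi>. w k \<xi> \<partial>L))"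
    proof (rule tensor.variance_le[where c = "real n" and c' = "(2 * real n)\<^sup>2"])
      show "AE q in config.LL. (f (obs (fst q)) - f (obs (mix (P (e k)) (snd q) (fst q))))\<^sup>2 \<le> w k (fst q)" for k
        using w(3)[of k] by eventually_elim (rule order_trans[OF clip_square_diff_le[OF f(1,2,2)]])
    qed (use w f in auto)
    also have "\<dots> \<le> ennreal (1 / 2) * ?S" using w(4) by (rule mult_left_mono) simp
    finally show "ennreal (variance (\<lambda>\<omega>. max (- real n) (min (real n) (Z \<omega>)))) \<le> ennreal (1 / 2) * ?S"
      using transfer[of f] transfer[of "\<lambda>x. (f x - (\<integral>\<xi>. f (obs \<xi>) \<partial>L))\<^sup>2"] by (simp add: f_def)
  qed
  moreover have "ext_entropy M (\<lambda>\<omega>. (Z \<omega>)\<^sup>2) \<le> enn2ereal (2 * ?S)" if Z2: "integrable M (\<lambda>\<omega>. (Z \<omega>)\<^sup>2)"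
  proof (rule ext_entropy_square_le_truncations[OF _ Z2])
    show "Z \<in> borel_measurable M"
      using measurable_compose[OF X_measL obs_measurable] by (subst measurable_cong[OF obs_eq]) auto
    fix n :: nat
    \<comment> \<open>The lower cutoff keeps the square of the observable away from \<open>0\<close>, where \<open>ln\<close> is unbounded.\<close>
    define f where "f x = max (1 / real (Suc n)) (min (real (Suc n)) \<bar>x\<bar>)" for x
    have [measurable]: "f \<in> borel_measurable borel" unfolding f_def by measurable
    define k0 where "k0 = real (Suc n)"
    have k0: "1 \<le> k0" "1 / k0 \<le> k0" by (auto simp: k0_def intro: order_trans[of _ 1])
    have f: "\<bar>f x - f y\<bar> \<le> \<bar>x - y\<bar>" "1 / k0 \<le> f x" "f x \<le> k0" for x y
      unfolding f_def k0_def[symmetric] using k0 by (auto simp: max_def min_def abs_if)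
    have f_abs: "\<bar>f x\<bar> \<le> k0" for x
    proof -
      have "0 < 1 / k0" using k0 by simp
      then show ?thesis using f(2)[of x] f(3)[of x] by linarith
    qed
    obtain w where w: "\<And>k. w k \<in> borel_measurable L" "\<And>k \<xi>. 0 \<le> w k \<xi> \<and> w k \<xi> \<le> (2 * k0)\<^sup>2"
      "\<And>k. AE q in config.LL. min ((2 * k0)\<^sup>2) ((obs (fst q) - obs (mix (P (e k)) (snd q) (fst q)))\<^sup>2) \<le> w k (fst q)"
      "(\<Sum>k. ennreal (\<integral>\<xi>. w k \<xi> \<partial>L)) \<le> ?S"
      using weights[of "(2 * k0)\<^sup>2"] by auto
    have "ennreal ((\<integral>\<xi>. (f (obs \<xi>))\<^sup>2 * ln ((f (obs \<xi>))\<^sup>2) \<partial>L) - (\<integral>\<xi>. (f (obs \<xi>))\<^sup>2 \<partial>L) * ln (\<integral>\<xi>. (f (obs \<xi>))\<^sup>2 \<partial>L))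
        \<le> 2 * (\<Sum>k. ennreal (\<integral>\<xi>. w k \<xi> \<partial>L))"
    proof (rule tensor.entropy_le[where lo = "1 / k0" and c = k0 and c' = "(2 * k0)\<^sup>2"])
      show "AE q in config.LL. (f (obs (fst q)) - f (obs (mix (P (e k)) (snd q) (fst q))))\<^sup>2 \<le> w k (fst q)" for k
        using w(3)[of k] by eventually_elim (rule order_trans[OF clip_square_diff_le[OF f(1) f_abs f_abs]])
    qed (use w f k0 in \<open>auto intro: divide_pos_pos\<close>)
    also have "\<dots> \<le> 2 * ?S" using w(4) by (rule mult_left_mono) simp
    finally show "ennreal (expectation (\<lambda>\<omega>. (max (1 / real (Suc n)) (min (real (Suc n)) \<bar>Z \<omega>\<bar>))\<^sup>2 * ln ((max (1 / real (Suc n)) (min (real (Suc n)) \<bar>Z \<omega>\<bar>))\<^sup>2))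
        - expectation (\<lambda>\<omega>. (max (1 / real (Suc n)) (min (real (Suc n)) \<bar>Z \<omega>\<bar>))\<^sup>2) * ln (expectation (\<lambda>\<omega>. (max (1 / real (Suc n)) (min (real (Suc n)) \<bar>Z \<omega>\<bar>))\<^sup>2))) \<le> 2 * ?S"
      using transfer[of "\<lambda>x. (f x)\<^sup>2 * ln ((f x)\<^sup>2)"] transfer[of "\<lambda>x. (f x)\<^sup>2"] unfolding f_def by simp
  qed
  ultimately show ?thesis by blast
qed

end
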